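(* Let $f:I\to I$ be a $(\lambda_c,H_0)$-Collet-Eckmann $S$-unimodal map satisfying the Benedicks-Carleson condition. (1) For any bounded function $v:I\to\mathbb{C}$, if the twisted cohomological equation (TCE) $$v(x)=\alpha(f(x))-f'(x)\,\alpha(x)\qquad \forall x\in I$$ admits a bounded solution $\alpha:I\to\mathbb{C}$ with $\alpha(c)=0$, then this solution is unique and $v$ satisfies the horizontality condition $$v(c)=-\sum_{j=0}^{\infty}\frac{v(f^j(c_1))}{(f^{j+1})'(c_1)}.$$ (2) Let $X:I\to\mathbb{C}$ be Lipschitz and let $v=X\circ f$. If $v$ satisfies the horizontality condition above, then there exists a continuous function $\alpha:I\to\mathbb{C}$ with $\alpha(c)=0$ solving the TCE. In addition, $\alpha(x)=\alpha_{cand}(x)$ for all $x\in I$ such that $f^j(x)=c$ for some $j\ge 0$, or such that the infinite series defining $\alpha_{cand}(x)$ converges absolutely.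
   Context: $I=[-1,1]$. A map $f:I\to I$ is $S$-unimodal if it is $C^3$ with negative Schwarzian derivative, $f(-1)=f(1)=-1$, $f'>0$ on $[-1,0)$, $f'<0$ on $(0,1]$, and $f''(0)<0$. Its critical point is $c=0$, and $c_k=f^k(c)$, $k\ge 0$. $f$ is $(\lambda_c,H_0)$-Collet-Eckmann if $\lambda_c>1$, $H_0\ge 1$ and $|(f^k)'(f(c))|\ge \lambda_c^k$ for all $k\ge H_0$. The Benedicks-Carleson condition: there exists $0<\gamma<\frac{\log\lambda_c}{4}$ such that $|f^k(c)-c|\ge e^{-\gamma k}$ for all $k\ge H_0$. The formal candidate $\alpha_{cand}$ (depending on $f$ and $v$): if $f^j(x)\neq c$ for all $j\ge 0$, $\alpha_{cand}(x)=-\sum_{j=0}^\infty \frac{v(f^j(x))}{(f^{j+1})'(x)}$ (a formal series); if there is $j\ge 0$ with $f^j(x)=c$ and $f^\ell(x)\ne c$ for $0\le \ell\le j-1$, $\alpha_{cand}(x)=-\sum_{\ell=0}^{j-1}\frac{v(f^\ell(x))}{(f^{\ell+1})'(x)}$ (in particular $\alpha_{cand}(c)=0$).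
   Formalization: The formal theorem also assumes that the boundary fixed point -1 is repelling, f'(-1)>1; without this, uniqueness in (1) is false, e.g. for v=0 and an even quartic f with f'(-1)<1 whose critical value maps to a repelling fixed point. *)

theory Defs
  imports "HOL-Analysis.Analysis"
begin

text \<open>
  Maps of the interval are represented by functions on the whole line, of which only the values
  on the interval matter: derivatives are taken within the interval (so they are one-sided at the
  endpoints).
\<close>

abbreviation I :: "real set" where
  "I \<equiv> {-1..1}"

abbreviation (input) c :: real where
  "c \<equiv> 0"

definition D :: "(real \<Rightarrow> real) \<Rightarrow> real \<Rightarrow> real" where
  "D f x = vector_derivative f (at x within I)"

lemma D_eqI:
  assumes "x \<in> I" "(f has_real_derivative d) (at x within I)"
  shows "D f x = d"
  using assms vector_derivative_within_closed_interval[of "-1" 1 x f d]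
  by (simp add: D_def has_real_derivative_iff_has_vector_derivative)

definition C3_on_I :: "(real \<Rightarrow> real) \<Rightarrow> bool" where
  "C3_on_I f \<longleftrightarrow>
     (\<forall>k<3. (D ^^ k) f differentiable_on I) \<and> continuous_on I ((D ^^ 3) f)"

definition schwarzian :: "(real \<Rightarrow> real) \<Rightarrow> real \<Rightarrow> real" where
  "schwarzian f x = (D ^^ 3) f x / D f x - 3 / 2 * ((D ^^ 2) f x / D f x)\<^sup>2"

text \<open>
  The Schwarzian derivative is only defined off the critical point. The definition does not force
  the boundary fixed point -1 to be repelling, not even for Collet-Eckmann maps: there are such
  maps with -1 attracting.
\<close>

definition S_unimodal :: "(real \<Rightarrow> real) \<Rightarrow> bool" where
  "S_unimodal f \<longleftrightarrow>
     f \<in> I \<rightarrow> I \<and> C3_on_I f \<and> (\<forall>x\<in>I - {c}. schwarzian f x < 0) \<and>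
     f (-1) = -1 \<and> f 1 = -1 \<and>
     (\<forall>x\<in>{-1..<0}. D f x > 0) \<and> (\<forall>x\<in>{0<..1}. D f x < 0) \<and>
     (D ^^ 2) f c < 0"

definition collet_eckmann :: "real \<Rightarrow> nat \<Rightarrow> (real \<Rightarrow> real) \<Rightarrow> bool" where
  "collet_eckmann lam H0 f \<longleftrightarrow>
     lam > 1 \<and> H0 \<ge> 1 \<and> (\<forall>k\<ge>H0. \<bar>D (f ^^ k) (f c)\<bar> \<ge> lam ^ k)"

definition benedicks_carleson :: "real \<Rightarrow> nat \<Rightarrow> (real \<Rightarrow> real) \<Rightarrow> bool" where
  "benedicks_carleson lam H0 f \<longleftrightarrow>
     (\<exists>g. 0 < g \<and> g < ln lam / 4 \<and> (\<forall>k\<ge>H0. \<bar>(f ^^ k) c - c\<bar> \<ge> exp (- g * real k)))"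

definition TCE :: "(real \<Rightarrow> real) \<Rightarrow> (real \<Rightarrow> complex) \<Rightarrow> (real \<Rightarrow> complex) \<Rightarrow> bool" where
  "TCE f v \<alpha> \<longleftrightarrow> (\<forall>x\<in>I. v x = \<alpha> (f x) - of_real (D f x) * \<alpha> x)"

definition cand_term :: "(real \<Rightarrow> real) \<Rightarrow> (real \<Rightarrow> complex) \<Rightarrow> real \<Rightarrow> nat \<Rightarrow> complex" where
  "cand_term f v x j = v ((f ^^ j) x) / of_real (D (f ^^ (j + 1)) x)"

text \<open>Convergence of the series is part of the condition.\<close>

definition horizontal :: "(real \<Rightarrow> real) \<Rightarrow> (real \<Rightarrow> complex) \<Rightarrow> bool" where
  "horizontal f v \<longleftrightarrow>
     summable (cand_term f v (f c)) \<and> v c = - (\<Sum>j. cand_term f v (f c) j)"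

text \<open>
  Where the infinite series diverges, the candidate is a purely formal expression and the value
  given here has no meaning.
\<close>

definition alpha_cand :: "(real \<Rightarrow> real) \<Rightarrow> (real \<Rightarrow> complex) \<Rightarrow> real \<Rightarrow> complex" where
  "alpha_cand f v x =
     (if \<exists>j. (f ^^ j) x = c
      then - (\<Sum>l < (LEAST j. (f ^^ j) x = c). cand_term f v x l)
      else - (\<Sum>j. cand_term f v x j))"

end

theory Submission
  imports Defs
begin

text \<open>
  Write \<open>c\<^sub>k = f\<^sup>k(0)\<close>, and let \<open>S\<^sub>n(x)\<close> be the sum of the first \<open>n\<close> terms of the formal
  candidate (\<open>psum\<close>). As long as the orbit of \<open>x\<close> has not met the critical point, every solution
  of the equation satisfies \<open>\<alpha>(x) = S\<^sub>n(x) + \<alpha>(f\<^sup>n x) / (f\<^sup>n)'(x)\<close> (\<open>TCE_iterate\<close>). So a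
  bounded solution is approximated by \<open>S\<^sub>n\<close> wherever \<open>(f\<^sup>n)'\<close> is large, and the theorem rests on
  two facts about expansion.

  (1) If the orbit of \<open>x\<close> never meets the critical point, then the derivatives \<open>(f\<^sup>n)'(x)\<close> are
  unbounded (\<open>derivatives_unbounded\<close>). Hence bounded solutions are unique; at \<open>x = c\<^sub>1\<close>, where the
  equation at 0 says \<open>\<alpha>(c\<^sub>1) = v(0)\<close>, the approximation is the horizontality condition.

  (2) A point \<open>w\<close> close to 0 has an orbit that follows the critical orbit during a bound period of
  length \<open>p\<close>. Horizontality makes \<open>S\<^sub>p(f w)\<close> equal to \<open>v(0)\<close> up to \<open>o(\<bar>w\<bar>)\<close>, and the derivative
  over the whole period is large (\<open>bound_period_cancellation\<close>). Hence the finite sums that define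
  the candidate on the preimages of 0 are bounded uniformly (\<open>ex_preimage_bound\<close>) and tend to 0
  at 0. The preimages of 0 are dense (\<open>precritical_dense\<close>); limits of the finite sums extend
  the candidate to the other points, by (1) in a unique way, and the same approximation proves
  that the extension solves the equation and is continuous (\<open>continuous_solution_exists\<close>).

  The expansion comes from the critical orbit alone. Negative Schwarzian derivative gives two
  inequalities for monotone branches that are stable under composition
  (\<open>iterate_length_expands\<close>, \<open>iterate_koebe\<close>). To bound \<open>(f\<^sup>n)'(x)\<close> from below, a small interval
  around \<open>f\<^sup>n x\<close> is pulled back along the orbit. If the pullback is monotone,
  \<open>iterate_koebe\<close> gives the bound. If not, the interval contains some \<open>c\<^sub>N\<close>, and the interval
  between \<open>c\<^sub>1\<close> and a point of the orbit of \<open>x\<close> is mapped into it by \<open>f\<^sup>N\<^sup>-\<^sup>1\<close>; since the derivative at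
  \<open>c\<^sub>1\<close> is huge, the derivative at the other end is tiny, contrary to what is already known
  for shorter orbit pieces (\<open>expansion_principle\<close>). For returns to distance \<open>R\<close> of 0 the interval is
  \<open>[-5R, 5R]\<close>, and slow recurrence gives a derivative at least of order \<open>R\<close> to the power -4 at \<open>c\<^sub>1\<close>,
  which closes the induction. Orbits that stay away from 0 are treated with intervals of fixed size; there a monotone
  branch on a fixed interval at all times is excluded by \<open>no_escaping_interval\<close>, and the repelling
  end point -1 takes care of orbits that come close to the boundary.
\<close>

section \<open>Maps with a convex inverse square root of the derivative\<close>

lemma mvt_real_within:
  fixes F :: "real \<Rightarrow> real"
  assumes "p < q" and "\<And>t. t \<in> {p..q} \<Longrightarrow> (F has_real_derivative F' t) (at t within {p..q})"
  obtains z where "p < z" "z < q" "F q - F p = F' z * (q - p)"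
  using mvt_simple[OF assms(1), of F "\<lambda>z. (*) (F' z)"] assms(2)
  by (auto simp: has_field_derivative_def)

lemma derivative_le_imp_increment_le:
  fixes F G :: "real \<Rightarrow> real"
  assumes "p \<le> q"
    and F: "\<And>t. t \<in> {p..q} \<Longrightarrow> (F has_real_derivative F' t) (at t within {p..q})"
    and G: "\<And>t. t \<in> {p..q} \<Longrightarrow> (G has_real_derivative G' t) (at t within {p..q})"
    and le: "\<And>t. t \<in> {p<..<q} \<Longrightarrow> F' t \<le> G' t"
  shows "F q - F p \<le> G q - G p"
proof (cases "p = q")
  case False
  then have "p < q" using assms(1) by simp
  obtain z where z: "p < z" "z < q" "(G q - F q) - (G p - F p) = (G' z - F' z) * (q - p)"
    using mvt_real_within[of p q "\<lambda>t. G t - F t" "\<lambda>t. G' t - F' t"] \<open>p < q\<close>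
      DERIV_diff[OF G F] by blast
  have "(G' z - F' z) * (q - p) \<ge> 0" using le[of z] z \<open>p < q\<close> by simp
  with z(3) show ?thesis by linarith
qed simp

text \<open>
  A Moebius map with linear denominator \<open>l t = k + s (t - x)\<close> has derivative \<open>1/l\<^sup>2\<close>:
  these are the maps for which the inverse square root of the derivative is exactly affine, and
  maps with convex inverse square root of the derivative are compared with them.
\<close>
lemma moebius_has_derivative:
  fixes k s x :: real
  assumes "k \<noteq> 0" "k + s * (t - x) \<noteq> 0"
  shows "((\<lambda>t. (t - x) / (k * (k + s * (t - x)))) has_real_derivative
          1 / (k + s * (t - x))\<^sup>2) (at t within S)"
  using assms
  by (auto intro!: derivative_eq_intros simp: divide_simps power2_eq_square) (simp add: algebra_simps)

text \<open>
  For an increasing map \<open>F\<close> put \<open>\<phi> = 1 / sqrt F'\<close>. Negative Schwarzian derivative of \<open>F\<close> means strict convexity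
  of \<phi>; expressed by an increasing \<open>\<phi>'\<close>, it combines well with the mean value theorem.
\<close>
locale convex_root =
  fixes F \<phi> \<phi>' :: "real \<Rightarrow> real" and a b :: real
  assumes F: "\<And>t. t \<in> {a..b} \<Longrightarrow> (F has_real_derivative 1 / (\<phi> t)\<^sup>2) (at t within {a..b})"
    and phi: "\<And>t. t \<in> {a..b} \<Longrightarrow> (\<phi> has_real_derivative \<phi>' t) (at t within {a..b})"
    and pos: "\<And>t. t \<in> {a..b} \<Longrightarrow> 0 < \<phi> t"
    and incr: "\<And>t u. a \<le> t \<Longrightarrow> t < u \<Longrightarrow> u \<le> b \<Longrightarrow> \<phi>' t < \<phi>' u"
begin

lemma mvt_F:
  assumes "a \<le> p" "p < q" "q \<le> b"
  obtains z where "p < z" "z < q" "F q - F p = 1 / (\<phi> z)\<^sup>2 * (q - p)"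
proof -
  have "(F has_real_derivative 1 / (\<phi> t)\<^sup>2) (at t within {p..q})" if "t \<in> {p..q}" for t
    using assms that by (intro DERIV_subset[OF F]) auto
  from mvt_real_within[OF assms(2) this] that show ?thesis by blast
qed

lemma mvt_phi:
  assumes "a \<le> p" "p < q" "q \<le> b"
  obtains z where "p < z" "z < q" "\<phi> q - \<phi> p = \<phi>' z * (q - p)"
proof -
  have "(\<phi> has_real_derivative \<phi>' t) (at t within {p..q})" if "t \<in> {p..q}" for t
    using assms that by (intro DERIV_subset[OF phi]) auto
  from mvt_real_within[OF assms(2) this] that show ?thesis by blast
qed

lemma strict_mono_F: "F t < F u" if tu: "a \<le> t" "t < u" "u \<le> b"
proof -
  obtain z where z: "t < z" "z < u" "F u - F t = 1 / (\<phi> z)\<^sup>2 * (u - t)"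
    by (rule mvt_F[OF tu])
  have "0 < 1 / (\<phi> z)\<^sup>2 * (u - t)" using pos[of z] z that by simp
  then show ?thesis using z(3) by linarith
qed

lemma tangent_below: "\<phi> x + \<phi>' x * (t - x) \<le> \<phi> t" if xt: "x \<in> {a..b}" "t \<in> {a..b}"
proof (cases t x rule: linorder_cases)
  case less
  obtain z where z: "t < z" "z < x" "\<phi> x - \<phi> t = \<phi>' z * (x - t)"
    by (rule mvt_phi[OF _ less]) (use xt in auto)
  have "\<phi>' z * (x - t) \<le> \<phi>' x * (x - t)"
    using incr[of z x] z that less by (intro mult_right_mono) auto
  then show ?thesis using z(3) by (simp add: algebra_simps)
next
  case greater
  obtain z where z: "x < z" "z < t" "\<phi> t - \<phi> x = \<phi>' z * (t - x)"
    by (rule mvt_phi[OF _ greater]) (use xt in auto)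
  have "\<phi>' x * (t - x) \<le> \<phi>' z * (t - x)"
    using incr[of x z] z that greater by (intro mult_right_mono) auto
  then show ?thesis using z(3) by (simp add: algebra_simps)
qed simp

lemma chord_above: "\<phi> t < \<phi> a + (\<phi> b - \<phi> a) / (b - a) * (t - a)" if ab: "a < t" "t < b"
proof -
  obtain z1 where z1: "a < z1" "z1 < t" "\<phi> t - \<phi> a = \<phi>' z1 * (t - a)"
    by (rule mvt_phi[OF order_refl ab(1)]) (use ab in auto)
  obtain z2 where z2: "t < z2" "z2 < b" "\<phi> b - \<phi> t = \<phi>' z2 * (b - t)"
    by (rule mvt_phi[OF _ ab(2) order_refl]) (use ab in auto)
  have "\<phi>' z1 < \<phi>' z2" using incr[of z1 z2] z1 z2 by simp
  then have "\<phi>' z1 * (t - a) * (b - t) < \<phi>' z2 * (b - t) * (t - a)"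
    using that by (simp add: mult.commute mult.left_commute)
  then have "(\<phi> t - \<phi> a) * (b - t) < (\<phi> b - \<phi> t) * (t - a)" using z1(3) z2(3) by simp
  then have "(\<phi> t - \<phi> a) * (b - a) < (\<phi> b - \<phi> a) * (t - a)" by (simp add: algebra_simps)
  then show ?thesis using that by (simp add: field_simps)
qed

text \<open>
  The chord of \<phi> lies above \<phi>, so \<open>F\<close> grows faster than the Moebius map with the same derivatives at
  both ends, whose increment is the geometric mean of the two derivatives times the length.
\<close>
lemma length_expands:
  assumes "a < b"
  shows "(b - a) / (\<phi> a * \<phi> b) < F b - F a"
proof -
  define s where "s = (\<phi> b - \<phi> a) / (b - a)"
  define l where "l t = \<phi> a + s * (t - a)" for t
  define m where "m t = (t - a) / (\<phi> a * (\<phi> a + s * (t - a)))" for t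
  have lb: "l b = \<phi> b" using assms by (simp add: l_def s_def)
  have lpos: "0 < l t" if "t \<in> {a..b}" for t
  proof (cases "t = a \<or> t = b")
    case True then show ?thesis using pos lb assms by (auto simp: l_def)
  next
    case False
    then have "\<phi> t < l t" using chord_above[of t] that by (simp add: l_def s_def)
    then show ?thesis using pos[OF that] by linarith
  qed
  have dm: "(m has_real_derivative 1 / (l t)\<^sup>2) (at t within S)" if "t \<in> {a..b}" for t S
    unfolding m_def l_def
    by (rule moebius_has_derivative) (use lpos[OF that] pos[of a] assms l_def in auto)
  obtain z where z: "a < z" "z < b" "(F b - m b) - (F a - m a) = (1 / (\<phi> z)\<^sup>2 - 1 / (l z)\<^sup>2) * (b - a)"
    using mvt_real_within[of a b "\<lambda>t. F t - m t" "\<lambda>t. 1 / (\<phi> t)\<^sup>2 - 1 / (l t)\<^sup>2"] assms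
      DERIV_diff[OF F dm] by blast
  have "\<phi> z < l z" using chord_above[of z] z by (simp add: l_def s_def)
  then have "(\<phi> z)\<^sup>2 < (l z)\<^sup>2" using pos[of z] z by (intro power_strict_mono) auto
  then have "1 / (l z)\<^sup>2 < 1 / (\<phi> z)\<^sup>2" using pos[of z] lpos[of z] z by (intro divide_strict_left_mono) auto
  then have "0 < (1 / (\<phi> z)\<^sup>2 - 1 / (l z)\<^sup>2) * (b - a)" using assms by simp
  with z(3) have "m b - m a < F b - F a" by linarith
  moreover have "m b - m a = (b - a) / (\<phi> a * \<phi> b)" using lb by (simp add: m_def l_def)
  ultimately show ?thesis by simp
qed

text \<open>
  The tangent of \<phi> at \<open>x\<close> lies below \<phi>, so \<open>F\<close> grows more slowly than the corresponding Moebius map.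
  If the tangent vanishes before \<open>y\<close>, the left-hand side is not positive.
\<close>
lemma tangent_bound:
  assumes x: "x \<in> {a..b}" and y: "y \<in> {a..b}" and "x \<noteq> y"
  shows "\<phi> x * (\<phi> x / \<bar>y - x\<bar> + sgn (y - x) * \<phi>' x) \<le> 1 / \<bar>F y - F x\<bar>"
proof -
  define s where "s = \<phi>' x"
  define l where "l t = \<phi> x + s * (t - x)" for t
  define m where "m t = (t - x) / (\<phi> x * (\<phi> x + s * (t - x)))" for t
  have px: "0 < \<phi> x" using pos x by simp
  have eq: "\<phi> x / \<bar>y - x\<bar> + sgn (y - x) * \<phi>' x = l y / \<bar>y - x\<bar>"
    using \<open>x \<noteq> y\<close> by (auto simp: l_def s_def sgn_if abs_if field_simps)
  have Fne: "0 < \<bar>F y - F x\<bar>"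
    using strict_mono_F[of x y] strict_mono_F[of y x] x y \<open>x \<noteq> y\<close> by (cases x y rule: linorder_cases) auto
  show ?thesis
  proof (cases "l y \<le> 0")
    case True
    then have "\<phi> x * (\<phi> x / \<bar>y - x\<bar> + sgn (y - x) * \<phi>' x) \<le> 0"
      unfolding eq using px by (simp add: mult_le_0_iff divide_le_0_iff)
    also have "0 \<le> 1 / \<bar>F y - F x\<bar>" by simp
    finally show ?thesis .
  next
    case False
    define p q where "p = min x y" and "q = max x y"
    have pq: "p < q" "a \<le> p" "q \<le> b" using x y \<open>x \<noteq> y\<close> by (auto simp: p_def q_def)
    have lpos: "0 < l t" if "t \<in> {p..q}" for t
    proof (cases "y < x")
      case True
      then have t: "y \<le> t" "t \<le> x" using that by (auto simp: p_def q_def)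
      show ?thesis
      proof (cases "s \<ge> 0")
        case True
        then have "l y \<le> l t" using t by (simp add: l_def mult_left_mono)
        then show ?thesis using False by simp
      next
        assume "\<not> 0 \<le> s"
        then have "0 \<le> s * (t - x)" using t by (simp add: mult_nonpos_nonpos)
        then show ?thesis using px by (simp add: l_def)
      qed
    next
      assume "\<not> y < x"
      then have t: "x \<le> t" "t \<le> y" using that by (auto simp: p_def q_def)
      show ?thesis
      proof (cases "s \<ge> 0")
        case True
        then have "0 \<le> s * (t - x)" using t by simp
        then show ?thesis using px by (simp add: l_def)
      next
        assume "\<not> 0 \<le> s"
        then have "l y \<le> l t" using t by (simp add: l_def mult_left_mono_neg)
        then show ?thesis using False by simp
      qed
    qed
    have dF: "(F has_real_derivative 1 / (\<phi> t)\<^sup>2) (at t within {p..q})" if "t \<in> {p..q}" for t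
      using F[of t] that pq by (intro DERIV_subset[OF F]) auto
    have dm: "(m has_real_derivative 1 / (l t)\<^sup>2) (at t within {p..q})" if "t \<in> {p..q}" for t
      unfolding m_def l_def
      by (rule moebius_has_derivative) (use lpos[OF that] px l_def in auto)
    have "F q - F p \<le> m q - m p"
    proof (rule derivative_le_imp_increment_le[OF _ dF dm])
      fix t assume t: "t \<in> {p<..<q}"
      have "l t \<le> \<phi> t" using tangent_below[of x t] x t pq by (simp add: l_def s_def)
      then have "(l t)\<^sup>2 \<le> (\<phi> t)\<^sup>2" using lpos[of t] t by (intro power_mono) auto
      then show "1 / (\<phi> t)\<^sup>2 \<le> 1 / (l t)\<^sup>2"
        using lpos[of t] t by (intro divide_left_mono) (auto simp: zero_less_mult_iff)
    qed (use pq in auto)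
    moreover have "m q - m p = \<bar>y - x\<bar> / (\<phi> x * l y)"
    proof -
      have "m x = 0" "m y = (y - x) / (\<phi> x * l y)" by (auto simp: m_def l_def)
      then show ?thesis using False px by (cases "x < y") (auto simp: p_def q_def min_def max_def field_simps)
    qed
    moreover have "F q - F p = \<bar>F y - F x\<bar>"
      using strict_mono_F[of p q] pq by (cases "x < y") (auto simp: p_def q_def)
    ultimately have le: "\<bar>F y - F x\<bar> \<le> \<bar>y - x\<bar> / (\<phi> x * l y)" by simp
    have "\<phi> x * (l y / \<bar>y - x\<bar>) = 1 / (\<bar>y - x\<bar> / (\<phi> x * l y))" by simp
    also have "\<dots> \<le> 1 / \<bar>F y - F x\<bar>"
      using le Fne by (intro divide_left_mono mult_pos_pos order.strict_trans2[OF Fne le]) auto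
    finally show ?thesis unfolding eq .
  qed
qed

text \<open>
  Adding the tangent bounds to the left and to the right of \<open>x\<close> cancels the unknown slope \<open>\<phi>' x\<close>.
\<close>
lemma koebe:
  assumes "a < x" "x < b"
  shows "1 / (x - a) + 1 / (b - x) \<le> 1 / (\<phi> x)\<^sup>2 * (1 / (F x - F a) + 1 / (F b - F x))"
proof -
  have px: "0 < \<phi> x" using pos[of x] assms by simp
  have "\<phi> x * (\<phi> x / (x - a) - \<phi>' x) \<le> 1 / (F x - F a)"
    using tangent_bound[of x a] assms strict_mono_F[of a x] by (simp add: abs_if)
  moreover have "\<phi> x * (\<phi> x / (b - x) + \<phi>' x) \<le> 1 / (F b - F x)"
    using tangent_bound[of x b] assms strict_mono_F[of x b] by (simp add: abs_if)
  ultimately have "(\<phi> x)\<^sup>2 * (1 / (x - a) + 1 / (b - x)) \<le> 1 / (F x - F a) + 1 / (F b - F x)"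
    by (simp add: algebra_simps power2_eq_square)
  then show ?thesis using px by (simp add: field_simps)
qed

end

section \<open>Auxiliary facts on sequences, sums and self-maps of an interval\<close>

lemma ex_least_value:
  fixes h :: "nat \<Rightarrow> real"
  assumes "0 < n"
  obtains m where "m < n" "\<And>j. j < n \<Longrightarrow> h m \<le> h j"
proof -
  have "Min (h ` {..<n}) \<in> h ` {..<n}" using assms by (intro Min_in) auto
  then obtain m where "m < n" "h m = Min (h ` {..<n})" by auto
  then show ?thesis by (intro that[of m]) auto
qed

text \<open>
  An increasing self-map of an interval moves all iterates of a point in the same direction.
\<close>
lemma monotone_self_map_converges:
  fixes h :: "real \<Rightarrow> real"
  assumes "continuous_on {u..v} h" "h ` {u..v} \<subseteq> {u..v}"
    and mono: "\<And>y z. u \<le> y \<Longrightarrow> y \<le> z \<Longrightarrow> z \<le> v \<Longrightarrow> h y \<le> h z" and x: "x \<in> {u..v}"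
  obtains l where "l \<in> {u..v}" "h l = l" "(\<lambda>n. (h ^^ n) x) \<longlonglongrightarrow> l"
proof -
  let ?s = "\<lambda>n. (h ^^ n) x"
  have in_uv: "?s n \<in> {u..v}" for n
  proof (induction n)
    case (Suc n)
    then have "h (?s n) \<in> h ` {u..v}" by blast
    then show ?case using assms(2) by auto
  qed (use x in simp)
  have "monoseq ?s"
  proof (cases "x \<le> h x")
    case True
    have "?s n \<le> ?s (Suc n)" for n
    proof (induction n)
      case (Suc n)
      then show ?case using mono[of "?s n" "?s (Suc n)"] in_uv[of n] in_uv[of "Suc n"] by auto
    qed (use True in simp)
    then show ?thesis by (simp only: monoseq_Suc) blast
  next
    case False
    have "?s (Suc n) \<le> ?s n" for n
    proof (induction n)
      case (Suc n)
      then show ?case using mono[of "?s (Suc n)" "?s n"] in_uv[of n] in_uv[of "Suc n"] by auto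
    qed (use False in simp)
    then show ?thesis by (simp only: monoseq_Suc) blast
  qed
  moreover have "Bseq ?s"
    using in_uv by (intro BseqI'[of _ "\<bar>u\<bar> + \<bar>v\<bar>"]) (auto simp: abs_if, (smt (verit) in_uv atLeastAtMost_iff)+)
  ultimately obtain l where l: "?s \<longlonglongrightarrow> l"
    using Bseq_monoseq_convergent convergent_def by blast
  have luv: "l \<in> {u..v}" using closed_sequentially[OF closed_atLeastAtMost _ l] in_uv by blast
  have "(\<lambda>n. h (?s n)) \<longlonglongrightarrow> h l"
    using continuous_on_tendsto_compose[OF assms(1) l luv] in_uv by simp
  moreover have "(\<lambda>n. h (?s n)) \<longlonglongrightarrow> l"
    using LIMSEQ_Suc[OF l] by simp
  ultimately have "h l = l" using LIMSEQ_unique by blast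
  then show ?thesis using luv l that by blast
qed

text \<open>
  A point of \<open>[-R, R]\<close> has room on both sides in \<open>[-5R, 5R]\<close>; the factor 5 makes the resulting constant 12/5
  larger than 2.
\<close>
lemma space_in_fivefold:
  fixes e R y :: real
  assumes "\<bar>y\<bar> \<le> R" "0 < R" "e \<le> 12 / 5 * R"
  shows "e * (5 * R - - (5 * R)) \<le> (y - - (5 * R)) * (5 * R - y)"
proof -
  have "y\<^sup>2 \<le> R\<^sup>2" using assms by (intro abs_le_square_iff[THEN iffD1]) auto
  moreover have "e * (5 * R - - (5 * R)) \<le> 12 / 5 * R * (5 * R - - (5 * R))"
    using assms by (intro mult_right_mono) auto
  moreover have "12 / 5 * R * (5 * R - - (5 * R)) = 24 * R\<^sup>2" by (simp add: power2_eq_square)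
  moreover have "(y - - (5 * R)) * (5 * R - y) = 25 * R\<^sup>2 - y\<^sup>2" by (simp add: power2_eq_square algebra_simps)
  ultimately show ?thesis by linarith
qed

lemma bounded_sequence_close_pair:
  fixes e :: "nat \<Rightarrow> real"
  assumes "\<And>n. e n \<in> {u..v}" "0 < l"
  obtains i j where "i < j" "\<bar>e i - e j\<bar> < l"
proof -
  obtain y r where r: "strict_mono r" "(e \<circ> r) \<longlonglongrightarrow> y"
    using compact_Icc[of u v] assms(1) unfolding compact_def by metis
  from r(2) have "Cauchy (e \<circ> r)" by (rule LIMSEQ_imp_Cauchy)
  then obtain M where "\<forall>m\<ge>M. \<forall>n\<ge>M. dist ((e \<circ> r) m) ((e \<circ> r) n) < l"
    using assms(2) unfolding Cauchy_def by blast
  then have "\<bar>e (r M) - e (r (Suc M))\<bar> < l" by (auto simp: dist_real_def)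
  moreover have "r M < r (Suc M)" using r(1) by (simp add: strict_mono_Suc_iff)
  ultimately show ?thesis using that by blast
qed

lemma sum_lessThan_add:
  "(\<Sum>j<m + n. h j) = (\<Sum>j<m. h j) + (\<Sum>j<n. h (m + j))" for h :: "nat \<Rightarrow> 'a :: comm_monoid_add"
  by (induction n) (auto simp: add.assoc)

lemma prod_near_one:
  fixes q \<epsilon> :: "nat \<Rightarrow> real"
  assumes "\<And>i. i < n \<Longrightarrow> \<bar>q i - 1\<bar> \<le> \<epsilon> i" "(\<Sum>i<n. \<epsilon> i) \<le> 1 / 4"
  shows "\<bar>(\<Prod>i<n. q i) - 1\<bar> \<le> 2 * (\<Sum>i<n. \<epsilon> i)"
  using assms
proof (induction n)
  case (Suc n)
  have e: "0 \<le> \<epsilon> i" if "i < Suc n" for i using Suc.prems(1)[OF that] by (meson abs_ge_zero order_trans)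
  have "(\<Sum>i<n. \<epsilon> i) \<le> 1 / 4" using Suc.prems(2) e[of n] by simp
  then have IH: "\<bar>(\<Prod>i<n. q i) - 1\<bar> \<le> 2 * (\<Sum>i<n. \<epsilon> i)" using Suc by simp
  have "\<bar>\<Prod>i<n. q i\<bar> \<le> 2" using IH \<open>(\<Sum>i<n. \<epsilon> i) \<le> 1 / 4\<close> by (simp add: abs_le_iff)
  then have "\<bar>(\<Prod>i<n. q i) * (q n - 1)\<bar> \<le> 2 * \<epsilon> n"
    unfolding abs_mult using Suc.prems(1)[of n] by (intro mult_mono) auto
  moreover have "(\<Prod>i<Suc n. q i) - 1 = (\<Prod>i<n. q i) * (q n - 1) + ((\<Prod>i<n. q i) - 1)"
    by (simp add: algebra_simps)
  ultimately show ?case using IH by (simp add: abs_le_iff)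
qed simp

lemma sum_exp_le:
  assumes "0 < (a::real)"
  shows "(\<Sum>i<n. exp (- a * real i)) \<le> 1 / (1 - exp (- a))"
proof -
  have eq: "exp (- a * real i) = exp (- a) ^ i" for i by (simp add: exp_of_nat_mult[symmetric] mult.commute)
  have "(\<Sum>i<n. exp (- a) ^ i) \<le> (\<Sum>i. exp (- a) ^ i)"
    using assms by (intro sum_le_suminf summable_geometric) auto
  also have "\<dots> = 1 / (1 - exp (- a))" using assms by (intro suminf_geometric) auto
  finally show ?thesis unfolding eq .
qed

lemma norm_diff_triangle: "norm (u - w) \<le> norm (u - v) + norm (v - w)" for u v w :: complex
  using norm_triangle_ineq[of "u - v" "v - w"] by simp

section \<open>S-unimodal maps and their iterates\<close>

lemma has_real_derivative_DI:
  assumes "g differentiable_on I" "x \<in> I"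
  shows "(g has_real_derivative D g x) (at x within I)"
  using assms vector_derivative_works[of g "at x within I"]
  by (simp add: D_def differentiable_on_def has_real_derivative_iff_has_vector_derivative)

lemma mvt_I:
  fixes F :: "real \<Rightarrow> real"
  assumes "p < q" "-1 \<le> p" "q \<le> 1"
    and "\<And>t. t \<in> I \<Longrightarrow> (F has_real_derivative F' t) (at t within I)"
  obtains z where "p < z" "z < q" "F q - F p = F' z * (q - p)"
proof -
  have "(F has_real_derivative F' t) (at t within {p..q})" if "t \<in> {p..q}" for t
    using assms that by (intro DERIV_subset[OF assms(4)]) auto
  from mvt_real_within[OF assms(1) this] that show ?thesis by blast
qed

locale S_unimodal_map =
  fixes f :: "real \<Rightarrow> real"
  assumes S_unimodal: "S_unimodal f"
begin

lemma maps_I: "x \<in> I \<Longrightarrow> f x \<in> I"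
  using S_unimodal by (auto simp: S_unimodal_def)

lemma iterate_in_I: "x \<in> I \<Longrightarrow> (f ^^ n) x \<in> I"
  by (induction n) (auto simp del: atLeastAtMost_iff intro: maps_I)

lemma f_minus_one: "f (-1) = -1" and f_one: "f 1 = -1"
  using S_unimodal by (auto simp: S_unimodal_def)

lemma D_pos: "-1 \<le> x \<Longrightarrow> x < 0 \<Longrightarrow> 0 < D f x"
  and D_neg: "0 < x \<Longrightarrow> x \<le> 1 \<Longrightarrow> D f x < 0"
  using S_unimodal by (auto simp: S_unimodal_def)

lemma deriv0: "x \<in> I \<Longrightarrow> (f has_real_derivative D f x) (at x within I)"
  and deriv1: "x \<in> I \<Longrightarrow> (D f has_real_derivative D (D f) x) (at x within I)"
  and deriv2: "x \<in> I \<Longrightarrow> (D (D f) has_real_derivative D (D (D f)) x) (at x within I)"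
proof -
  have "\<forall>k<3. (D ^^ k) f differentiable_on I"
    using S_unimodal unfolding S_unimodal_def C3_on_I_def by blast
  then have "(D ^^ 0) f differentiable_on I" "(D ^^ 1) f differentiable_on I" "(D ^^ 2) f differentiable_on I"
    by (auto dest: spec[of _ 0] spec[of _ 1] spec[of _ 2])
  then have "f differentiable_on I" "D f differentiable_on I" "D (D f) differentiable_on I"
    by (simp_all add: numeral_2_eq_2)
  then show "x \<in> I \<Longrightarrow> (f has_real_derivative D f x) (at x within I)"
    "x \<in> I \<Longrightarrow> (D f has_real_derivative D (D f) x) (at x within I)"
    "x \<in> I \<Longrightarrow> (D (D f) has_real_derivative D (D (D f)) x) (at x within I)"
    by (blast intro: has_real_derivative_DI)+
qed

lemma continuous_f: "continuous_on I f" and continuous_D: "continuous_on I (D f)"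
  and continuous_D2: "continuous_on I (D (D f))"
  using deriv0 deriv1 deriv2 by (auto intro!: DERIV_continuous_on simp del: atLeastAtMost_iff)

lemma D_critical: "D f 0 = 0"
proof (rule ccontr)
  assume ne: "D f 0 \<noteq> 0"
  then obtain d where d: "d > 0" "\<And>y. y \<in> I \<Longrightarrow> \<bar>y\<bar> < d \<Longrightarrow> \<bar>D f y - D f 0\<bar> < \<bar>D f 0\<bar>"
    using continuous_D[unfolded continuous_on_iff, rule_format, of 0 "\<bar>D f 0\<bar>"]
    by (auto simp: dist_real_def)
  \<comment> \<open>a point to the right of 0 and its mirror image, where \<open>f'\<close> has opposite signs\<close>
  define y where "y = min (d / 2) 1"
  have "0 < y" "y < d" "y \<le> 1" using d(1) by (auto simp: y_def)
  then show False using d(2)[of y] d(2)[of "- y"] D_neg[of y] D_pos[of "- y"] ne by auto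
qed

lemma D_eq_0_iff: "x \<in> I \<Longrightarrow> D f x = 0 \<longleftrightarrow> x = 0"
  using D_pos[of x] D_neg[of x] D_critical by (cases x "0::real" rule: linorder_cases) auto

lemma D2_critical: "D (D f) 0 < 0"
  using S_unimodal by (auto simp: S_unimodal_def numeral_2_eq_2)

lemma schwarzian_neg: "x \<in> I \<Longrightarrow> x \<noteq> 0 \<Longrightarrow> D (D (D f)) x / D f x < 3 / 2 * (D (D f) x / D f x)\<^sup>2"
  using S_unimodal by (auto simp: S_unimodal_def schwarzian_def numeral_2_eq_2 numeral_3_eq_3)

lemma ex_derivative_upper: "\<exists>B>0. \<forall>x\<in>I. \<forall>y\<in>I. \<bar>D f x - D f y\<bar> \<le> B * \<bar>x - y\<bar>"
proof -
  have "bounded (D (D f) ` I)"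
    by (intro compact_imp_bounded compact_continuous_image continuous_D2) simp
  then obtain B where B: "B > 0" "\<And>x. x \<in> I \<Longrightarrow> \<bar>D (D f) x\<bar> \<le> B"
    by (metis bounded_pos image_eqI real_norm_def)
  have "\<bar>D f x - D f y\<bar> \<le> B * \<bar>x - y\<bar>" if "x \<in> I" "y \<in> I" for x y
    using field_differentiable_bound[of I "D f" "D (D f)" B x y] deriv1 B that by simp
  then show ?thesis using B(1) by blast
qed

text \<open>
  Near 0 this is nondegeneracy of the critical point: \<open>f' x / x\<close> extends continuously
  by \<open>f'' 0\<close>, and the extension has no zero in \<open>I\<close>.
\<close>
lemma ex_derivative_lower: "\<exists>\<kappa>>0. \<forall>x\<in>I. \<kappa> * \<bar>x\<bar> \<le> \<bar>D f x\<bar>"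
proof -
  define h where "h x = (if x = 0 then D (D f) 0 else D f x / x)" for x
  have "continuous_on I h"
    unfolding continuous_on_eq_continuous_within
  proof
    fix x :: real assume x: "x \<in> I"
    show "continuous (at x within I) h"
    proof (cases "x = 0")
      case True
      have "((\<lambda>y. (D f y - D f 0) / (y - 0)) \<longlongrightarrow> D (D f) 0) (at 0 within I)"
        using deriv1[of 0] by (simp add: has_field_derivative_iff)
      then have "(h \<longlongrightarrow> D (D f) 0) (at 0 within I)"
        by (rule Lim_transform_eventually) (auto simp: h_def D_critical eventually_at_filter)
      then show ?thesis using True by (simp add: continuous_within h_def)
    next
      case False
      have "continuous (at x within I) (\<lambda>y. D f y / y)"
        using continuous_D x False
        by (intro continuous_at_within_divide) (auto simp: continuous_on_eq_continuous_within)
      moreover have "\<forall>\<^sub>F y in at x within I. D f y / y = h y"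
        using False by (auto simp: h_def eventually_at intro!: exI[of _ "\<bar>x\<bar>"] simp: dist_real_def)
      ultimately show ?thesis using False
        by (auto simp: continuous_within h_def intro: Lim_transform_eventually)
    qed
  qed
  then have "continuous_on I (\<lambda>x. \<bar>h x\<bar>)" by (intro continuous_intros)
  then obtain m where m: "m \<in> I" "\<And>x. x \<in> I \<Longrightarrow> \<bar>h m\<bar> \<le> \<bar>h x\<bar>"
    using continuous_attains_inf[of I "\<lambda>x. \<bar>h x\<bar>"] by auto
  have "h m \<noteq> 0" using m(1) D2_critical D_eq_0_iff[of m] by (auto simp: h_def)
  moreover have "\<bar>h m\<bar> * \<bar>x\<bar> \<le> \<bar>D f x\<bar>" if "x \<in> I" for x
    using m(2)[OF that] by (cases "x = 0") (auto simp: h_def abs_divide field_simps)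
  ultimately show ?thesis by (intro exI[of _ "\<bar>h m\<bar>"]) auto
qed

definition B where "B = (SOME B. B > 0 \<and> (\<forall>x\<in>I. \<forall>y\<in>I. \<bar>D f x - D f y\<bar> \<le> B * \<bar>x - y\<bar>))"
definition \<kappa> where "\<kappa> = (SOME \<kappa>. \<kappa> > 0 \<and> (\<forall>x\<in>I. \<kappa> * \<bar>x\<bar> \<le> \<bar>D f x\<bar>))"

lemma B_pos: "0 < B" and D_lipschitz: "x \<in> I \<Longrightarrow> y \<in> I \<Longrightarrow> \<bar>D f x - D f y\<bar> \<le> B * \<bar>x - y\<bar>"
  using someI_ex[OF ex_derivative_upper] unfolding B_def by blast+

lemma kappa_pos: "0 < \<kappa>" and D_lower: "x \<in> I \<Longrightarrow> \<kappa> * \<bar>x\<bar> \<le> \<bar>D f x\<bar>"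
  using someI_ex[OF ex_derivative_lower] unfolding \<kappa>_def by blast+

lemma D_upper: "x \<in> I \<Longrightarrow> \<bar>D f x\<bar> \<le> B * \<bar>x\<bar>"
  using D_lipschitz[of x 0] D_critical by simp

lemma f_increasing: "-1 \<le> x \<Longrightarrow> x < y \<Longrightarrow> y \<le> 0 \<Longrightarrow> f x < f y"
proof -
  assume a: "-1 \<le> x" "x < y" "y \<le> 0"
  obtain z where "x < z" "z < y" "f y - f x = D f z * (y - x)"
    using mvt_I[of x y f "D f"] deriv0 a by auto
  moreover have "0 < D f z * (y - x)" using D_pos[of z] a calculation by simp
  ultimately show "f x < f y" by linarith
qed

lemma f_decreasing: "0 \<le> x \<Longrightarrow> x < y \<Longrightarrow> y \<le> 1 \<Longrightarrow> f y < f x"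
proof -
  assume a: "0 \<le> x" "x < y" "y \<le> 1"
  obtain z where "x < z" "z < y" "f y - f x = D f z * (y - x)"
    using mvt_I[of x y f "D f"] deriv0 a by auto
  moreover have "D f z * (y - x) < 0" using D_neg[of z] a calculation by (simp add: mult_neg_pos)
  ultimately show "f y < f x" by linarith
qed

lemma f_le_critical_value: "x \<in> I \<Longrightarrow> f x \<le> f 0"
  using f_increasing[of x 0] f_decreasing[of 0 x] by (cases x "0::real" rule: linorder_cases) auto

lemma critical_value_lower: "x \<in> I \<Longrightarrow> \<kappa> / 2 * x\<^sup>2 \<le> f 0 - f x"
proof -
  assume x: "x \<in> I"
  let ?h = "\<lambda>t. f t + \<kappa> / 2 * t\<^sup>2" and ?h' = "\<lambda>t. D f t + \<kappa> * t"
  have dh: "(?h has_real_derivative ?h' t) (at t within I)" if "t \<in> I" for t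
    using deriv0[OF that] by (auto intro!: derivative_eq_intros)
  show ?thesis
  proof (cases x "0::real" rule: linorder_cases)
    case less
    obtain z where z: "x < z" "z < 0" "?h 0 - ?h x = ?h' z * (0 - x)"
      by (rule mvt_I[OF less _ _ dh]) (use x in auto)
    have "0 \<le> ?h' z" using D_lower[of z] D_pos[of z] z x by (auto simp: abs_if split: if_splits)
    then have "0 \<le> ?h' z * (0 - x)" using less by (intro mult_nonneg_nonneg) auto
    then show ?thesis using z(3) by simp
  next
    case greater
    obtain z where z: "0 < z" "z < x" "?h x - ?h 0 = ?h' z * (x - 0)"
      by (rule mvt_I[OF greater _ _ dh]) (use x in auto)
    have "?h' z \<le> 0" using D_lower[of z] D_neg[of z] z x by (auto simp: abs_if split: if_splits)
    then have "?h' z * (x - 0) \<le> 0" using greater by (intro mult_nonpos_nonneg) auto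
    then show ?thesis using z(3) by simp
  qed simp
qed

lemma critical_value_upper: "x \<in> I \<Longrightarrow> f 0 - f x \<le> B * x\<^sup>2"
proof -
  assume x: "x \<in> I"
  have "\<bar>f 0 - f x\<bar> \<le> (B * \<bar>x\<bar>) * \<bar>0 - x\<bar>"
  proof (rule field_differentiable_bound[of "closed_segment 0 x" f "D f", simplified real_norm_def])
    show "(f has_real_derivative D f z) (at z within closed_segment 0 x)" if "z \<in> closed_segment 0 x" for z
      using that x by (intro DERIV_subset[OF deriv0]) (auto simp: closed_segment_eq_real_ivl split: if_splits)
    show "\<bar>D f z\<bar> \<le> B * \<bar>x\<bar>" if z: "z \<in> closed_segment 0 x" for z
    proof -
      have "\<bar>z\<bar> \<le> \<bar>x\<bar>" "z \<in> I" using z x by (auto simp: closed_segment_eq_real_ivl split: if_splits)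
      then show ?thesis using D_upper[of z] B_pos by (meson mult_left_mono order_trans less_imp_le)
    qed
  qed auto
  then show ?thesis by (auto simp: power2_eq_square)
qed

end

declare funpow.simps [simp del]

lemma funpow_Suc_apply [simp]: "(g ^^ Suc n) x = g ((g ^^ n) x)"
  by (simp add: funpow.simps)

lemma funpow_1_apply: "(g ^^ Suc 0) x = g x" for g :: "'a \<Rightarrow> 'a"
  by simp

context S_unimodal_map
begin

lemma iterate_image: "(f ^^ n) ` I \<subseteq> I"
  using iterate_in_I by blast

lemma iterate_has_derivative:
  assumes x: "x \<in> I"
  shows "(f ^^ n has_real_derivative (\<Prod>i<n. D f ((f ^^ i) x))) (at x within I)"
proof (induction n)
  case 0
  have "((\<lambda>x. x) has_real_derivative 1) (at x within I)" by (rule DERIV_ident)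
  moreover have "f ^^ 0 = (\<lambda>x. x)" by (rule ext) simp
  moreover have "(\<Prod>i<0. D f ((f ^^ i) x)) = 1" by (simp only: lessThan_0 prod.empty)
  ultimately show ?case by metis
next
  case (Suc n)
  have "(f has_real_derivative D f ((f ^^ n) x)) (at ((f ^^ n) x) within (f ^^ n) ` I)"
    by (rule DERIV_subset[OF deriv0[OF iterate_in_I[OF x]] iterate_image])
  from DERIV_image_chain[OF this Suc.IH] show ?case
    by (simp only: funpow.simps prod.lessThan_Suc mult.commute)
qed

definition Df :: "nat \<Rightarrow> real \<Rightarrow> real" where
  "Df n x = D (f ^^ n) x"

lemma Df: "x \<in> I \<Longrightarrow> Df n x = (\<Prod>i<n. D f ((f ^^ i) x))"
  unfolding Df_def by (rule D_eqI[OF _ iterate_has_derivative])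

lemma Df_deriv: "x \<in> I \<Longrightarrow> (f ^^ n has_real_derivative Df n x) (at x within I)"
  using iterate_has_derivative Df by simp

lemma Df_0 [simp]: "x \<in> I \<Longrightarrow> Df 0 x = 1"
  using Df[of x 0] by simp

lemma Df_1 [simp]: "x \<in> I \<Longrightarrow> Df (Suc 0) x = D f x"
  using Df[of x "Suc 0"] by simp

lemma Df_add: "x \<in> I \<Longrightarrow> Df (m + n) x = Df n ((f ^^ m) x) * Df m x"
proof -
  assume x: "x \<in> I"
  have "(\<Prod>i<m + n. D f ((f ^^ i) x)) = (\<Prod>i<m. D f ((f ^^ i) x)) * (\<Prod>i<n. D f ((f ^^ (m + i)) x))"
    by (induction n) (auto simp: mult.assoc)
  also have "(\<Prod>i<n. D f ((f ^^ (m + i)) x)) = (\<Prod>i<n. D f ((f ^^ i) ((f ^^ m) x)))"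
    by (metis (no_types, opaque_lifting) add.commute comp_apply funpow_add)
  finally show ?thesis using Df x iterate_in_I[OF x] by (simp add: mult.commute)
qed

lemma Df_Suc: "x \<in> I \<Longrightarrow> Df (Suc n) x = Df n (f x) * D f x"
  using Df_add[of x 1 n] by simp

lemma Df_Suc': "x \<in> I \<Longrightarrow> Df (Suc n) x = D f ((f ^^ n) x) * Df n x"
  using Df_add[of x n 1] Df_1[OF iterate_in_I[of x n]] by simp

lemma Df_split: "x \<in> I \<Longrightarrow> m \<le> n \<Longrightarrow> Df n x = Df (n - m) ((f ^^ m) x) * Df m x"
  using Df_add[of x m "n - m"] by simp

lemma iterate_split: "m \<le> n \<Longrightarrow> (f ^^ (n - m)) ((f ^^ m) x) = (f ^^ n) x"
  by (metis comp_apply funpow_add le_add_diff_inverse2)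

lemma iterate_add: "(f ^^ m) ((f ^^ n) x) = (f ^^ (n + m)) x"
  by (metis add.commute comp_apply funpow_add)

lemma iterate_Suc_shift: "(f ^^ n) (f x) = (f ^^ Suc n) x"
  by (simp add: funpow_swap1)

lemma Df_eq_0_iff: "x \<in> I \<Longrightarrow> Df n x = 0 \<longleftrightarrow> (\<exists>i<n. (f ^^ i) x = 0)"
  using Df[of x n] D_eq_0_iff iterate_in_I[of x] by auto

lemma continuous_iterate: "continuous_on I (f ^^ n)"
  using Df_deriv by (auto intro!: DERIV_continuous_on simp del: atLeastAtMost_iff)

lemma continuous_Df: "continuous_on I (Df n)"
proof (induction n)
  case 0
  have "continuous_on I (\<lambda>_. 1::real)" by simp
  then show ?case by (rule continuous_on_eq) (rule Df_0[symmetric])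
next
  case (Suc n)
  have "continuous_on I (\<lambda>x. D f ((f ^^ n) x) * Df n x)"
    using iterate_in_I
    by (intro continuous_on_mult Suc continuous_on_compose2[OF continuous_D continuous_iterate]) auto
  then show ?case by (rule continuous_on_eq) (rule Df_Suc'[symmetric])
qed

section \<open>Expansion of monotone branches\<close>

text \<open>
  On an interval without the critical point, \<open>\<phi> = 1 / sqrt \<bar>f'\<bar>\<close> satisfies
  \<open>\<phi>'' = - \<phi> S f / 2\<close>, so negative Schwarzian derivative means that \<phi> is strictly convex.
\<close>
lemma convex_root_branch:
  assumes \<sigma>: "\<sigma> = 1 \<or> \<sigma> = -1" and ab: "-1 \<le> a" "b \<le> 1"
    and pos: "\<And>t. t \<in> {a..b} \<Longrightarrow> 0 < \<sigma> * D f t"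
  shows "convex_root (\<lambda>t. \<sigma> * f t) (\<lambda>t. 1 / sqrt (\<sigma> * D f t))
           (\<lambda>t. - (\<sigma> * D (D f) t) / (2 * (\<sigma> * D f t) * sqrt (\<sigma> * D f t))) a b"
proof
  fix t assume t: "t \<in> {a..b}"
  have tI: "t \<in> I" and sub: "{a..b} \<subseteq> I" using t ab by auto
  have p: "0 < \<sigma> * D f t" by (rule pos[OF t])
  show "((\<lambda>t. \<sigma> * f t) has_real_derivative 1 / (1 / sqrt (\<sigma> * D f t))\<^sup>2) (at t within {a..b})"
    using DERIV_cmult[OF DERIV_subset[OF deriv0[OF tI] sub], of \<sigma>] p by (simp add: power_divide)
  have d1: "((\<lambda>t. \<sigma> * D f t) has_real_derivative \<sigma> * D (D f) t) (at t within {a..b})"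
    by (rule DERIV_cmult[OF DERIV_subset[OF deriv1[OF tI] sub]])
  have ds: "((\<lambda>t. sqrt (\<sigma> * D f t)) has_real_derivative
      inverse (sqrt (\<sigma> * D f t)) / 2 * (\<sigma> * D (D f) t)) (at t within {a..b})"
    by (rule DERIV_chain2[OF DERIV_real_sqrt[OF p] d1])
  show "((\<lambda>t. 1 / sqrt (\<sigma> * D f t)) has_real_derivative
         - (\<sigma> * D (D f) t) / (2 * (\<sigma> * D f t) * sqrt (\<sigma> * D f t))) (at t within {a..b})"
    by (rule DERIV_cong[OF DERIV_divide[OF DERIV_const ds]]) (use p in \<open>auto simp: field_simps\<close>)
  show "0 < 1 / sqrt (\<sigma> * D f t)" using p by simp
next
  fix t u assume tu: "a \<le> t" "t < u" "u \<le> b"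
  let ?E = "\<lambda>t. \<sigma> * D f t" and ?E1 = "\<lambda>t. \<sigma> * D (D f) t" and ?E2 = "\<lambda>t. \<sigma> * D (D (D f)) t"
  let ?g = "\<lambda>t. - ?E1 t / (2 * ?E t * sqrt (?E t))"
  let ?g' = "\<lambda>t. (3 / 2 * (?E1 t / ?E t)\<^sup>2 - ?E2 t / ?E t) / (2 * sqrt (?E t))"
  have "(?g has_real_derivative ?g' z) (at z within {t..u})" if "z \<in> {t..u}" for z
  proof -
    have zI: "z \<in> I" and sub: "{t..u} \<subseteq> I" using that tu ab by auto
    have p: "0 < ?E z" using pos[of z] that tu by simp
    have s: "sqrt (?E z) * sqrt (?E z) = ?E z" using p by simp
    have d1: "(?E has_real_derivative ?E1 z) (at z within {t..u})"
      by (rule DERIV_cmult[OF DERIV_subset[OF deriv1[OF zI] sub]])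
    have d2: "(?E1 has_real_derivative ?E2 z) (at z within {t..u})"
      by (rule DERIV_cmult[OF DERIV_subset[OF deriv2[OF zI] sub]])
    have ds: "((\<lambda>z. sqrt (?E z)) has_real_derivative ?E1 z / (2 * sqrt (?E z))) (at z within {t..u})"
      by (rule DERIV_cong[OF DERIV_chain2[OF DERIV_real_sqrt[OF p] d1]]) (use p in \<open>simp add: field_simps\<close>)
    have "(?g has_real_derivative
       ((- ?E2 z) * (2 * ?E z * sqrt (?E z)) -
         (- ?E1 z) * (2 * ?E1 z * sqrt (?E z) + 2 * ?E z * (?E1 z / (2 * sqrt (?E z)))))
        / ((2 * ?E z * sqrt (?E z)) * (2 * ?E z * sqrt (?E z)))) (at z within {t..u})"
      using p by (intro DERIV_divide DERIV_minus d2 DERIV_cong[OF DERIV_mult[OF DERIV_cmult[OF d1] ds]]) auto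
    moreover have alg: "((- e2) * (2 * e * s) - (- e1) * (2 * e1 * s + 2 * e * (e1 / (2 * s))))
        / ((2 * e * s) * (2 * e * s)) = (3 / 2 * (e1 / e)\<^sup>2 - e2 / e) / (2 * s)"
      if "s > 0" "e = s * s" for e e1 e2 s :: real
      using that(1) unfolding that(2) by (simp add: divide_simps power2_eq_square) (simp add: algebra_simps)
    moreover have "0 < sqrt (?E z)" "?E z = sqrt (?E z) * sqrt (?E z)" using p s by auto
    note alg[OF this, of "?E2 z" "?E1 z"]
    ultimately show ?thesis by (simp only:)
  qed
  from mvt_real_within[OF tu(2) this] obtain z where z: "t < z" "z < u" "?g u - ?g t = ?g' z * (u - t)"
    by blast
  have p: "0 < ?E z" using pos[of z] z tu by simp
  have "z \<in> I" "z \<noteq> 0" using z tu ab p D_critical by auto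
  then have "0 < 3 / 2 * (D (D f) z / D f z)\<^sup>2 - D (D (D f)) z / D f z"
    using schwarzian_neg[of z] by simp
  also have "\<dots> = 3 / 2 * (?E1 z / ?E z)\<^sup>2 - ?E2 z / ?E z" using \<sigma> by auto
  finally have "0 < ?g' z" using p by simp
  then have "0 < ?g' z * (u - t)" by (rule mult_pos_pos) (use tu in simp)
  with z(3) show "?g t < ?g u" by linarith
qed

lemma branch_sign:
  assumes "-1 \<le> a" "a \<le> b" "b \<le> 1" "0 \<notin> {a..b}"
  obtains \<sigma> :: real where "\<sigma> = 1 \<or> \<sigma> = -1" "\<And>t. t \<in> {a..b} \<Longrightarrow> 0 < \<sigma> * D f t"
proof (cases "b < 0")
  case True
  then show ?thesis using assms D_pos by (intro that[of 1]) auto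
next
  case False
  then have "0 < a" using assms by auto
  then show ?thesis using assms D_neg by (intro that[of "-1"]) auto
qed

lemma abs_sign: "\<sigma> = 1 \<or> \<sigma> = -1 \<Longrightarrow> 0 < \<sigma> * (y::real) \<Longrightarrow> \<bar>y\<bar> = \<sigma> * y"
  by (auto simp: abs_if)

lemma branch_length_expands:
  assumes "-1 \<le> a" "a < b" "b \<le> 1" "0 \<notin> {a..b}"
  shows "(b - a)\<^sup>2 * (\<bar>D f a\<bar> * \<bar>D f b\<bar>) < (f b - f a)\<^sup>2"
proof -
  obtain \<sigma> :: real where \<sigma>: "\<sigma> = 1 \<or> \<sigma> = -1" "\<And>t. t \<in> {a..b} \<Longrightarrow> 0 < \<sigma> * D f t"
    using branch_sign[of a b] assms by (metis less_imp_le)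
  interpret convex_root "\<lambda>t. \<sigma> * f t" "\<lambda>t. 1 / sqrt (\<sigma> * D f t)"
    "\<lambda>t. - (\<sigma> * D (D f) t) / (2 * (\<sigma> * D f t) * sqrt (\<sigma> * D f t))" a b
    using convex_root_branch[OF \<sigma>(1) _ _ \<sigma>(2)] assms by blast
  have a: "0 < \<sigma> * D f a" and b: "0 < \<sigma> * D f b" using \<sigma>(2) assms by auto
  have "(b - a) * (sqrt (\<sigma> * D f a) * sqrt (\<sigma> * D f b)) < \<sigma> * f b - \<sigma> * f a"
    using length_expands assms by simp
  then have "((b - a) * (sqrt (\<sigma> * D f a) * sqrt (\<sigma> * D f b)))\<^sup>2 < (\<sigma> * f b - \<sigma> * f a)\<^sup>2"
    using assms a b by (intro power_strict_mono) auto
  moreover have "(\<sigma> * f b - \<sigma> * f a)\<^sup>2 = (f b - f a)\<^sup>2" using \<sigma>(1) by (auto simp: power2_eq_square algebra_simps)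
  ultimately show ?thesis
    using a b abs_sign[OF \<sigma>(1) a] abs_sign[OF \<sigma>(1) b] by (simp add: power_mult_distrib)
qed

lemma branch_koebe:
  assumes "-1 \<le> a" "a < x" "x < b" "b \<le> 1" "0 \<notin> {a..b}"
  shows "1 / (x - a) + 1 / (b - x) \<le> \<bar>D f x\<bar> * (1 / \<bar>f x - f a\<bar> + 1 / \<bar>f b - f x\<bar>)"
proof -
  obtain \<sigma> :: real where \<sigma>: "\<sigma> = 1 \<or> \<sigma> = -1" "\<And>t. t \<in> {a..b} \<Longrightarrow> 0 < \<sigma> * D f t"
    using branch_sign[of a b] assms by (metis less_imp_le less_trans)
  interpret convex_root "\<lambda>t. \<sigma> * f t" "\<lambda>t. 1 / sqrt (\<sigma> * D f t)"
    "\<lambda>t. - (\<sigma> * D (D f) t) / (2 * (\<sigma> * D f t) * sqrt (\<sigma> * D f t))" a b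
    using convex_root_branch[OF \<sigma>(1) _ _ \<sigma>(2)] assms by blast
  have x: "0 < \<sigma> * D f x" using \<sigma>(2) assms by auto
  have "\<sigma> * f x - \<sigma> * f a = \<bar>f x - f a\<bar>" "\<sigma> * f b - \<sigma> * f x = \<bar>f b - f x\<bar>"
    using strict_mono_F[of a x] strict_mono_F[of x b] assms \<sigma>(1) by auto
  then show ?thesis using koebe[of x] assms x abs_sign[OF \<sigma>(1) x] by (simp add: power_divide)
qed

definition crit_free :: "nat \<Rightarrow> real set \<Rightarrow> bool" where
  "crit_free n S \<longleftrightarrow> (\<forall>j<n. \<forall>t\<in>S. (f ^^ j) t \<noteq> 0)"

lemma crit_free_mono: "crit_free n S \<Longrightarrow> m \<le> n \<Longrightarrow> T \<subseteq> S \<Longrightarrow> crit_free m T"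
  unfolding crit_free_def by (meson order_less_le_trans subsetD)

lemma crit_free_0 [simp]: "crit_free 0 S"
  by (simp add: crit_free_def)

lemma crit_free_Suc: "crit_free (Suc n) S \<longleftrightarrow> 0 \<notin> S \<and> crit_free n (f ` S)"
  unfolding crit_free_def by (auto simp: iterate_Suc_shift less_Suc_eq_0_disj simp del: funpow_Suc_apply)

lemma image_segment:
  assumes "a \<in> I" "b \<in> I" "0 \<notin> closed_segment a b"
  shows "f ` closed_segment a b = closed_segment (f a) (f b)"
proof -
  have *: "f ` {a..b} = closed_segment (f a) (f b)" if "-1 \<le> a" "a \<le> b" "b \<le> 1" "0 \<notin> {a..b}" for a b
  proof
    show "f ` {a..b} \<subseteq> closed_segment (f a) (f b)"
    proof
      fix y assume "y \<in> f ` {a..b}"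
      then obtain t where t: "t \<in> {a..b}" "y = f t" by blast
      then show "y \<in> closed_segment (f a) (f b)"
        using that f_increasing[of a t] f_increasing[of t b] f_decreasing[of a t] f_decreasing[of t b]
        by (cases "a = t"; cases "t = b"; cases "b < 0") (auto simp: closed_segment_eq_real_ivl)
    qed
    have "connected (f ` {a..b})"
      using that by (intro connected_continuous_image continuous_on_subset[OF continuous_f]) auto
    then show "closed_segment (f a) (f b) \<subseteq> f ` {a..b}"
      using that by (intro closed_segment_subset) (auto simp: connected_convex_1)
  qed
  show ?thesis
  proof (cases "a \<le> b")
    case True
    then show ?thesis using *[of a b] assms by (auto simp: closed_segment_eq_real_ivl)
  next
    case False
    then show ?thesis using *[of b a] assms by (auto simp: closed_segment_eq_real_ivl closed_segment_commute)
  qed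
qed

lemma image_segment_iterate:
  assumes "a \<in> I" "b \<in> I" "crit_free n (closed_segment a b)"
  shows "(f ^^ n) ` closed_segment a b = closed_segment ((f ^^ n) a) ((f ^^ n) b)"
  using assms
proof (induction n arbitrary: a b)
  case (Suc n)
  have 0: "0 \<notin> closed_segment a b" "crit_free n (f ` closed_segment a b)"
    using Suc.prems by (auto simp: crit_free_Suc)
  have im: "f ` closed_segment a b = closed_segment (f a) (f b)"
    using image_segment 0 Suc.prems by blast
  have "(f ^^ Suc n) ` closed_segment a b = (f ^^ n) ` f ` closed_segment a b"
    by (simp only: funpow_Suc_right image_comp)
  also have "\<dots> = closed_segment ((f ^^ n) (f a)) ((f ^^ n) (f b))"
    unfolding im using Suc.IH[of "f a" "f b"] 0(2) im maps_I Suc.prems(1,2) by simp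
  finally show ?case by (simp only: iterate_Suc_shift)
qed simp

lemma iterate_inj:
  assumes "a \<in> I" "b \<in> I" "a \<noteq> b" "crit_free n (closed_segment a b)"
  shows "(f ^^ n) a \<noteq> (f ^^ n) b"
  using assms
proof (induction n arbitrary: a b)
  case (Suc n)
  have 0: "0 \<notin> closed_segment a b" "crit_free n (f ` closed_segment a b)"
    using Suc.prems by (auto simp: crit_free_Suc)
  then have im: "f ` closed_segment a b = closed_segment (f a) (f b)"
    using image_segment Suc.prems by blast
  have "f a \<noteq> f b"
    using 0(1) Suc.prems(1-3) f_increasing[of a b] f_increasing[of b a] f_decreasing[of a b] f_decreasing[of b a]
    by (cases "a < b") (auto simp: closed_segment_eq_real_ivl split: if_splits)
  then show ?case using Suc.IH[of "f a" "f b"] 0(2) maps_I Suc.prems(1,2) im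
    by (simp only: iterate_Suc_shift) simp
qed simp

text \<open>
  This inequality and the next one are infinitesimal forms of the expansion of cross-ratios. Both sides
  behave multiplicatively under composition, so that they pass from \<open>f\<close> to its iterates by the chain
  rule and no Schwarzian derivative of an iterate has to be computed.
\<close>
theorem iterate_length_expands:
  assumes "a \<in> I" "b \<in> I" "crit_free n (closed_segment a b)"
  shows "(a - b)\<^sup>2 * (\<bar>Df n a\<bar> * \<bar>Df n b\<bar>) \<le> ((f ^^ n) a - (f ^^ n) b)\<^sup>2"
    and "n \<noteq> 0 \<Longrightarrow> a \<noteq> b \<Longrightarrow>
      (a - b)\<^sup>2 * (\<bar>Df n a\<bar> * \<bar>Df n b\<bar>) < ((f ^^ n) a - (f ^^ n) b)\<^sup>2"
proof -
  have *: "(a - b)\<^sup>2 * (\<bar>Df (Suc n) a\<bar> * \<bar>Df (Suc n) b\<bar>) < ((f ^^ Suc n) a - (f ^^ Suc n) b)\<^sup>2"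
    if "a \<in> I" "b \<in> I" "a \<noteq> b" "crit_free (Suc n) (closed_segment a b)" for n a b
    using that
  proof (induction n arbitrary: a b)
    case 0
    then have "0 \<notin> closed_segment a b" by (force simp: crit_free_def)
    then show ?case
      using 0 branch_length_expands[of a b] branch_length_expands[of b a]
      by (cases "a < b") (auto simp: closed_segment_eq_real_ivl power2_commute mult.commute mult.left_commute split: if_splits)
  next
    case (Suc n)
    have 0: "0 \<notin> closed_segment a b" "crit_free (Suc n) (f ` closed_segment a b)"
      using Suc.prems by (auto simp: crit_free_Suc)
    then have im: "f ` closed_segment a b = closed_segment (f a) (f b)"
      using image_segment Suc.prems by blast
    have ne: "f a \<noteq> f b" using iterate_inj[of a b 1] Suc.prems crit_free_mono[OF Suc.prems(4), of 1] by simp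
    have 1: "(a - b)\<^sup>2 * (\<bar>D f a\<bar> * \<bar>D f b\<bar>) \<le> (f a - f b)\<^sup>2"
      using branch_length_expands[of a b] branch_length_expands[of b a] Suc.prems 0
      by (cases "a < b") (auto simp: closed_segment_eq_real_ivl power2_commute mult.commute mult.left_commute split: if_splits)
    let ?g = "f ^^ Suc n" and ?N = "Suc n"
    have "(a - b)\<^sup>2 * (\<bar>Df (Suc (Suc n)) a\<bar> * \<bar>Df (Suc (Suc n)) b\<bar>)
        = ((a - b)\<^sup>2 * (\<bar>D f a\<bar> * \<bar>D f b\<bar>)) * (\<bar>Df ?N (f a)\<bar> * \<bar>Df ?N (f b)\<bar>)"
      using Df_Suc[of a "Suc n"] Df_Suc[of b "Suc n"] Suc.prems
      by (simp add: abs_mult ac_simps)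
    also have "\<dots> \<le> (f a - f b)\<^sup>2 * (\<bar>Df ?N (f a)\<bar> * \<bar>Df ?N (f b)\<bar>)"
      by (rule mult_right_mono[OF 1]) simp
    also have "\<dots> < (?g (f a) - ?g (f b))\<^sup>2"
      using Suc.IH[of "f a" "f b"] maps_I Suc.prems ne 0(2) im by simp
    finally show ?case by (simp only: iterate_Suc_shift)
  qed
  show "n \<noteq> 0 \<Longrightarrow> a \<noteq> b \<Longrightarrow>
      (a - b)\<^sup>2 * (\<bar>Df n a\<bar> * \<bar>Df n b\<bar>) < ((f ^^ n) a - (f ^^ n) b)\<^sup>2"
    using *[of a b "n - 1"] assms by (cases n) auto
  then show "(a - b)\<^sup>2 * (\<bar>Df n a\<bar> * \<bar>Df n b\<bar>) \<le> ((f ^^ n) a - (f ^^ n) b)\<^sup>2"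
    using assms by (cases "n = 0 \<or> a = b") auto
qed

theorem iterate_koebe:
  assumes "-1 \<le> a" "a < x" "x < b" "b \<le> 1" "crit_free n {a..b}"
  shows "1 / (x - a) + 1 / (b - x) \<le>
    \<bar>Df n x\<bar> * (1 / \<bar>(f ^^ n) x - (f ^^ n) a\<bar> + 1 / \<bar>(f ^^ n) b - (f ^^ n) x\<bar>)"
  using assms
proof (induction n)
  case 0
  then show ?case by simp
next
  case (Suc n)
  have cf: "crit_free n {a..b}" using crit_free_mono[OF Suc.prems(5), of n] by simp
  let ?g = "f ^^ n" and ?N = n
  have seg: "closed_segment a b = {a..b}" using Suc.prems by (simp add: closed_segment_eq_real_ivl)
  have im: "?g ` {u..v} = closed_segment (?g u) (?g v)" if "a \<le> u" "u \<le> v" "v \<le> b" for u v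
    using image_segment_iterate[of u v n] that Suc.prems crit_free_mono[OF cf, of n "{u..v}"]
    by (simp add: closed_segment_eq_real_ivl)
  have ne: "?g u \<noteq> ?g v" if "a \<le> u" "u < v" "v \<le> b" for u v
    using iterate_inj[of u v n] that Suc.prems crit_free_mono[OF cf, of n "{u..v}"]
    by (simp add: closed_segment_eq_real_ivl)
  have x: "?g x \<in> closed_segment (?g a) (?g b)" using im[of a b] Suc.prems by auto
  have 0: "0 \<notin> closed_segment (?g a) (?g b)"
    using im[of a b] Suc.prems by (force simp: crit_free_def)
  have I: "?g a \<in> I" "?g b \<in> I" "?g x \<in> I" using iterate_in_I Suc.prems by auto
  have "1 / \<bar>?g x - ?g a\<bar> + 1 / \<bar>?g b - ?g x\<bar> \<le>
      \<bar>D f (?g x)\<bar> * (1 / \<bar>f (?g x) - f (?g a)\<bar> + 1 / \<bar>f (?g b) - f (?g x)\<bar>)"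
  proof (cases "?g a < ?g b")
    case True
    then have "?g a < ?g x" "?g x < ?g b"
      using x ne[of a x] ne[of x b] Suc.prems by (auto simp: closed_segment_eq_real_ivl)
    then show ?thesis using branch_koebe[of "?g a" "?g x" "?g b"] I 0 True
      by (simp add: closed_segment_eq_real_ivl)
  next
    case False
    then have "?g b < ?g x" "?g x < ?g a"
      using x ne[of a x] ne[of x b] Suc.prems by (auto simp: closed_segment_eq_real_ivl split: if_splits)
    then show ?thesis using branch_koebe[of "?g b" "?g x" "?g a"] I 0 False
      by (simp add: closed_segment_eq_real_ivl abs_minus_commute add.commute split: if_splits)
  qed
  then have "\<bar>Df ?N x\<bar> * (1 / \<bar>?g x - ?g a\<bar> + 1 / \<bar>?g b - ?g x\<bar>) \<le>
      \<bar>Df ?N x\<bar> * (\<bar>D f (?g x)\<bar> * (1 / \<bar>f (?g x) - f (?g a)\<bar> + 1 / \<bar>f (?g b) - f (?g x)\<bar>))"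
    by (rule mult_left_mono) simp
  moreover have "1 / (x - a) + 1 / (b - x) \<le> \<bar>Df ?N x\<bar> * (1 / \<bar>?g x - ?g a\<bar> + 1 / \<bar>?g b - ?g x\<bar>)"
    using Suc.IH[OF Suc.prems(1-4) cf] .
  moreover have "\<bar>Df (Suc n) x\<bar> = \<bar>Df ?N x\<bar> * \<bar>D f (?g x)\<bar>"
    using Df_Suc'[of x n] Suc.prems by (simp add: abs_mult)
  ultimately show ?case by (simp add: mult.assoc)
qed

section \<open>Pulling intervals back along an orbit\<close>

text \<open>
  By \<open>crit_free\<close> the iterate is monotone on \<open>{a..b}\<close>; it may preserve or reverse the orientation.
\<close>
definition regular_pullback :: "nat \<Rightarrow> real \<Rightarrow> real \<Rightarrow> real \<Rightarrow> real \<Rightarrow> real \<Rightarrow> bool" where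
  "regular_pullback n x p q a b \<longleftrightarrow> -1 \<le> a \<and> a < x \<and> x < b \<and> b \<le> 1 \<and> crit_free n {a..b} \<and>
     {(f ^^ n) a, (f ^^ n) b} = {p, q}"

lemma regular_pullback_image:
  assumes "regular_pullback n x p q a b" "p \<le> q"
  shows "(f ^^ n) ` {a..b} = {p..q}"
proof -
  have "(f ^^ n) ` closed_segment a b = closed_segment ((f ^^ n) a) ((f ^^ n) b)"
    using assms by (intro image_segment_iterate) (auto simp: regular_pullback_def closed_segment_eq_real_ivl)
  then show ?thesis
    using assms by (auto simp: regular_pullback_def closed_segment_eq_real_ivl doubleton_eq_iff)
qed

text \<open>
  An interval is pulled back one step at a time along the branch of \<open>f\<close> that contains the orbit. Each
  half of \<open>I\<close> is mapped onto \<open>[-1, f 0]\<close>, so the only obstruction is an interval that contains the critical value.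
\<close>
lemma pullback_dichotomy:
  assumes "x \<in> I" "-1 \<le> p" "q \<le> 1" "p < (f ^^ n) x" "(f ^^ n) x < q"
  shows "(\<exists>a b. regular_pullback n x p q a b) \<or>
    (\<exists>k<n. crit_free (n - Suc k) (closed_segment ((f ^^ Suc k) x) (f 0)) \<and> (f ^^ (n - k)) 0 \<in> {p..q})"
  using assms
proof (induction n arbitrary: x)
  case 0
  then have "regular_pullback 0 x p q p q" by (auto simp: regular_pullback_def)
  then show ?case by blast
next
  case (Suc n)
  have "f x \<in> I" "p < (f ^^ n) (f x)" "(f ^^ n) (f x) < q"
    using maps_I Suc.prems by (simp_all only: iterate_Suc_shift)
  from Suc.IH[OF this(1) Suc.prems(2,3) this(2,3)] show ?case
  proof (elim disjE exE conjE)
    fix k assume "k < n" "crit_free (n - Suc k) (closed_segment ((f ^^ Suc k) (f x)) (f 0))"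
      "(f ^^ (n - k)) 0 \<in> {p..q}"
    then show ?thesis
      by (intro disjI2 exI[of _ "Suc k"]) (simp only: iterate_Suc_shift diff_Suc_Suc Suc_less_eq simp_thms)
  next
    fix a b assume ab: "regular_pullback n (f x) p q a b"
    then have ab': "-1 \<le> a" "a < f x" "f x < b" "b \<le> 1" and cf: "crit_free n {a..b}"
      and ends: "{(f ^^ n) a, (f ^^ n) b} = {p, q}" by (auto simp: regular_pullback_def)
    show ?thesis
    proof (cases "f 0 \<le> b")
      case True
      then have f0: "f 0 \<in> {a..b}" using f_le_critical_value[OF Suc.prems(1)] ab' by auto
      then have "closed_segment (f x) (f 0) \<subseteq> {a..b}" using ab' by (auto simp: closed_segment_eq_real_ivl)
      then have "crit_free n (closed_segment (f x) (f 0))" using crit_free_mono[OF cf] by blast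
      moreover have "(f ^^ n) (f 0) \<in> {p..q}"
        using regular_pullback_image[OF ab] Suc.prems f0 by auto
      ultimately show ?thesis
        by (intro disjI2 exI[of _ 0]) (simp add: iterate_Suc_shift funpow_1_apply del: funpow_Suc_apply)
    next
      case False
      have x0: "x \<noteq> 0" using False ab' by auto
      have pull: "crit_free (Suc n) (closed_segment u v)" if "u \<in> I" "v \<in> I" "0 \<notin> closed_segment u v" "f u = a" "f v = b" for u v
        using that cf image_segment[of u v] ab' by (simp add: crit_free_Suc closed_segment_eq_real_ivl)
      have shift: "{(f ^^ Suc n) u, (f ^^ Suc n) v} = {p, q}" if "f u = a" "f v = b" for u v
        using ends that by (simp add: iterate_Suc_shift[symmetric] del: funpow_Suc_apply)
      show ?thesis
      proof (cases "x < 0")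
        case True
        obtain u where u: "-1 \<le> u" "u \<le> x" "f u = a"
          using IVT'[of f "-1" a x] ab' f_minus_one Suc.prems(1) continuous_on_subset[OF continuous_f, of "{-1..x}"] by auto
        obtain v where v: "x \<le> v" "v \<le> 0" "f v = b"
          using IVT'[of f x b 0] ab' False Suc.prems(1) True continuous_on_subset[OF continuous_f, of "{x..0}"] by auto
        have "u < x" "x < v" "v < 0" using u v ab' False by (auto simp: less_le)
        then have "regular_pullback (Suc n) x p q u v"
          using pull[of u v] shift[of u v] u v Suc.prems(1) True
          unfolding regular_pullback_def by (auto simp: closed_segment_eq_real_ivl)
        then show ?thesis by blast
      next
        case xpos: False
        obtain u where u: "x \<le> u" "u \<le> 1" "f u = a"
          using IVT2'[of f 1 a x] ab' f_one Suc.prems(1) continuous_on_subset[OF continuous_f, of "{x..1}"] by auto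
        obtain v where v: "0 \<le> v" "v \<le> x" "f v = b"
          using IVT2'[of f x b 0] ab' False Suc.prems(1) xpos continuous_on_subset[OF continuous_f, of "{0..x}"] by auto
        have "x < u" "v < x" "0 < v" using u v ab' False by (auto simp: less_le)
        then have "regular_pullback (Suc n) x p q v u"
          using pull[of u v] shift[of u v] u v Suc.prems(1) xpos
          unfolding regular_pullback_def by (auto simp: closed_segment_eq_real_ivl insert_commute)
        then show ?thesis by blast
      qed
    qed
  qed
qed

lemma regular_pullback_koebe:
  assumes "regular_pullback n x p q a b" "p < (f ^^ n) x" "(f ^^ n) x < q"
  shows "1 / (x - a) + 1 / (b - x) \<le> \<bar>Df n x\<bar> * ((q - p) / (((f ^^ n) x - p) * (q - (f ^^ n) x)))"
proof -
  let ?y = "(f ^^ n) x"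
  have "1 / (x - a) + 1 / (b - x) \<le> \<bar>Df n x\<bar> * (1 / \<bar>?y - (f ^^ n) a\<bar> + 1 / \<bar>(f ^^ n) b - ?y\<bar>)"
    using assms by (intro iterate_koebe) (auto simp: regular_pullback_def)
  also have "1 / \<bar>?y - (f ^^ n) a\<bar> + 1 / \<bar>(f ^^ n) b - ?y\<bar> = 1 / (?y - p) + 1 / (q - ?y)"
    using assms by (auto simp: regular_pullback_def doubleton_eq_iff)
  also have "\<dots> = (q - p) / ((?y - p) * (q - ?y))" using assms by (simp add: field_simps)
  finally show ?thesis .
qed

lemma regular_pullback_Df:
  assumes "regular_pullback n x p q a b" "p < (f ^^ n) x" "(f ^^ n) x < q"
    and "e * (q - p) \<le> ((f ^^ n) x - p) * (q - (f ^^ n) x)"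
  shows "e * (1 / (x - a) + 1 / (b - x)) \<le> \<bar>Df n x\<bar>"
proof -
  let ?P = "((f ^^ n) x - p) * (q - (f ^^ n) x)" and ?S = "1 / (x - a) + 1 / (b - x)"
  have P: "0 < ?P" and pq: "p < q" using assms by auto
  have S: "0 < ?S" using assms(1) by (simp add: regular_pullback_def add_pos_pos)
  have "?S * ?P \<le> \<bar>Df n x\<bar> * (q - p)"
    using regular_pullback_koebe[OF assms(1-3)] P by (simp add: field_simps)
  moreover have "?S * (e * (q - p)) \<le> ?S * ?P" using assms(4) S by (intro mult_left_mono) auto
  ultimately have "(e * ?S) * (q - p) \<le> \<bar>Df n x\<bar> * (q - p)" by (simp add: ac_simps)
  then show ?thesis using pq by simp
qed

text \<open>
  The source of all expansion. Suppose that the pullback of \<open>{p..q}\<close> meets the critical point. Then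
  the critical value and a point \<open>z\<close> of the orbit of \<open>x\<close> bound an interval of length at least
  \<open>\<kappa> / 2 * R\<^sup>2\<close>, because \<open>z\<close> is the image of a point at distance at least \<open>R\<close> from 0, and an
  iterate maps it monotonically into \<open>{p..q}\<close>. By \<open>iterate_length_expands\<close> the derivatives at
  the two end points have a small product; the hypothesis \<open>no\<close> on the critical orbit then makes the one at \<open>z\<close>
  smaller than \<open>e\<close>. This contradicts the induction hypothesis for \<open>z\<close>, whose remaining orbit
  is shorter. The number \<open>e\<close> is the lower bound that \<open>iterate_koebe\<close> yields for a
  regular pullback, since all lengths in \<open>I\<close> are at most 2.
\<close>
lemma expansion_principle:
  assumes "0 < R" "-1 \<le> p" "q \<le> 1" "0 < e" "e \<le> 1"
    and no: "\<And>N. N \<ge> 1 \<Longrightarrow> (f ^^ N) 0 \<in> {p..q} \<Longrightarrow>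
        (q - p)\<^sup>2 < (\<kappa> / 2 * R\<^sup>2)\<^sup>2 * (\<bar>Df (N - 1) (f 0)\<bar> * e)"
    and x: "x \<in> I" "\<And>j. j < n \<Longrightarrow> R \<le> \<bar>(f ^^ j) x\<bar>"
    and y: "p < (f ^^ n) x" "(f ^^ n) x < q" "e * (q - p) \<le> ((f ^^ n) x - p) * (q - (f ^^ n) x)"
  shows "e \<le> \<bar>Df n x\<bar> \<and> (\<exists>a b. regular_pullback n x p q a b)"
  using x y
proof (induction n arbitrary: x rule: less_induct)
  case (less n)
  from pullback_dichotomy[OF less.prems(1) assms(2,3) less.prems(3,4)]
  show ?case
  proof (elim disjE exE conjE)
    fix a b assume ab: "regular_pullback n x p q a b"
    then have "1 \<le> 1 / (x - a) + 1 / (b - x)"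
    proof -
      have "0 < x - a" "x - a \<le> 2" "0 < b - x" "b - x \<le> 2"
        using ab less.prems(1) by (auto simp: regular_pullback_def)
      then have "1 / 2 \<le> 1 / (x - a)" "1 / 2 \<le> 1 / (b - x)" by (auto simp: field_simps)
      then show ?thesis by linarith
    qed
    then have "e * 1 \<le> e * (1 / (x - a) + 1 / (b - x))" using assms(4) by (intro mult_left_mono) auto
    also have "\<dots> \<le> \<bar>Df n x\<bar>" by (rule regular_pullback_Df[OF ab less.prems(3-5)])
    finally show ?thesis using ab by auto
  next
    fix k assume k: "k < n" and cf: "crit_free (n - Suc k) (closed_segment ((f ^^ Suc k) x) (f 0))"
      and c: "(f ^^ (n - k)) 0 \<in> {p..q}"
    let ?z = "(f ^^ Suc k) x" and ?m = "n - Suc k"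
    have zI: "?z \<in> I" and xk: "(f ^^ k) x \<in> I" by (rule iterate_in_I[OF less.prems(1)])+
    have f0: "f 0 \<in> I" using maps_I by simp
    have zm: "(f ^^ ?m) ?z = (f ^^ n) x" using iterate_split[of "Suc k" n x] k by simp
    have "e \<le> \<bar>Df ?m ?z\<bar>"
    proof -
      have "R \<le> \<bar>(f ^^ j) ?z\<bar>" if "j < ?m" for j
        using less.prems(2)[of "Suc k + j"] that k by (simp only: iterate_add less_diff_conv add.commute)
      then show ?thesis using less.IH[of ?m ?z] k zI less.prems(3-5) zm by simp
    qed
    moreover have cm: "(f ^^ ?m) (f 0) = (f ^^ (n - k)) 0"
      using k by (simp only: iterate_Suc_shift Suc_diff_Suc)
    have "(?z - f 0)\<^sup>2 * (\<bar>Df ?m ?z\<bar> * \<bar>Df ?m (f 0)\<bar>) \<le> ((f ^^ n) x - (f ^^ (n - k)) 0)\<^sup>2"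
      using iterate_length_expands(1)[OF zI f0 cf] zm cm by simp
    moreover have "((f ^^ n) x - (f ^^ (n - k)) 0)\<^sup>2 \<le> (q - p)\<^sup>2"
      using c less.prems(3,4) by (intro abs_le_square_iff[THEN iffD1]) auto
    moreover have "(\<kappa> / 2 * R\<^sup>2)\<^sup>2 * (\<bar>Df ?m (f 0)\<bar> * e) \<le> (?z - f 0)\<^sup>2 * (\<bar>Df ?m (f 0)\<bar> * \<bar>Df ?m ?z\<bar>)"
    proof (intro mult_mono)
      have "\<kappa> / 2 * R\<^sup>2 \<le> \<kappa> / 2 * ((f ^^ k) x)\<^sup>2"
        using less.prems(2)[OF k] kappa_pos assms(1) by (intro mult_left_mono abs_le_square_iff[THEN iffD1]) auto
      also have "\<dots> \<le> f 0 - ?z" using critical_value_lower[OF xk] by simp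
      finally have "(\<kappa> / 2 * R\<^sup>2)\<^sup>2 \<le> (f 0 - ?z)\<^sup>2" using kappa_pos by (intro power_mono) auto
      then show "(\<kappa> / 2 * R\<^sup>2)\<^sup>2 \<le> (?z - f 0)\<^sup>2" by (simp only: power2_commute[of ?z])
      show "e \<le> \<bar>Df ?m ?z\<bar>" by fact
    qed (use assms(4) in auto)
    ultimately have "(\<kappa> / 2 * R\<^sup>2)\<^sup>2 * (\<bar>Df ?m (f 0)\<bar> * e) \<le> (q - p)\<^sup>2"
      by (simp only: mult.commute[of "\<bar>Df ?m (f 0)\<bar>"])
    moreover have "(q - p)\<^sup>2 < (\<kappa> / 2 * R\<^sup>2)\<^sup>2 * (\<bar>Df ?m (f 0)\<bar> * e)"
      using no[of "n - k"] c k by simp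
    ultimately show ?thesis by linarith
  qed
qed

end

section \<open>The critical orbit\<close>

locale collet_eckmann_map = S_unimodal_map +
  fixes lam :: real and H0 :: nat and g :: real
  assumes repelling: "1 < D f (-1)"
    and CE: "collet_eckmann lam H0 f"
    and g_pos: "0 < g" and g_less: "g < ln lam / 4"
    and BC: "\<And>k. k \<ge> H0 \<Longrightarrow> exp (- g * real k) \<le> \<bar>(f ^^ k) 0\<bar>"
begin

lemma lam_gt_1: "1 < lam"
  using CE by (simp add: collet_eckmann_def)

lemma f0_in_I: "f 0 \<in> I"
  using maps_I by simp

text \<open>
  By the chain rule a zero would persist for all later iterates, against exponential growth.
\<close>
lemma Df_critical_value_ne_0: "Df k (f 0) \<noteq> 0"
proof
  assume "Df k (f 0) = 0"
  then obtain i where i: "i < k" "(f ^^ i) (f 0) = 0" using Df_eq_0_iff f0_in_I by blast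
  then have "Df (max H0 k) (f 0) = 0" using Df_eq_0_iff[OF f0_in_I, of "max H0 k"] by auto
  moreover have "lam ^ max H0 k \<le> \<bar>Df (max H0 k) (f 0)\<bar>" using CE by (simp add: collet_eckmann_def Df_def)
  moreover have "0 < lam ^ max H0 k" using lam_gt_1 by simp
  ultimately show False by simp
qed

lemma critical_orbit_ne_0: "k \<ge> 1 \<Longrightarrow> (f ^^ k) 0 \<noteq> 0"
proof
  assume k: "k \<ge> 1" "(f ^^ k) 0 = 0"
  then have "(f ^^ (k - 1)) (f 0) = 0" by (simp only: iterate_Suc_shift) simp
  then have "Df k (f 0) = 0" using Df_eq_0_iff[OF f0_in_I, of k] k by (auto intro!: exI[of _ "k - 1"])
  then show False using Df_critical_value_ne_0 by simp
qed

lemma ex_positive_lower_bound: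
  fixes h :: "nat \<Rightarrow> real"
  assumes "\<And>k. 0 < h k" "\<And>k. k \<ge> H \<Longrightarrow> 1 \<le> h k"
  shows "\<exists>a>0. a \<le> 1 \<and> (\<forall>k. a \<le> h k)"
proof -
  define a where "a = Min (insert 1 (h ` {..<H}))"
  have "a \<le> h k" for k
  proof (cases "k < H")
    case False
    have "a \<le> 1" by (simp add: a_def)
    then show ?thesis using assms(2)[of k] False by linarith
  qed (simp add: a_def)
  moreover have "0 < a" "a \<le> 1" using assms(1) by (auto simp: a_def)
  ultimately show ?thesis by blast
qed

lemma ex_critical_derivative: "\<exists>a>0. a \<le> 1 \<and> (\<forall>k. a * lam ^ k \<le> \<bar>Df k (f 0)\<bar>)"
proof -
  have "\<exists>a>0. a \<le> 1 \<and> (\<forall>k. a \<le> \<bar>Df k (f 0)\<bar> / lam ^ k)"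
    using lam_gt_1 Df_critical_value_ne_0 CE
    by (intro ex_positive_lower_bound[of _ H0]) (auto simp: collet_eckmann_def Df_def field_simps)
  then show ?thesis using lam_gt_1 by (simp add: field_simps)
qed

lemma ex_critical_distance: "\<exists>b>0. b \<le> 1 \<and> (\<forall>k\<ge>1. b * exp (- g * real k) \<le> \<bar>(f ^^ k) 0\<bar>)"
proof -
  have "\<exists>b>0. b \<le> 1 \<and> (\<forall>k. b \<le> \<bar>(f ^^ Suc k) 0\<bar> / exp (- g * real (Suc k)))"
    using critical_orbit_ne_0[of "Suc k" for k] BC[of "Suc k" for k]
    by (intro ex_positive_lower_bound[of _ H0]) (auto simp: field_simps simp del: funpow_Suc_apply)
  then obtain b where b: "b > 0" "b \<le> 1" "\<And>k. b \<le> \<bar>(f ^^ Suc k) 0\<bar> / exp (- g * real (Suc k))" by blast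
  have "b * exp (- g * real k) \<le> \<bar>(f ^^ k) 0\<bar>" if k: "k \<ge> 1" for k
  proof -
    obtain m where m: "k = Suc m" using k by (cases k) auto
    have "b * exp (- g * real (Suc m)) \<le> \<bar>(f ^^ Suc m) 0\<bar>"
      using b(3)[of m] pos_le_divide_eq[of "exp (- g * real (Suc m))" b "\<bar>(f ^^ Suc m) 0\<bar>"] exp_gt_zero by blast
    then show ?thesis by (simp only: m)
  qed
  then show ?thesis using b(1,2) by blast
qed

definition a0 where "a0 = (SOME a. a > 0 \<and> a \<le> 1 \<and> (\<forall>k. a * lam ^ k \<le> \<bar>Df k (f 0)\<bar>))"
definition b0 where "b0 = (SOME b. b > 0 \<and> b \<le> 1 \<and> (\<forall>k\<ge>1. b * exp (- g * real k) \<le> \<bar>(f ^^ k) 0\<bar>))"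

lemma a0: "0 < a0" "a0 \<le> 1" "a0 * lam ^ k \<le> \<bar>Df k (f 0)\<bar>"
  using someI_ex[OF ex_critical_derivative] unfolding a0_def by blast+

lemma b0: "0 < b0" "b0 \<le> 1" "k \<ge> 1 \<Longrightarrow> b0 * exp (- g * real k) \<le> \<bar>(f ^^ k) 0\<bar>"
  using someI_ex[OF ex_critical_distance] unfolding b0_def by blast+

lemma a0_le_Df: "a0 \<le> \<bar>Df k (f 0)\<bar>"
proof -
  have "a0 * 1 \<le> a0 * lam ^ k" using a0(1) lam_gt_1 by (intro mult_left_mono one_le_power) auto
  then show ?thesis using a0(3)[of k] by linarith
qed

lemma lam_power_exp: "lam ^ k = exp (ln lam * real k)"
  using lam_gt_1 by (simp add: exp_of_nat_mult mult.commute)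

text \<open>
  Slow recurrence with rate below \<open>ln lam / 4\<close> says that a close return to distance \<open>d\<close>
  of the critical point comes with a derivative of order at least \<open>d\<close> to the power -4.
\<close>
lemma critical_return_derivative:
  assumes "N \<ge> 1" "\<bar>(f ^^ N) 0\<bar> \<le> d"
  shows "a0 / lam * b0 ^ 4 \<le> \<bar>Df (N - 1) (f 0)\<bar> * d ^ 4"
proof -
  have d: "b0 * exp (- g * real N) \<le> d" using b0(3)[OF assms(1)] assms(2) by linarith
  have dpos: "0 \<le> d" using d b0(1) by (meson exp_ge_zero less_imp_le mult_nonneg_nonneg order_trans)
  have "b0 ^ 4 * exp (- (4 * g * real N)) = (b0 * exp (- g * real N)) ^ 4"
    by (simp add: power_mult_distrib exp_of_nat_mult[symmetric] mult.assoc)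
  also have "\<dots> \<le> d ^ 4" using d b0(1) by (intro power_mono) auto
  finally have 1: "b0 ^ 4 * exp (- (4 * g * real N)) \<le> d ^ 4" .
  have "exp (4 * g * real N) \<le> lam ^ N"
    using g_less unfolding lam_power_exp by (auto intro!: mult_right_mono)
  then have "a0 / lam * exp (4 * g * real N) \<le> a0 / lam * lam ^ N"
    using a0(1) lam_gt_1 by (intro mult_left_mono) auto
  also have "\<dots> = a0 * lam ^ (N - 1)" using assms(1) lam_gt_1 by (cases N) auto
  also have "\<dots> \<le> \<bar>Df (N - 1) (f 0)\<bar>" by (rule a0(3))
  finally have 2: "a0 / lam * exp (4 * g * real N) \<le> \<bar>Df (N - 1) (f 0)\<bar>" .
  have "a0 / lam * b0 ^ 4 = (a0 / lam * exp (4 * g * real N)) * (b0 ^ 4 * exp (- (4 * g * real N)))"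
    by (simp add: exp_minus field_simps)
  also have "\<dots> \<le> \<bar>Df (N - 1) (f 0)\<bar> * d ^ 4"
    using 1 2 a0(1) b0(1) lam_gt_1 by (intro mult_mono) auto
  finally show ?thesis .
qed

section \<open>Expansion at close returns to the critical point\<close>

text \<open>
  Below this radius the hypothesis of \<open>expansion_principle\<close> on the critical orbit holds for the
  interval \<open>[-5R, 5R]\<close>: the square of its length is \<open>100 R\<^sup>2\<close>, and by \<open>critical_return_derivative\<close>
  the right-hand side there is at least a constant times \<open>R\<close>.
\<close>
definition R1 where "R1 = min (1 / 10) (\<kappa>\<^sup>2 * a0 * b0 ^ 4 / (250000 * lam))"

lemma R1_pos: "0 < R1" and R1_le: "R1 \<le> 1 / 10"
  using kappa_pos a0 b0 lam_gt_1 by (auto simp: R1_def)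

lemma entry_expansion:
  assumes R: "0 < R" "R \<le> R1" and x: "x \<in> I" "\<And>j. j < n \<Longrightarrow> R \<le> \<bar>(f ^^ j) x\<bar>"
    and y: "\<bar>(f ^^ n) x\<bar> \<le> R"
  shows "2 * R \<le> \<bar>Df n x\<bar> \<and> (\<exists>a b. regular_pullback n x (- (5 * R)) (5 * R) a b)"
proof (rule expansion_principle[OF R(1) _ _ _ _ _ x])
  have R10: "R \<le> 1 / 10" using R R1_le by simp
  then show "-1 \<le> - (5 * R)" "5 * R \<le> 1" "0 < 2 * R" "2 * R \<le> 1" using R by auto
  show "- (5 * R) < (f ^^ n) x" "(f ^^ n) x < 5 * R" using y R(1) by auto
  show "2 * R * (5 * R - - (5 * R)) \<le> ((f ^^ n) x - - (5 * R)) * (5 * R - (f ^^ n) x)"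
    using y R(1) by (intro space_in_fivefold) auto
  fix N assume N: "N \<ge> (1::nat)" "(f ^^ N) 0 \<in> {- (5 * R)..5 * R}"
  let ?d = "\<bar>Df (N - 1) (f 0)\<bar>"
  have c: "a0 / lam * b0 ^ 4 \<le> ?d * (5 * R) ^ 4"
    using N by (intro critical_return_derivative) auto
  have "R \<le> \<kappa>\<^sup>2 * a0 * b0 ^ 4 / (250000 * lam)" using R by (simp add: R1_def)
  then have "250000 * R \<le> \<kappa>\<^sup>2 * (a0 / lam * b0 ^ 4)" using lam_gt_1 by (simp add: field_simps)
  also have "\<dots> \<le> \<kappa>\<^sup>2 * (?d * (5 * R) ^ 4)" using c by (intro mult_left_mono) auto
  finally have "400 * R \<le> \<kappa>\<^sup>2 * (?d * R ^ 4)" by (simp add: power_mult_distrib ac_simps)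
  then have "400 * R * R \<le> \<kappa>\<^sup>2 * (?d * R ^ 4) * R" using R(1) by (intro mult_right_mono) auto
  moreover have "\<kappa>\<^sup>2 * (?d * R ^ 4) * R / 2 = (\<kappa> / 2 * R\<^sup>2)\<^sup>2 * (?d * (2 * R))"
    by (simp add: power_mult_distrib power_divide flip: power_mult)
  moreover have "(5 * R - - (5 * R))\<^sup>2 = 100 * R * R" by (simp add: power2_eq_square)
  ultimately show "(5 * R - - (5 * R))\<^sup>2 < (\<kappa> / 2 * R\<^sup>2)\<^sup>2 * (?d * (2 * R))"
    using R(1) mult_pos_pos[of R R] by linarith
qed

text \<open>
  The pullback of \<open>[-5R, 5R]\<close> does not contain 0, hence on the side towards 0 it reaches at most the distance
  \<open>R\<close> from \<open>x\<close>, whereas the image has room of order \<open>4R\<close> on both sides.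
\<close>
lemma record_doubling:
  assumes R: "0 < R" "R \<le> R1" and x: "x \<in> I" "\<bar>x\<bar> = R" and n: "0 < n"
    and far: "\<And>j. j < n \<Longrightarrow> R \<le> \<bar>(f ^^ j) x\<bar>" and y: "\<bar>(f ^^ n) x\<bar> \<le> R"
  shows "2 \<le> \<bar>Df n x\<bar>"
proof -
  obtain a b where ab: "regular_pullback n x (- (5 * R)) (5 * R) a b"
    using entry_expansion[OF R x(1) far y] by auto
  then have "crit_free n {a..b}" "a < x" "x < b" by (auto simp: regular_pullback_def)
  then have "0 \<notin> {a..b}" using n by (force simp: crit_free_def)
  then have "x - a \<le> R \<or> b - x \<le> R" using \<open>a < x\<close> \<open>x < b\<close> x(2) by auto
  then have "1 / R \<le> 1 / (x - a) \<or> 1 / R \<le> 1 / (b - x)"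
    using \<open>a < x\<close> \<open>x < b\<close> R(1) by (auto intro: divide_left_mono)
  moreover have "0 \<le> 1 / (x - a)" "0 \<le> 1 / (b - x)" using \<open>a < x\<close> \<open>x < b\<close> by auto
  ultimately have "1 / R \<le> 1 / (x - a) + 1 / (b - x)" by linarith
  then have "12 / 5 * R * (1 / R) \<le> 12 / 5 * R * (1 / (x - a) + 1 / (b - x))"
    using R(1) by (intro mult_left_mono) auto
  also have "\<dots> \<le> \<bar>Df n x\<bar>"
  proof (rule regular_pullback_Df[OF ab])
    show "- (5 * R) < (f ^^ n) x" "(f ^^ n) x < 5 * R" using y R(1) by auto
    show "12 / 5 * R * (5 * R - - (5 * R)) \<le> ((f ^^ n) x - - (5 * R)) * (5 * R - (f ^^ n) x)"
      using y R(1) by (intro space_in_fivefold) auto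
  qed
  finally show ?thesis using R(1) by simp
qed

text \<open>
  Unlike in \<open>entry_expansion\<close>, the bound does not depend on \<open>R\<close>. If the orbit comes closer
  to 0 than \<open>R1\<close> before time \<open>n\<close>, let \<open>m\<close> be the time of closest approach: the derivative doubles between
  \<open>m\<close> and \<open>n\<close>, and time \<open>m\<close> is again such an entry, for a larger radius.
\<close>
lemma entry_derivative:
  assumes "0 < R" "R \<le> R1" "x \<in> I" "\<And>j. j < n \<Longrightarrow> R \<le> \<bar>(f ^^ j) x\<bar>" "\<bar>(f ^^ n) x\<bar> \<le> R"
  shows "2 * R1 \<le> \<bar>Df n x\<bar>"
  using assms
proof (induction n arbitrary: R rule: less_induct)
  case (less n)
  show ?case
  proof (cases "\<forall>j<n. R1 \<le> \<bar>(f ^^ j) x\<bar>")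
    case True
    then show ?thesis using entry_expansion[of R1 x n] R1_pos less.prems by auto
  next
    case False
    then have "0 < n" by auto
    then obtain m where m: "m < n" "\<And>j. j < n \<Longrightarrow> \<bar>(f ^^ m) x\<bar> \<le> \<bar>(f ^^ j) x\<bar>"
      using ex_least_value[of n "\<lambda>j. \<bar>(f ^^ j) x\<bar>"] by auto
    let ?R = "\<bar>(f ^^ m) x\<bar>"
    have R': "0 < ?R" "?R \<le> R1" "R \<le> ?R"
      using False m less.prems(1) less.prems(4)[of m] by force+
    have 1: "2 * R1 \<le> \<bar>Df m x\<bar>"
      using m by (intro less.IH[OF m(1) R'(1,2) less.prems(3)]) auto
    have 2: "2 \<le> \<bar>Df (n - m) ((f ^^ m) x)\<bar>"
    proof (rule record_doubling[OF R'(1,2) iterate_in_I[OF less.prems(3)]])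
      show "?R \<le> \<bar>(f ^^ j) ((f ^^ m) x)\<bar>" if "j < n - m" for j
        using m(2)[of "m + j"] that by (simp add: iterate_add)
      show "\<bar>(f ^^ (n - m)) ((f ^^ m) x)\<bar> \<le> ?R"
        using iterate_split[of m n x] m(1) less.prems(5) R'(3) by simp
    qed (use m in auto)
    have "2 * R1 \<le> 2 * (2 * R1)" using R1_pos by simp
    also have "\<dots> \<le> \<bar>Df (n - m) ((f ^^ m) x)\<bar> * \<bar>Df m x\<bar>"
      using 1 2 R1_pos by (intro mult_mono) auto
    also have "\<dots> = \<bar>Df n x\<bar>" using Df_split[of x m n] m(1) less.prems(3) by (simp add: abs_mult)
    finally show ?thesis .
  qed
qed

text \<open>
  An orbit that accumulates at 0 has infinitely many record times of closest approach, and the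
  derivative doubles from each record to the next.
\<close>
lemma deep_returns:
  assumes x: "x \<in> I" "\<And>j. (f ^^ j) x \<noteq> 0" and acc: "\<And>R. 0 < R \<Longrightarrow> \<exists>j. \<bar>(f ^^ j) x\<bar> < R"
  shows "\<exists>n. \<bar>(f ^^ n) x\<bar> \<le> R1 \<and> (\<forall>j<n. \<bar>(f ^^ n) x\<bar> \<le> \<bar>(f ^^ j) x\<bar>) \<and> 2 * R1 * 2 ^ k \<le> \<bar>Df n x\<bar>"
proof (induction k)
  case 0
  define n where "n = (LEAST j. \<bar>(f ^^ j) x\<bar> < R1)"
  have n: "\<bar>(f ^^ n) x\<bar> < R1" unfolding n_def using acc[OF R1_pos] by (rule LeastI_ex)
  have far: "R1 \<le> \<bar>(f ^^ j) x\<bar>" if "j < n" for j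
    using not_less_Least[of j "\<lambda>j. \<bar>(f ^^ j) x\<bar> < R1"] that by (auto simp: n_def)
  have "2 * R1 \<le> \<bar>Df n x\<bar>" using n far R1_pos x(1) by (intro entry_derivative[of R1]) auto
  then show ?case using n far by (intro exI[of _ n]) force
next
  case (Suc k)
  then obtain n where n: "\<bar>(f ^^ n) x\<bar> \<le> R1" "\<And>j. j < n \<Longrightarrow> \<bar>(f ^^ n) x\<bar> \<le> \<bar>(f ^^ j) x\<bar>"
    "2 * R1 * 2 ^ k \<le> \<bar>Df n x\<bar>" by blast
  let ?R = "\<bar>(f ^^ n) x\<bar>"
  have Rpos: "0 < ?R" using x(2) by simp
  define m where "m = (LEAST j. \<bar>(f ^^ j) x\<bar> < ?R)"
  have m: "\<bar>(f ^^ m) x\<bar> < ?R" unfolding m_def using acc[OF Rpos] by (rule LeastI_ex)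
  have far: "?R \<le> \<bar>(f ^^ j) x\<bar>" if "j < m" for j
    using not_less_Least[of j "\<lambda>j. \<bar>(f ^^ j) x\<bar> < ?R"] that by (auto simp: m_def)
  have "n < m" using n(2)[of m] m by (cases n m rule: linorder_cases) auto
  have "2 \<le> \<bar>Df (m - n) ((f ^^ n) x)\<bar>"
  proof (rule record_doubling[OF Rpos n(1) iterate_in_I[OF x(1)]])
    show "?R \<le> \<bar>(f ^^ j) ((f ^^ n) x)\<bar>" if "j < m - n" for j
      using far[of "n + j"] that by (simp add: iterate_add)
    show "\<bar>(f ^^ (m - n)) ((f ^^ n) x)\<bar> \<le> ?R"
      using iterate_split[of n m x] \<open>n < m\<close> m by simp
  qed (use \<open>n < m\<close> in auto)
  then have "2 * (2 * R1 * 2 ^ k) \<le> \<bar>Df (m - n) ((f ^^ n) x)\<bar> * \<bar>Df n x\<bar>"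
    using n(3) R1_pos by (intro mult_mono) auto
  also have "\<dots> = \<bar>Df m x\<bar>" using Df_split[of x n m] \<open>n < m\<close> x(1) by (simp add: abs_mult)
  finally have "2 * R1 * 2 ^ Suc k \<le> \<bar>Df m x\<bar>" by simp
  moreover have "\<bar>(f ^^ m) x\<bar> \<le> R1" using m n(1) by linarith
  moreover have "\<forall>j<m. \<bar>(f ^^ m) x\<bar> \<le> \<bar>(f ^^ j) x\<bar>" using far m by force
  ultimately show ?case by blast
qed

section \<open>Expansion away from the critical point\<close>

text \<open>
  For orbits that stay at distance \<open>R\<close> from 0, the number \<tau> is the size of intervals that can be pulled back,
  by the last condition. These intervals have to lie in \<open>I\<close>. The conditions in the middle say that the
  orbit does not come close to 1 and that it can only be close to -1 at some time if it has been so since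
  its first iterate; there \<open>f'\<close> is larger than a constant above 1.
\<close>
definition margin :: "real \<Rightarrow> real \<Rightarrow> bool" where
  "margin R \<tau> \<longleftrightarrow> 0 < R \<and> 0 < \<tau> \<and> \<tau> \<le> R / 2 \<and> \<tau> \<le> 1 / 4 \<and>
     (\<forall>t. -1 \<le> t \<and> t \<le> -1 + \<tau> \<longrightarrow> (1 + D f (-1)) / 2 \<le> D f t) \<and>
     (\<forall>x\<in>I. R \<le> \<bar>x\<bar> \<longrightarrow> f x \<le> 1 - \<tau>) \<and>
     (\<forall>x\<in>I. R \<le> \<bar>x\<bar> \<and> f (f x) < -1 + \<tau> \<longrightarrow> f x < -1 + \<tau>) \<and>
     8 * \<tau> < (\<kappa> / 2 * R\<^sup>2)\<^sup>2 * a0"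

lemma ex_margin:
  assumes R: "0 < R" shows "\<exists>\<tau>. margin R \<tau>"
proof -
  let ?k = "\<kappa> / 2 * R\<^sup>2"
  have kpos: "0 < ?k" using kappa_pos R by simp
  \<comment> \<open>the image of \<open>{x \<in> I. R \<le> \<bar>x\<bar>}\<close> lies to the left of \<open>u\<close>\<close>
  define u where "u = max 0 (1 - ?k)"
  have u: "0 \<le> u" "u < 1" "1 - ?k \<le> u" using kpos by (auto simp: u_def)
  have fu: "-1 < f u" using f_decreasing[of u 1] u f_one by simp
  obtain d where d: "d > 0" "\<And>y. y \<in> I \<Longrightarrow> \<bar>y + 1\<bar> < d \<Longrightarrow> \<bar>D f y - D f (-1)\<bar> < (D f (-1) - 1) / 2"
    using continuous_D[unfolded continuous_on_iff, rule_format, of "-1" "(D f (-1) - 1) / 2"] repelling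
    by (auto simp: dist_real_def)
  define w where "w = ?k\<^sup>2 * a0 / 16"
  define M where "M = {R / 2, 1 / 4, d / 2, ?k, f u + 1, w}"
  define \<tau> where "\<tau> = Min M"
  have "0 < w" using kappa_pos R a0(1) unfolding w_def by (intro divide_pos_pos mult_pos_pos zero_less_power) auto
  then have pos: "\<forall>s\<in>M. 0 < s" using R d(1) kpos fu unfolding M_def by simp
  have fin: "finite M" "M \<noteq> {}" by (simp_all add: M_def)
  have "0 < \<tau>" using pos fin by (simp add: \<tau>_def)
  moreover have "\<forall>s\<in>M. \<tau> \<le> s" using fin by (simp add: \<tau>_def)
  ultimately have \<tau>: "0 < \<tau>" "\<tau> \<le> R / 2" "\<tau> \<le> 1 / 4" "\<tau> \<le> d / 2" "\<tau> \<le> ?k" "\<tau> \<le> f u + 1" "\<tau> \<le> w"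
    by (simp_all add: M_def)
  have near: "(1 + D f (-1)) / 2 \<le> D f t" if "-1 \<le> t" "t \<le> -1 + \<tau>" for t
  proof -
    have "\<bar>D f t - D f (-1)\<bar> < (D f (-1) - 1) / 2" using that \<tau> d(1) by (intro d(2)) auto
    then show ?thesis by (auto simp: abs_if field_simps split: if_splits)
  qed
  have up: "f x \<le> 1 - ?k" if "x \<in> I" "R \<le> \<bar>x\<bar>" for x
  proof -
    have "?k \<le> \<kappa> / 2 * x\<^sup>2"
      using that R kappa_pos by (intro mult_left_mono abs_le_square_iff[THEN iffD1]) auto
    then show ?thesis using critical_value_lower[OF that(1)] f0_in_I by auto
  qed
  have "f x < -1 + \<tau>" if x: "x \<in> I" "R \<le> \<bar>x\<bar>" and "f (f x) < -1 + \<tau>" for x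
  proof (rule ccontr)
    assume "\<not> f x < -1 + \<tau>"
    then have y: "-1 + \<tau> \<le> f x" by simp
    show False
    proof (cases "f x \<le> 0")
      case True
      obtain z where z: "-1 < z" "z < -1 + \<tau>" "f (-1 + \<tau>) - f (-1) = D f z * (-1 + \<tau> - (-1))"
        using mvt_I[of "-1" "-1 + \<tau>" f "D f"] deriv0 \<tau> by auto
      have "1 \<le> D f z" using near[of z] z repelling by simp
      then have "1 * \<tau> \<le> D f z * \<tau>" using \<tau>(1) by (intro mult_right_mono) auto
      then have "-1 + \<tau> \<le> f (-1 + \<tau>)" using z(3) f_minus_one by simp
      also have "\<dots> \<le> f (f x)" using f_increasing[of "-1 + \<tau>" "f x"] y True \<tau> by (cases "-1 + \<tau> = f x") auto
      finally show False using that(3) by simp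
    next
      case False
      then have "f u \<le> f (f x)"
        using f_decreasing[of "f x" u] up[OF x] u by (cases "f x = u") auto
      then show False using that(3) \<tau>(6) by simp
    qed
  qed
  moreover have "8 * \<tau> < ?k\<^sup>2 * a0" using \<tau>(1,7) unfolding w_def by linarith
  moreover have "f x \<le> 1 - \<tau>" if "x \<in> I" "R \<le> \<bar>x\<bar>" for x using up[OF that] \<tau>(5) by simp
  ultimately have "margin R \<tau>" unfolding margin_def using R \<tau> near by blast
  then show ?thesis ..
qed

lemma away_regular:
  assumes m: "margin R \<tau>" and x: "x \<in> I" "\<And>j. j < n \<Longrightarrow> R \<le> \<bar>(f ^^ j) x\<bar>"
    and y: "-1 + \<tau> \<le> (f ^^ n) x" "(f ^^ n) x \<le> 1 - \<tau>"
  shows "\<tau> / 2 \<le> \<bar>Df n x\<bar> \<and> (\<exists>a b. regular_pullback n x ((f ^^ n) x - \<tau>) ((f ^^ n) x + \<tau>) a b)"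
proof (rule expansion_principle[OF _ _ _ _ _ _ x])
  show "0 < R" "-1 \<le> (f ^^ n) x - \<tau>" "(f ^^ n) x + \<tau> \<le> 1" "0 < \<tau> / 2" "\<tau> / 2 \<le> 1"
    "(f ^^ n) x - \<tau> < (f ^^ n) x" "(f ^^ n) x < (f ^^ n) x + \<tau>"
    "\<tau> / 2 * ((f ^^ n) x + \<tau> - ((f ^^ n) x - \<tau>)) \<le> ((f ^^ n) x - ((f ^^ n) x - \<tau>)) * ((f ^^ n) x + \<tau> - (f ^^ n) x)"
    using m y by (auto simp: margin_def)
  fix N :: nat
  let ?K = "(\<kappa> / 2 * R\<^sup>2)\<^sup>2"
  have \<tau>: "0 < \<tau>" using m by (simp add: margin_def)
  have "8 * \<tau> < ?K * a0" using m by (simp add: margin_def)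
  also have "?K * a0 \<le> ?K * \<bar>Df (N - 1) (f 0)\<bar>" by (intro mult_left_mono a0_le_Df) auto
  finally have "8 * \<tau> * (\<tau> / 2) < ?K * \<bar>Df (N - 1) (f 0)\<bar> * (\<tau> / 2)" using \<tau> by (intro mult_strict_right_mono) auto
  then show "((f ^^ n) x + \<tau> - ((f ^^ n) x - \<tau>))\<^sup>2 < ?K * (\<bar>Df (N - 1) (f 0)\<bar> * (\<tau> / 2))"
    by (simp add: power2_eq_square mult.assoc)
qed

lemma away_upper:
  assumes m: "margin R \<tau>" and x: "x \<in> I" "0 < n" "R \<le> \<bar>(f ^^ (n - 1)) x\<bar>"
  shows "(f ^^ n) x \<le> 1 - \<tau>"
proof -
  have "f ((f ^^ (n - 1)) x) \<le> 1 - \<tau>" using m x iterate_in_I[OF x(1)] unfolding margin_def by blast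
  then show ?thesis using x(2) by (cases n) auto
qed

lemma near_endpoint_backwards:
  assumes m: "margin R \<tau>" and x: "x \<in> I" "\<And>j. j < n \<Longrightarrow> R \<le> \<bar>(f ^^ j) x\<bar>"
    and y: "(f ^^ n) x < -1 + \<tau>" and i: "1 \<le> i" "i \<le> n"
  shows "(f ^^ i) x < -1 + \<tau>"
proof -
  have "(f ^^ (n - d)) x < -1 + \<tau>" if "d < n" for d
    using that
  proof (induction d)
    case (Suc d)
    let ?z = "(f ^^ (n - Suc (Suc d))) x"
    have 1: "f ?z = (f ^^ (n - Suc d)) x"
      by (subst funpow_Suc_apply[symmetric]) (use Suc.prems in \<open>simp only: Suc_diff_Suc\<close>)
    have 2: "f (f ?z) = (f ^^ (n - d)) x"
      unfolding 1 by (subst funpow_Suc_apply[symmetric]) (use Suc.prems in \<open>simp only: Suc_diff_Suc Suc_lessD\<close>)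
    have "R \<le> \<bar>?z\<bar>" using x(2) Suc.prems by simp
    moreover have "f (f ?z) < -1 + \<tau>" using Suc 2 by simp
    ultimately show ?case using m iterate_in_I[OF x(1)] 1 unfolding margin_def by metis
  qed (use y in simp)
  from this[of "n - i"] i show ?thesis by simp
qed

lemma near_endpoint_growth:
  assumes m: "margin R \<tau>" and x: "x \<in> I" "\<And>j. j < n \<Longrightarrow> (f ^^ j) x \<le> -1 + \<tau>"
  shows "((1 + D f (-1)) / 2) ^ n \<le> \<bar>Df n x\<bar>"
  using x(2)
proof (induction n)
  case (Suc n)
  have "(1 + D f (-1)) / 2 \<le> D f ((f ^^ n) x)"
    using m Suc.prems[of n] iterate_in_I[OF x(1), of n] by (auto simp: margin_def)
  then have "(1 + D f (-1)) / 2 * ((1 + D f (-1)) / 2) ^ n \<le> \<bar>D f ((f ^^ n) x)\<bar> * \<bar>Df n x\<bar>"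
    using Suc repelling by (intro mult_mono) auto
  then show ?case using Df_Suc'[OF x(1)] by (simp add: abs_mult)
qed (use x(1) in simp)

text \<open>
  If the last point is close to -1, all earlier points except the first are close to -1 too, and the derivative there exceeds 1.
  Otherwise an interval of size \<tau> around the last point can be pulled back.
\<close>
lemma ex_away_lower:
  assumes R: "0 < R"
  shows "\<exists>C>0. C \<le> 1 \<and> (\<forall>x\<in>I. \<forall>n. (\<forall>j<n. R \<le> \<bar>(f ^^ j) x\<bar>) \<longrightarrow> C \<le> \<bar>Df n x\<bar>)"
proof -
  obtain \<tau> where m: "margin R \<tau>" using ex_margin[OF R] by blast
  define C where "C = Min {1, \<tau> / 2, \<kappa> * R}"
  have C: "C \<le> 1" "C \<le> \<tau> / 2" "C \<le> \<kappa> * R" "0 < C"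
    using m kappa_pos R by (auto simp: C_def margin_def)
  have "C \<le> \<bar>Df n x\<bar>" if x: "x \<in> I" "\<And>j. j < n \<Longrightarrow> R \<le> \<bar>(f ^^ j) x\<bar>" for x n
  proof (cases "n = 0")
    case True then show ?thesis using C x by simp
  next
    case n: False
    have up: "(f ^^ n) x \<le> 1 - \<tau>" using away_upper[OF m x(1), of n] n x(2)[of "n - 1"] by simp
    show ?thesis
    proof (cases "-1 + \<tau> \<le> (f ^^ n) x")
      case True
      then show ?thesis using away_regular[OF m x True up] C by simp
    next
      case False
      obtain k where k: "n = Suc k" using n by (cases n) auto
      have "(f ^^ j) (f x) \<le> -1 + \<tau>" if "j < k" for j
        using near_endpoint_backwards[where n = n and i = "Suc j", OF m x] that False k
        by (simp only: iterate_Suc_shift) simp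
      then have "((1 + D f (-1)) / 2) ^ k \<le> \<bar>Df k (f x)\<bar>"
        using near_endpoint_growth[OF m maps_I[OF x(1)]] by blast
      moreover have "1 \<le> ((1 + D f (-1)) / 2) ^ k" using repelling by (intro one_le_power) simp
      ultimately have "1 \<le> \<bar>Df k (f x)\<bar>" by linarith
      moreover have "\<kappa> * R \<le> \<kappa> * \<bar>x\<bar>" using x(2)[of 0] kappa_pos n by simp
      then have "\<kappa> * R \<le> \<bar>D f x\<bar>" using D_lower[OF x(1)] by linarith
      ultimately have "1 * (\<kappa> * R) \<le> \<bar>Df k (f x)\<bar> * \<bar>D f x\<bar>" using kappa_pos R by (intro mult_mono) auto
      then show ?thesis using Df_Suc[OF x(1), of k] k C by (simp add: abs_mult)
    qed
  qed
  then show ?thesis using C by blast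
qed

lemma crit_free_far: "0 < R \<Longrightarrow> (\<And>j t. t \<in> S \<Longrightarrow> R \<le> \<bar>(f ^^ j) t\<bar>) \<Longrightarrow> crit_free n S"
  unfolding crit_free_def by (metis abs_zero not_le)

text \<open>
  An even iterate is increasing on the interval, so the orbits of both end points converge to fixed points.
  These are distinct, since the lengths of the images stay bounded below, and the derivative there is at
  least 1, since the derivatives of all iterates are bounded below. But then, by the strict form of
  \<open>iterate_length_expands\<close>, the interval between them would become longer.
\<close>
lemma no_invariant_interval:
  assumes R: "0 < R" and uv: "u < v" "{u..v} \<subseteq> I" and k: "0 < k" and inv: "(f ^^ k) ` {u..v} \<subseteq> {u..v}"
    and far: "\<And>n y. y \<in> {u..v} \<Longrightarrow> R \<le> \<bar>(f ^^ n) y\<bar>"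
  shows False
proof -
  obtain C where C: "0 < C" "\<And>x n. x \<in> I \<Longrightarrow> (\<And>j. j < n \<Longrightarrow> R \<le> \<bar>(f ^^ j) x\<bar>) \<Longrightarrow> C \<le> \<bar>Df n x\<bar>"
    using ex_away_lower[OF R] by blast
  have low: "C \<le> \<bar>Df n y\<bar>" if "y \<in> {u..v}" for n y
    using C(2)[of y n] far[OF that] that uv(2) by blast
  have cf: "crit_free n {u..v}" for n using crit_free_far[OF R far] by blast
  have cfs: "crit_free n (closed_segment y z)" if "y \<in> {u..v}" "z \<in> {u..v}" for n y z
    using crit_free_mono[OF cf, of n n "closed_segment y z"] that by (auto simp: closed_segment_eq_real_ivl)
  \<comment> \<open>\<open>?h\<close> may reverse the orientation, \<open>?h2\<close> preserves it\<close>
  let ?h = "f ^^ k" and ?h2 = "f ^^ (k + k)"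
  have h2: "?h2 y = ?h (?h y)" for y by (simp add: funpow_add)
  have conth: "continuous_on {u..v} ?h" by (rule continuous_on_subset[OF continuous_iterate uv(2)])
  have "inj_on ?h {u..v}"
    using iterate_inj[of _ _ k] cfs uv(2) by (intro inj_onI) (metis subsetD)
  then have "strict_mono_on {u..v} ?h \<or> strict_antimono_on {u..v} ?h"
    using injective_eq_monotone_map[of "{u..v}" ?h] conth by (simp add: is_interval_cc)
  then have mono: "?h2 y \<le> ?h2 z" if "u \<le> y" "y \<le> z" "z \<le> v" for y z
  proof (cases "y = z")
    case False
    have yz: "y \<in> {u..v}" "z \<in> {u..v}" "y < z" using that False by auto
    have h: "?h y \<in> {u..v}" "?h z \<in> {u..v}" using inv yz by blast+
    from \<open>strict_mono_on {u..v} ?h \<or> strict_antimono_on {u..v} ?h\<close> show ?thesis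
      using yz h unfolding h2 monotone_on_def by (smt (verit))
  qed simp
  have h2in: "?h2 ` {u..v} \<subseteq> {u..v}" using inv unfolding h2 by blast
  have cont2: "continuous_on {u..v} ?h2" by (rule continuous_on_subset[OF continuous_iterate uv(2)])
  have pow: "((f ^^ (k + k)) ^^ n) y = (f ^^ ((k + k) * n)) y" for n y by (simp add: funpow_mult mult.commute)
  obtain l where l: "l \<in> {u..v}" "?h2 l = l" "(\<lambda>n. (?h2 ^^ n) u) \<longlonglongrightarrow> l"
    by (rule monotone_self_map_converges[OF cont2 h2in mono, of u]) (use uv in auto)
  obtain m where m: "m \<in> {u..v}" "?h2 m = m" "(\<lambda>n. (?h2 ^^ n) v) \<longlonglongrightarrow> m"
    by (rule monotone_self_map_converges[OF cont2 h2in mono, of v]) (use uv in auto)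
  have "C * (v - u) \<le> \<bar>(?h2 ^^ n) u - (?h2 ^^ n) v\<bar>" for n
  proof -
    let ?n = "(k + k) * n"
    have "(u - v)\<^sup>2 * (C * C) \<le> (u - v)\<^sup>2 * (\<bar>Df ?n u\<bar> * \<bar>Df ?n v\<bar>)"
      using low[of u ?n] low[of v ?n] uv C(1) by (intro mult_left_mono mult_mono) auto
    also have "\<dots> \<le> ((f ^^ ?n) u - (f ^^ ?n) v)\<^sup>2"
      using iterate_length_expands(1)[of u v ?n] cfs[of u v] uv by auto
    finally have "(C * (v - u))\<^sup>2 \<le> ((?h2 ^^ n) u - (?h2 ^^ n) v)\<^sup>2"
      by (simp add: pow power2_eq_square algebra_simps)
    then show ?thesis using C(1) uv by (simp add: abs_le_square_iff[symmetric])
  qed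
  moreover have "(\<lambda>n. \<bar>(?h2 ^^ n) u - (?h2 ^^ n) v\<bar>) \<longlonglongrightarrow> \<bar>l - m\<bar>" by (intro tendsto_intros l m)
  ultimately have "C * (v - u) \<le> \<bar>l - m\<bar>" by (intro LIMSEQ_le_const) auto
  moreover have "0 < C * (v - u)" using C(1) uv by (intro mult_pos_pos) auto
  ultimately have lm: "l \<noteq> m" by auto
  have ge1: "1 \<le> \<bar>Df (k + k) y\<bar>" if y: "y \<in> {u..v}" "?h2 y = y" for y
  proof (rule ccontr)
    assume "\<not> 1 \<le> \<bar>Df (k + k) y\<bar>"
    then have less: "\<bar>Df (k + k) y\<bar> < 1" by simp
    have yI: "y \<in> I" using y uv by blast
    have fixed: "(?h2 ^^ n) y = y" for n by (induction n) (use y in auto)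
    have "\<bar>Df ((k + k) * n) y\<bar> = \<bar>Df (k + k) y\<bar> ^ n" for n
    proof (induction n)
      case (Suc n)
      have "Df ((k + k) * n + (k + k)) y = Df (k + k) y * Df ((k + k) * n) y"
        using Df_add[OF yI, of "(k + k) * n" "k + k"] fixed pow by metis
      moreover have "(k + k) * Suc n = (k + k) * n + (k + k)" by simp
      ultimately show ?case using Suc by (simp only: abs_mult power_Suc)
    qed (use yI in simp)
    then have "C \<le> \<bar>Df (k + k) y\<bar> ^ n" for n using low[OF y(1), of "(k + k) * n"] by simp
    moreover obtain n where "\<bar>Df (k + k) y\<bar> ^ n < C" using real_arch_pow_inv[OF C(1) less] by blast
    ultimately show False by (meson not_le)
  qed
  have "(l - m)\<^sup>2 * (\<bar>Df (k + k) l\<bar> * \<bar>Df (k + k) m\<bar>) < (?h2 l - ?h2 m)\<^sup>2"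
    using iterate_length_expands(2)[of l m "k + k"] cfs l m uv k lm by blast
  moreover have "(l - m)\<^sup>2 * (1 * 1) \<le> (l - m)\<^sup>2 * (\<bar>Df (k + k) l\<bar> * \<bar>Df (k + k) m\<bar>)"
    using ge1[of l] ge1[of m] l m by (intro mult_left_mono mult_mono) auto
  ultimately show False using l m by simp
qed

text \<open>
  The images of such an interval have lengths bounded below, so two of them overlap, say at times \<open>i\<close> and \<open>i + k\<close>.
  Then the images at times \<open>i + k m\<close> form a chain, and the closure of its union is an interval
  invariant under \<open>f\<^sup>k\<close>.
\<close>
lemma no_escaping_interval:
  assumes R: "0 < R" and st: "s < t" "{s..t} \<subseteq> I"
    and far: "\<And>n y. y \<in> {s..t} \<Longrightarrow> R \<le> \<bar>(f ^^ n) y\<bar>"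
  shows False
proof -
  obtain C where C: "0 < C" "\<And>x n. x \<in> I \<Longrightarrow> (\<And>j. j < n \<Longrightarrow> R \<le> \<bar>(f ^^ j) x\<bar>) \<Longrightarrow> C \<le> \<bar>Df n x\<bar>"
    using ex_away_lower[OF R] by blast
  have low: "C \<le> \<bar>Df n y\<bar>" if "y \<in> {s..t}" for n y
    using C(2)[of y n] far[OF that] that st(2) by blast
  have cf: "crit_free n (closed_segment s t)" for n
    using crit_free_far[OF R, of "{s..t}"] far st by (simp add: closed_segment_eq_real_ivl)
  have sI: "s \<in> I" and tI: "t \<in> I" using st by auto
  define K where "K n = (f ^^ n) ` {s..t}" for n
  have Kseg: "K n = closed_segment ((f ^^ n) s) ((f ^^ n) t)" for n
    using image_segment_iterate[OF sI tI cf] st by (simp add: K_def closed_segment_eq_real_ivl)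
  have len: "C * (t - s) \<le> \<bar>(f ^^ n) s - (f ^^ n) t\<bar>" for n
  proof -
    have "(s - t)\<^sup>2 * (C * C) \<le> (s - t)\<^sup>2 * (\<bar>Df n s\<bar> * \<bar>Df n t\<bar>)"
      using low[of s n] low[of t n] st C(1) by (intro mult_left_mono mult_mono) auto
    also have "\<dots> \<le> ((f ^^ n) s - (f ^^ n) t)\<^sup>2" using iterate_length_expands(1)[OF sI tI cf] .
    finally have "(C * (t - s))\<^sup>2 \<le> ((f ^^ n) s - (f ^^ n) t)\<^sup>2"
      by (simp add: power2_eq_square algebra_simps)
    then show ?thesis using C(1) st by (simp add: abs_le_square_iff[symmetric])
  qed
  have Cst: "0 < C * (t - s)" using C st by simp
  define lo where "lo n = min ((f ^^ n) s) ((f ^^ n) t)" for n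
  obtain i j where ij: "i < j" "\<bar>lo i - lo j\<bar> < C * (t - s)"
  proof (rule bounded_sequence_close_pair[of lo "-1" 1])
    show "lo n \<in> {-1..1}" for n
      using iterate_in_I[OF sI, of n] iterate_in_I[OF tI, of n] by (auto simp: lo_def min_def)
  qed (use Cst in auto)
  define k where "k = j - i"
  have k: "0 < k" using ij by (simp add: k_def)
  have "lo j \<in> K i \<inter> K j \<or> lo i \<in> K i \<inter> K j"
    using ij(2) len[of i] len[of j] unfolding Kseg lo_def
    by (auto simp: closed_segment_eq_real_ivl min_def abs_if split: if_splits)
  then obtain z where z: "z \<in> K i" "z \<in> K (i + k)" using ij(1) by (auto simp: k_def)
  have Kf: "(f ^^ a) ` K b = K (b + a)" for a b by (auto simp: K_def image_image iterate_add)
  have Kconn: "connected (K n)" for n unfolding Kseg by (rule connected_segment)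
  have KI: "K n \<subseteq> I" for n using iterate_in_I st(2) unfolding K_def by blast
  define G where "G n = (\<Union>m\<le>n. K (i + k * m))" for n
  have Gconn: "connected (G n)" for n
  proof (induction n)
    case (Suc n)
    have "(f ^^ (k * n)) z \<in> K (i + k * n)" "(f ^^ (k * n)) z \<in> K (i + k * Suc n)"
      using z Kf[of "k * n" i] Kf[of "k * n" "i + k"] by (auto simp: ac_simps)
    then have "G n \<inter> K (i + k * Suc n) \<noteq> {}" by (auto simp: G_def)
    then have "connected (G n \<union> K (i + k * Suc n))" using Suc Kconn by (intro connected_Un) auto
    then show ?case by (simp add: G_def atMost_Suc Un_commute)
  qed (simp add: G_def Kconn)
  define H where "H = \<Union> (range G)"
  have zG: "z \<in> G n" for n using z(1) by (auto simp: G_def intro!: bexI[of _ 0])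
  have Hconn: "connected H" unfolding H_def by (rule connected_Union) (use Gconn zG in blast)+
  have HK: "H = (\<Union>m. K (i + k * m))" by (auto simp: H_def G_def)
  have HI: "H \<subseteq> I" unfolding HK using KI by blast
  have cHI: "closure H \<subseteq> I" using HI by (rule closure_minimal) simp
  have Hinv: "(f ^^ k) ` H \<subseteq> H"
  proof -
    have "(f ^^ k) ` K (i + k * m) = K (i + k * Suc m)" for m
      using Kf[of k "i + k * m"] by (simp add: ac_simps)
    then show ?thesis unfolding HK image_UN by blast
  qed
  have "compact (closure H)" using cHI by (simp add: compact_eq_bounded_closed bounded_subset[OF bounded_closed_interval])
  moreover have "connected (closure H)" using Hconn by (rule connected_imp_connected_closure)
  ultimately obtain u v where uv: "closure H = {u..v}" using connected_compact_interval_1 by blast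
  have inK: "(f ^^ i) s \<in> H" "(f ^^ i) t \<in> H"
    using st unfolding HK K_def by (auto intro!: exI[of _ "0::nat"])
  have inuv: "(f ^^ i) s \<in> {u..v}" "(f ^^ i) t \<in> {u..v}" using inK closure_subset uv by blast+
  have "(f ^^ i) s \<noteq> (f ^^ i) t" using len[of i] Cst by auto
  then have "u < v" using inuv by auto
  moreover have "(f ^^ k) ` closure H \<subseteq> closure H"
    by (rule image_closure_subset[OF continuous_on_subset[OF continuous_iterate cHI]])
      (use Hinv closure_subset in auto)
  moreover have "R \<le> \<bar>(f ^^ n) y\<bar>" if y: "y \<in> closure H" for n y
  proof -
    have "(\<lambda>y. \<bar>(f ^^ n) y\<bar>) ` closure H \<subseteq> {R..}"
    proof (rule image_closure_subset)
      show "continuous_on (closure H) (\<lambda>y. \<bar>(f ^^ n) y\<bar>)"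
        by (intro continuous_intros continuous_on_subset[OF continuous_iterate cHI])
      show "(\<lambda>y. \<bar>(f ^^ n) y\<bar>) ` H \<subseteq> {R..}"
        unfolding HK K_def using far by (auto simp: iterate_add)
    qed simp
    then show ?thesis using y by auto
  qed
  ultimately show False using no_invariant_interval[OF R, of u v k] k cHI uv by auto
qed

text \<open>
  If the derivatives stayed bounded, \<open>iterate_koebe\<close> would bound the regular pullbacks of intervals of fixed size from
  below on both sides of the point: some fixed interval would stay away from 0 under all iterates.
\<close>
lemma away_unbounded:
  assumes R: "0 < R" and x: "x \<in> I" "\<And>j. R \<le> \<bar>(f ^^ j) x\<bar>"
  shows "\<exists>n. M < \<bar>Df n x\<bar>"
proof -
  obtain \<tau> where m: "margin R \<tau>" using ex_margin[OF R] by blast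
  have \<tau>: "0 < \<tau>" "\<tau> \<le> R / 2" using m by (auto simp: margin_def)
  show ?thesis
  proof (cases "\<exists>N\<ge>1. -1 + \<tau> \<le> (f ^^ N) x")
    case False
    let ?\<rho> = "(1 + D f (-1)) / 2"
    have "?\<rho> ^ n \<le> \<bar>Df n (f x)\<bar>" for n
    proof (rule near_endpoint_growth[OF m maps_I[OF x(1)]])
      show "(f ^^ j) (f x) \<le> -1 + \<tau>" for j
        using False by (simp only: iterate_Suc_shift) (metis less_eq_real_def le_add1 linorder_not_less plus_1_eq_Suc)
    qed
    moreover have "0 < \<bar>D f x\<bar>" using D_eq_0_iff[OF x(1)] x(2)[of 0] R by auto
    moreover obtain n where "M / \<bar>D f x\<bar> < ?\<rho> ^ n" using real_arch_pow[of ?\<rho>] repelling by auto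
    ultimately have "M / \<bar>D f x\<bar> < \<bar>Df n (f x)\<bar>" by (meson less_le_trans)
    then have "M < \<bar>Df (Suc n) x\<bar>"
      using \<open>0 < \<bar>D f x\<bar>\<close> Df_Suc[OF x(1)] by (simp add: abs_mult field_simps)
    then show ?thesis ..
  next
    case True
    then obtain N where N: "N \<ge> 1" "-1 + \<tau> \<le> (f ^^ N) x" by blast
    let ?z = "(f ^^ N) x"
    have zI: "?z \<in> I" by (rule iterate_in_I[OF x(1)])
    have zR: "R \<le> \<bar>(f ^^ j) ?z\<bar>" for j using x(2)[of "N + j"] by (simp add: iterate_add)
    have up: "(f ^^ n) ?z \<le> 1 - \<tau>" for n
      using away_upper[OF m x(1), of "N + n"] x(2) N by (simp add: iterate_add)
    have dn: "-1 + \<tau> \<le> (f ^^ n) ?z" for n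
      using near_endpoint_backwards[where n = "N + n" and i = N, OF m x(1) x(2)] N by (force simp: iterate_add)
    have "(f ^^ i) x \<noteq> 0" for i using x(2)[of i] R by auto
    then have DN: "0 < \<bar>Df N x\<bar>" using Df_eq_0_iff[OF x(1), of N] by simp
    show ?thesis
    proof (rule ccontr)
      assume "\<not> ?thesis"
      then have bound: "\<bar>Df n x\<bar> \<le> M" for n by (simp add: not_less)
      define L where "L = M / \<bar>Df N x\<bar>"
      have L: "\<bar>Df n ?z\<bar> \<le> L" for n
        using bound[of "N + n"] DN Df_add[OF x(1), of N n] by (simp add: L_def abs_mult field_simps)
      have Lpos: "0 < L" using L[of 0] zI by (simp del: atLeastAtMost_iff)
      define \<rho> where "\<rho> = \<tau> / (2 * L)"
      have rpos: "0 < \<rho>" using \<tau> Lpos by (simp add: \<rho>_def)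
      have key: "-1 \<le> ?z - \<rho> \<and> ?z + \<rho> \<le> 1 \<and> (\<forall>y\<in>{?z - \<rho>..?z + \<rho>}. R / 2 \<le> \<bar>(f ^^ n) y\<bar>)" for n
      proof -
        let ?w = "(f ^^ n) ?z"
        obtain a b where ab: "regular_pullback n ?z (?w - \<tau>) (?w + \<tau>) a b"
          using away_regular[OF m zI zR dn up] by blast
        then have ab': "-1 \<le> a" "a < ?z" "?z < b" "b \<le> 1" by (auto simp: regular_pullback_def)
        have "\<tau> / 2 * (1 / (?z - a) + 1 / (b - ?z)) \<le> \<bar>Df n ?z\<bar>"
          by (rule regular_pullback_Df[OF ab]) (use \<tau> in auto)
        also have "\<dots> \<le> L" by (rule L)
        finally have "\<tau> / 2 * (1 / (?z - a)) + \<tau> / 2 * (1 / (b - ?z)) \<le> L" by (simp only: distrib_left)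
        moreover have "0 \<le> \<tau> / 2 * (1 / (?z - a))" "0 \<le> \<tau> / 2 * (1 / (b - ?z))" using ab' \<tau> by auto
        ultimately have "\<tau> / 2 * (1 / (?z - a)) \<le> L" "\<tau> / 2 * (1 / (b - ?z)) \<le> L" by linarith+
        then have r: "\<rho> \<le> ?z - a" "\<rho> \<le> b - ?z" using ab' \<tau> Lpos by (auto simp: \<rho>_def field_simps)
        have im: "(f ^^ n) ` {a..b} = {?w - \<tau>..?w + \<tau>}" using regular_pullback_image[OF ab] \<tau> by simp
        have "R / 2 \<le> \<bar>(f ^^ n) y\<bar>" if "y \<in> {?z - \<rho>..?z + \<rho>}" for y
        proof -
          have "(f ^^ n) y \<in> {?w - \<tau>..?w + \<tau>}" using im r that by (auto simp del: atLeastAtMost_iff) auto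
          then show ?thesis using zR[of n] \<tau> by auto
        qed
        then show ?thesis using r ab' by auto
      qed
      show False
      proof (rule no_escaping_interval[of "R / 2" "?z - \<rho>" "?z + \<rho>"])
        show "{?z - \<rho>..?z + \<rho>} \<subseteq> I" using key[of 0] by auto
        show "R / 2 \<le> \<bar>(f ^^ n) y\<bar>" if "y \<in> {?z - \<rho>..?z + \<rho>}" for n y using key that by blast
      qed (use R rpos in auto)
    qed
  qed
qed

text \<open>
  Compactness makes the previous lemma uniform: a limit of counterexamples for larger and larger \<open>N\<close> would
  have bounded derivatives.
\<close>
lemma ex_doubling_time:
  assumes R: "0 < R"
  shows "\<exists>N. \<forall>x\<in>I. (\<forall>j<N. R \<le> \<bar>(f ^^ j) x\<bar>) \<longrightarrow> (\<exists>j\<le>N. 2 \<le> \<bar>Df j x\<bar>)"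
proof (rule ccontr)
  assume "\<not> ?thesis"
  then obtain X where X: "\<And>N. X N \<in> I" "\<And>N j. j < N \<Longrightarrow> R \<le> \<bar>(f ^^ j) (X N)\<bar>"
    "\<And>N j. j \<le> N \<Longrightarrow> \<bar>Df j (X N)\<bar> < 2" by (metis not_le)
  obtain x r where x: "x \<in> I" and r: "strict_mono r" "(X \<circ> r) \<longlonglongrightarrow> x"
    using compact_Icc[of "-1::real" 1] X(1) unfolding compact_def by metis
  have XI: "\<forall>\<^sub>F n in sequentially. (X \<circ> r) n \<in> I" using X(1) by (simp del: atLeastAtMost_iff)
  have lim: "(\<lambda>n. \<bar>h ((X \<circ> r) n)\<bar>) \<longlonglongrightarrow> \<bar>h x\<bar>" if "continuous_on I h"
    for h :: "real \<Rightarrow> real"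
    by (rule tendsto_rabs) (rule continuous_on_tendsto_compose[OF that r(2) x XI])
  have "R \<le> \<bar>(f ^^ j) x\<bar>" for j
  proof (rule LIMSEQ_le_const[OF lim[OF continuous_iterate]])
    show "\<exists>N. \<forall>n\<ge>N. R \<le> \<bar>(f ^^ j) ((X \<circ> r) n)\<bar>"
      using X(2) seq_suble[OF r(1)] by (intro exI[of _ "Suc j"]) (auto simp: Suc_le_eq intro: less_le_trans)
  qed
  moreover have "\<bar>Df j x\<bar> \<le> 2" for j
  proof (rule LIMSEQ_le_const2[OF lim[OF continuous_Df]])
    have "\<bar>Df j ((X \<circ> r) n)\<bar> \<le> 2" if "j \<le> n" for n
      using X(3)[of j "r n"] seq_suble[OF r(1), of n] that by simp
    then show "\<exists>N. \<forall>n\<ge>N. \<bar>Df j ((X \<circ> r) n)\<bar> \<le> 2" by blast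
  qed
  ultimately show False using away_unbounded[OF R x, of 2] by (meson not_le)
qed

lemma ex_away_sum:
  assumes R: "0 < R"
  shows "\<exists>K>0. \<forall>x\<in>I. \<forall>n. (\<forall>j<n. R \<le> \<bar>(f ^^ j) x\<bar>) \<longrightarrow> (\<Sum>j<n. 1 / \<bar>Df (Suc j) x\<bar>) \<le> K"
proof -
  obtain C where C: "0 < C" "\<And>x n. x \<in> I \<Longrightarrow> (\<And>j. j < n \<Longrightarrow> R \<le> \<bar>(f ^^ j) x\<bar>) \<Longrightarrow> C \<le> \<bar>Df n x\<bar>"
    using ex_away_lower[OF R] by blast
  obtain N where N: "\<And>x. x \<in> I \<Longrightarrow> (\<And>j. j < N \<Longrightarrow> R \<le> \<bar>(f ^^ j) x\<bar>) \<Longrightarrow> \<exists>j\<le>N. 2 \<le> \<bar>Df j x\<bar>"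
    using ex_doubling_time[OF R] by blast
  have short: "(\<Sum>j<n. 1 / \<bar>Df (Suc j) x\<bar>) \<le> real N / C"
    if "x \<in> I" "\<And>j. j < n \<Longrightarrow> R \<le> \<bar>(f ^^ j) x\<bar>" "n \<le> N" for x n
  proof -
    have "(\<Sum>j<n. 1 / \<bar>Df (Suc j) x\<bar>) \<le> (\<Sum>j<n. 1 / C)"
    proof (rule sum_mono)
      fix j assume "j \<in> {..<n}"
      then have "C \<le> \<bar>Df (Suc j) x\<bar>" using C(2)[of x "Suc j"] that by auto
      then show "1 / \<bar>Df (Suc j) x\<bar> \<le> 1 / C" using C(1) by (intro divide_left_mono) auto
    qed
    also have "\<dots> \<le> real N / C" using that(3) C(1) by (simp add: divide_right_mono)
    finally show ?thesis .
  qed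
  have main: "(\<Sum>j<n. 1 / \<bar>Df (Suc j) x\<bar>) \<le> 2 * (real N / C)"
    if "x \<in> I" "\<And>j. j < n \<Longrightarrow> R \<le> \<bar>(f ^^ j) x\<bar>" for x n
    using that
  proof (induction n arbitrary: x rule: less_induct)
    case (less n)
    have NC: "0 \<le> real N / C" using C(1) by simp
    show ?case
    proof (cases "n \<le> N")
      case True
      then show ?thesis using short[of x n] less.prems NC by auto
    next
      case False
      obtain i where i: "i \<le> N" "2 \<le> \<bar>Df i x\<bar>" using N[of x] less.prems False by auto
      have "0 < i" using i(2) less.prems(1) by (cases i) auto
      let ?z = "(f ^^ i) x"
      have zI: "?z \<in> I" by (rule iterate_in_I[OF less.prems(1)])
      have "(\<Sum>j<n. 1 / \<bar>Df (Suc j) x\<bar>) = (\<Sum>j<i + (n - i). 1 / \<bar>Df (Suc j) x\<bar>)"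
        using i(1) False by simp
      also have "\<dots> = (\<Sum>j<i. 1 / \<bar>Df (Suc j) x\<bar>) + (\<Sum>j<n - i. 1 / \<bar>Df (Suc (i + j)) x\<bar>)"
        by (rule sum_lessThan_add)
      also have "(\<Sum>j<n - i. 1 / \<bar>Df (Suc (i + j)) x\<bar>) = (\<Sum>j<n - i. 1 / \<bar>Df (Suc j) ?z\<bar>) / \<bar>Df i x\<bar>"
        using Df_add[OF less.prems(1), of i "Suc j" for j]
        by (simp add: sum_divide_distrib abs_mult)
      also have "(\<Sum>j<i. 1 / \<bar>Df (Suc j) x\<bar>) \<le> real N / C"
        using i(1) False less.prems by (intro short) auto
      also have "(\<Sum>j<n - i. 1 / \<bar>Df (Suc j) ?z\<bar>) / \<bar>Df i x\<bar> \<le> 2 * (real N / C) / 2"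
      proof (rule frac_le)
        show "(\<Sum>j<n - i. 1 / \<bar>Df (Suc j) ?z\<bar>) \<le> 2 * (real N / C)"
        proof (rule less.IH[OF _ zI])
          show "R \<le> \<bar>(f ^^ j) ?z\<bar>" if "j < n - i" for j
            using less.prems(2)[of "i + j"] that by (simp add: iterate_add)
        qed (use \<open>0 < i\<close> False i in auto)
      qed (use i NC in auto)
      finally show ?thesis by simp
    qed
  qed
  show ?thesis
  proof (intro exI[of _ "2 * (real N / C) + 1"] conjI ballI allI impI)
    show "0 < 2 * (real N / C) + 1" using C(1) by (simp add: add_nonneg_pos)
    fix x n assume "x \<in> I" "\<forall>j<n. R \<le> \<bar>(f ^^ j) x\<bar>"
    then have "(\<Sum>j<n. 1 / \<bar>Df (Suc j) x\<bar>) \<le> 2 * (real N / C)" using main by blast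
    then show "(\<Sum>j<n. 1 / \<bar>Df (Suc j) x\<bar>) \<le> 2 * (real N / C) + 1" by linarith
  qed
qed

theorem derivatives_unbounded:
  assumes x: "x \<in> I" "\<And>j. (f ^^ j) x \<noteq> 0"
  shows "\<exists>n. M < \<bar>Df n x\<bar>"
proof (cases "\<exists>R>0. \<forall>j. R \<le> \<bar>(f ^^ j) x\<bar>")
  case True
  then show ?thesis using away_unbounded x(1) by blast
next
  case False
  then have acc: "\<exists>j. \<bar>(f ^^ j) x\<bar> < R" if "0 < R" for R using that by (meson not_le)
  obtain k where k: "M / (2 * R1) < 2 ^ k" using real_arch_pow[of 2] by auto
  obtain n where "2 * R1 * 2 ^ k \<le> \<bar>Df n x\<bar>" using deep_returns[OF x acc] by blast
  then have "M < \<bar>Df n x\<bar>" using k R1_pos by (simp add: field_simps)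
  then show ?thesis ..
qed

section \<open>Density of the preimages of the critical point\<close>

text \<open>
  On an interval free of preimages of 0 there are two possibilities. If two of its points have orbits away from
  0, so do all points between them, against \<open>no_escaping_interval\<close>. If an orbit accumulates at 0, the
  regular pullback from a deep record time contains a preimage \<open>z\<close> of 0; its distance to the point \<open>y\<close> is
  small because the derivative at \<open>y\<close> is large and the derivative at \<open>z\<close> is at least
  of the order of the size of the image.
\<close>
theorem precritical_dense:
  assumes x: "x \<in> I" and e: "0 < e"
  shows "\<exists>y\<in>I. \<bar>x - y\<bar> < e \<and> (\<exists>j. (f ^^ j) y = 0)"
proof (rule ccontr)
  assume "\<not> ?thesis"
  then have none: "(f ^^ j) y \<noteq> 0" if "y \<in> I" "\<bar>x - y\<bar> < e" for y j using that by blast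
  define d where "d = min e 1 / 5"
  have d: "0 < d" "5 * d \<le> e" "d \<le> 1 / 5" using e by (auto simp: d_def)
  \<comment> \<open>on the side of \<open>x\<close> with room in \<open>I\<close>; \<open>{s..t}\<close> keeps a margin \<open>d / 2\<close> within the preimage-free region\<close>
  define s where "s = (if x \<le> 0 then x + d else x - 3 * d)"
  define t where "t = s + d"
  have st: "s < t" using d by (simp add: t_def)
  have near: "y \<in> I" "\<bar>x - y\<bar> < e" if "y \<in> {s - d / 2..t + d / 2}" for y
    using that x d by (auto simp: s_def t_def split: if_splits)
  have nonzero: "(f ^^ j) y \<noteq> 0" if "y \<in> {s - d / 2..t + d / 2}" for y j using none near that by blast
  have no_acc: "\<exists>R>0. \<forall>j. R \<le> \<bar>(f ^^ j) y\<bar>" if y: "y \<in> {s..t}" for y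
  proof (rule ccontr)
    assume "\<not> ?thesis"
    then have acc: "\<exists>j. \<bar>(f ^^ j) y\<bar> < R" if "0 < R" for R using that by (meson not_le)
    have yI: "y \<in> I" using near(1)[of y] y d by auto
    have yn: "(f ^^ j) y \<noteq> 0" for j using nonzero[of y j] y d by auto
    obtain k where k: "4 / (2 * R1 * d\<^sup>2) < 2 ^ k" using real_arch_pow[of 2] by auto
    obtain n where n: "\<bar>(f ^^ n) y\<bar> \<le> R1" "\<And>j. j < n \<Longrightarrow> \<bar>(f ^^ n) y\<bar> \<le> \<bar>(f ^^ j) y\<bar>"
      "2 * R1 * 2 ^ k \<le> \<bar>Df n y\<bar>" using deep_returns[OF yI yn acc] by blast
    let ?r = "\<bar>(f ^^ n) y\<bar>"
    have r: "0 < ?r" using yn by simp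
    obtain a b where ab: "regular_pullback n y (- (5 * ?r)) (5 * ?r) a b"
      using entry_expansion[where n = n, OF r n(1) yI n(2)] by auto
    then have ab': "-1 \<le> a" "a < y" "y < b" "b \<le> 1" "crit_free n {a..b}"
      and ends: "{(f ^^ n) a, (f ^^ n) b} = {- (5 * ?r), 5 * ?r}" by (auto simp: regular_pullback_def)
    have "0 \<in> (f ^^ n) ` {a..b}" using regular_pullback_image[OF ab] r by auto
    then obtain z where z: "z \<in> {a..b}" "(f ^^ n) z = 0" by auto
    have zab: "a < z" "z < b" using z ends r by (auto simp: doubleton_eq_iff less_le)
    then have zreg: "regular_pullback n z (- (5 * ?r)) (5 * ?r) a b"
      using ab by (simp add: regular_pullback_def)
    have "5 * ?r / 2 * 1 \<le> 5 * ?r / 2 * (1 / (z - a) + 1 / (b - z))"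
    proof (rule mult_left_mono)
      have "1 / 2 \<le> 1 / (z - a)" "1 / 2 \<le> 1 / (b - z)" using ab' zab by (auto simp: field_simps)
      then show "1 \<le> 1 / (z - a) + 1 / (b - z)" by linarith
    qed (use r in auto)
    also have "\<dots> \<le> \<bar>Df n z\<bar>"
      by (rule regular_pullback_Df[OF zreg]) (use z r in auto)
    finally have Dz: "5 * ?r / 2 \<le> \<bar>Df n z\<bar>" by simp
    have zI: "z \<in> I" using z(1) ab' by auto
    have "z \<notin> {s - d / 2..t + d / 2}" using nonzero z(2) by blast
    then have "(d / 2)\<^sup>2 \<le> (y - z)\<^sup>2" using y d(1) by (intro abs_le_square_iff[THEN iffD1]) auto
    then have "(d / 2)\<^sup>2 * (2 * R1 * 2 ^ k * (5 * ?r / 2)) \<le> (y - z)\<^sup>2 * (\<bar>Df n y\<bar> * \<bar>Df n z\<bar>)"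
      using n(3) Dz R1_pos r by (intro mult_mono) auto
    also have "\<dots> \<le> ((f ^^ n) y - (f ^^ n) z)\<^sup>2"
    proof (rule iterate_length_expands(1)[OF yI zI])
      show "crit_free n (closed_segment y z)"
        using crit_free_mono[OF ab'(5), of n "closed_segment y z"] ab' z(1) by (auto simp: closed_segment_eq_real_ivl)
    qed
    also have "\<dots> = ?r * ?r" using z(2) by (simp add: power2_eq_square)
    finally have "(d / 2)\<^sup>2 * (2 * R1 * 2 ^ k * (5 / 2)) * ?r \<le> ?r * ?r"
      by (simp add: ac_simps)
    then have "(d / 2)\<^sup>2 * (2 * R1 * 2 ^ k * (5 / 2)) \<le> ?r" using r by (simp only: mult_le_cancel_right_pos)
    moreover have "4 < 2 ^ k * (2 * R1 * d\<^sup>2)" using k R1_pos d(1) by (simp add: field_simps)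
    moreover have "(d / 2)\<^sup>2 * (2 * R1 * 2 ^ k * (5 / 2)) = 5 / 8 * (2 ^ k * (2 * R1 * d\<^sup>2))"
      by (simp add: power_divide)
    moreover have "?r \<le> 1" using n(1) R1_le by linarith
    ultimately show False by linarith
  qed
  obtain Rs Rt where R: "0 < Rs" "0 < Rt" "\<And>j. Rs \<le> \<bar>(f ^^ j) s\<bar>" "\<And>j. Rt \<le> \<bar>(f ^^ j) t\<bar>"
    using no_acc[of s] no_acc[of t] st by auto
  have stI: "{s..t} \<subseteq> I" using near(1) d(1) by (auto simp: subset_iff)
  have cf: "crit_free n (closed_segment s t)" for n
    using nonzero st d(1) by (auto simp: crit_free_def closed_segment_eq_real_ivl)
  have "min Rs Rt \<le> \<bar>(f ^^ n) y\<bar>" if y: "y \<in> {s..t}" for n y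
  proof -
    have im: "(f ^^ n) ` {s..t} = closed_segment ((f ^^ n) s) ((f ^^ n) t)"
      using image_segment_iterate[OF _ _ cf] stI st by (simp add: closed_segment_eq_real_ivl)
    have "0 \<notin> closed_segment ((f ^^ n) s) ((f ^^ n) t)"
      using nonzero d(1) unfolding im[symmetric] by force
    moreover have "(f ^^ n) y \<in> closed_segment ((f ^^ n) s) ((f ^^ n) t)" using im y by blast
    ultimately show ?thesis using R(3,4)[of n]
      by (auto simp: closed_segment_eq_real_ivl abs_if split: if_splits)
  qed
  then show False using no_escaping_interval[OF _ st stI, of "min Rs Rt"] R(1,2) by auto
qed

section \<open>Shadowing the critical orbit\<close>

lemma kappa_le_B: "\<kappa> \<le> B"
  using D_lower[of 1] D_upper[of 1] by simp

definition gap :: "real \<Rightarrow> nat \<Rightarrow> real" where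
  "gap w i = \<bar>(f ^^ i) (f w) - (f ^^ i) (f 0)\<bar>"

text \<open>
  A bound for the relative error of \<open>f'\<close> between the two orbits at step \<open>i\<close>.
\<close>
definition distortion :: "real \<Rightarrow> nat \<Rightarrow> real" where
  "distortion w i = B / \<kappa> * (gap w i / \<bar>(f ^^ Suc i) 0\<bar>)"

lemma gap_nonneg: "0 \<le> gap w i"
  by (simp add: gap_def)

lemma distortion_nonneg: "0 \<le> distortion w i"
  using B_pos kappa_pos gap_nonneg by (simp add: distortion_def)

lemma cv_orbit: "(f ^^ i) (f 0) = (f ^^ Suc i) 0"
  by (rule iterate_Suc_shift)

lemma cv_orbit_ne_0: "(f ^^ Suc i) 0 \<noteq> 0"
  using critical_orbit_ne_0[of "Suc i"] by simp

lemma D_cv_orbit_ne_0: "D f ((f ^^ i) (f 0)) \<noteq> 0"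
  using D_eq_0_iff[OF iterate_in_I[OF f0_in_I, of i]] cv_orbit_ne_0[of i] by (simp only: cv_orbit) simp

lemma D_ratio:
  assumes "z \<in> I" "\<bar>z - (f ^^ i) (f 0)\<bar> \<le> gap w i"
  shows "\<bar>D f z / D f ((f ^^ i) (f 0)) - 1\<bar> \<le> distortion w i"
proof -
  let ?e = "(f ^^ i) (f 0)"
  have eI: "?e \<in> I" by (rule iterate_in_I[OF f0_in_I])
  have e0: "?e \<noteq> 0" using cv_orbit_ne_0[of i] by (simp only: cv_orbit) simp
  have "\<bar>D f z / D f ?e - 1\<bar> = \<bar>D f z - D f ?e\<bar> / \<bar>D f ?e\<bar>"
    using D_cv_orbit_ne_0[of i] by (simp add: abs_divide[symmetric] diff_divide_distrib)
  also have "\<dots> \<le> (B * gap w i) / (\<kappa> * \<bar>?e\<bar>)"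
  proof (rule frac_le)
    have "B * \<bar>z - ?e\<bar> \<le> B * gap w i" using assms(2) B_pos by simp
    then show "\<bar>D f z - D f ?e\<bar> \<le> B * gap w i" using D_lipschitz[OF assms(1) eI] by linarith
  qed (use D_lower[OF eI] kappa_pos e0 B_pos gap_nonneg in auto)
  finally show ?thesis by (simp add: distortion_def cv_orbit del: funpow_Suc_apply)
qed

text \<open>
  The mean value theorem at each step replaces a distortion estimate for all points between the two orbits.
\<close>
lemma gap_step:
  assumes "w \<in> I"
  obtains q where "gap w (Suc i) = q * \<bar>D f ((f ^^ i) (f 0))\<bar> * gap w i" "\<bar>q - 1\<bar> \<le> distortion w i"
proof -
  let ?y = "(f ^^ i) (f w)" and ?e = "(f ^^ i) (f 0)"
  have yI: "?y \<in> I" and eI: "?e \<in> I" by (rule iterate_in_I[OF maps_I], use assms in simp)+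
  have "\<exists>\<xi>\<in>I. \<bar>\<xi> - ?e\<bar> \<le> \<bar>?y - ?e\<bar> \<and> f ?y - f ?e = D f \<xi> * (?y - ?e)"
  proof (cases ?y ?e rule: linorder_cases)
    case less
    obtain z where "?y < z" "z < ?e" "f ?e - f ?y = D f z * (?e - ?y)"
      by (rule mvt_I[OF less _ _ deriv0]) (use yI eI in auto)
    then show ?thesis using yI eI by (intro bexI[of _ z]) (auto simp: algebra_simps)
  next
    case greater
    obtain z where "?e < z" "z < ?y" "f ?y - f ?e = D f z * (?y - ?e)"
      by (rule mvt_I[OF greater _ _ deriv0]) (use yI eI in auto)
    then show ?thesis using yI eI by (intro bexI[of _ z]) (auto simp: algebra_simps)
  qed (use eI in auto)
  then obtain \<xi> where \<xi>: "\<xi> \<in> I" "\<bar>\<xi> - ?e\<bar> \<le> \<bar>?y - ?e\<bar>" "f ?y - f ?e = D f \<xi> * (?y - ?e)" by blast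
  let ?r = "D f \<xi> / D f ?e"
  have r: "\<bar>?r - 1\<bar> \<le> distortion w i" using D_ratio[of \<xi> i w] \<xi> by (simp add: gap_def)
  have "\<bar>\<bar>?r\<bar> - 1\<bar> \<le> \<bar>?r - 1\<bar>" using abs_triangle_ineq3[of ?r 1] by simp
  then have "\<bar>\<bar>?r\<bar> - 1\<bar> \<le> distortion w i" using r by linarith
  moreover have "gap w (Suc i) = \<bar>?r\<bar> * \<bar>D f ?e\<bar> * gap w i"
    using \<xi>(3) D_cv_orbit_ne_0[of i] by (simp add: gap_def abs_mult)
  ultimately show ?thesis using that by blast
qed

text \<open>
  A bound period: the orbits of \<open>f w\<close> and of the critical value stay close for \<open>p\<close> steps. The
  tolerance decays at rate \<open>2 g\<close> while the critical orbit approaches 0 at rate at most \<open>g\<close>, so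
  the distortion is summable.
\<close>
definition bound :: "real \<Rightarrow> real \<Rightarrow> nat \<Rightarrow> bool" where
  "bound \<eta> w p \<longleftrightarrow> (\<forall>i<p. gap w i \<le> \<eta> * b0 * exp (- (2 * g) * real i))"

text \<open>
  A tolerance small enough for the total distortion of a bound period to be at most 1/4.
\<close>
definition \<eta>0 where "\<eta>0 = \<kappa> * (1 - exp (- g)) / (4 * B * exp g)"

lemma eta0_pos: "0 < \<eta>0"
  using kappa_pos B_pos g_pos by (simp add: \<eta>0_def)

lemma bound_mono: "bound \<eta> w p \<Longrightarrow> i \<le> p \<Longrightarrow> bound \<eta> w i"
  by (simp add: bound_def)

lemma bound_distortion:
  assumes "bound \<eta> w p" "i < p" "0 < \<eta>" "\<eta> \<le> \<eta>0"
  shows "distortion w i \<le> (1 - exp (- g)) / 4 * exp (- g * real i)"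
proof -
  have c: "b0 * exp (- g * real (Suc i)) \<le> \<bar>(f ^^ Suc i) 0\<bar>" by (rule b0(3)) simp
  have "gap w i / \<bar>(f ^^ Suc i) 0\<bar> \<le> (\<eta> * b0 * exp (- (2 * g) * real i)) / (b0 * exp (- g * real (Suc i)))"
    using assms b0(1) c by (intro frac_le) (auto simp: bound_def)
  also have "\<dots> = \<eta> * exp g * exp (- g * real i)"
    using b0(1) by (simp add: field_simps flip: exp_add)
  finally have "distortion w i \<le> B / \<kappa> * (\<eta> * exp g * exp (- g * real i))"
    unfolding distortion_def using B_pos kappa_pos by (intro mult_left_mono) auto
  also have "\<dots> \<le> B / \<kappa> * (\<eta>0 * exp g * exp (- g * real i))"
    using B_pos kappa_pos assms by (intro mult_left_mono mult_right_mono) auto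
  also have "\<dots> = (1 - exp (- g)) / 4 * exp (- g * real i)"
    using B_pos kappa_pos by (simp add: \<eta>0_def)
  finally show ?thesis .
qed

lemma bound_distortion_sum:
  assumes "bound \<eta> w p" "0 < \<eta>" "\<eta> \<le> \<eta>0"
  shows "(\<Sum>i<p. distortion w i) \<le> 1 / 4"
proof -
  have g1: "0 < 1 - exp (- g)" using g_pos by simp
  have "(\<Sum>i<p. distortion w i) \<le> (\<Sum>i<p. (1 - exp (- g)) / 4 * exp (- g * real i))"
    using bound_distortion[OF assms(1) _ assms(2,3)] by (intro sum_mono) auto
  also have "\<dots> = (1 - exp (- g)) / 4 * (\<Sum>i<p. exp (- g * real i))" by (simp only: sum_distrib_left)
  also have "\<dots> \<le> (1 - exp (- g)) / 4 * (1 / (1 - exp (- g)))"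
    using sum_exp_le[OF g_pos, of p] g1 by (intro mult_left_mono) auto
  also have "\<dots> = 1 / 4" using g1 by (simp add: field_simps)
  finally show ?thesis .
qed

lemma bound_Df_ratio:
  assumes "bound \<eta> w p" "0 < \<eta>" "\<eta> \<le> \<eta>0" "w \<in> I"
  shows "\<bar>Df p (f w) / Df p (f 0) - 1\<bar> \<le> 2 * (\<Sum>i<p. distortion w i)"
proof -
  have "\<bar>(\<Prod>i<p. D f ((f ^^ i) (f w)) / D f ((f ^^ i) (f 0))) - 1\<bar> \<le> 2 * (\<Sum>i<p. distortion w i)"
    using bound_distortion_sum[OF assms(1-3)] iterate_in_I[OF maps_I[OF assms(4)]]
    by (intro prod_near_one D_ratio) (auto simp: gap_def)
  then show ?thesis using Df[OF f0_in_I] Df[OF maps_I[OF assms(4)]] by (simp add: prod_dividef)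
qed

lemma bound_Df_lower:
  assumes "bound \<eta> w p" "0 < \<eta>" "\<eta> \<le> \<eta>0" "w \<in> I"
  shows "\<bar>Df p (f 0)\<bar> / 2 \<le> \<bar>Df p (f w)\<bar>"
proof -
  have "\<bar>Df p (f w) / Df p (f 0) - 1\<bar> \<le> 1 / 2"
    using bound_Df_ratio[OF assms] bound_distortion_sum[OF assms(1-3)] by linarith
  then have "1 / 2 \<le> \<bar>Df p (f w) / Df p (f 0)\<bar>" by linarith
  then show ?thesis using Df_critical_value_ne_0[of p] by (simp add: abs_divide field_simps)
qed

lemma bound_gap:
  assumes "bound \<eta> w p" "0 < \<eta>" "\<eta> \<le> \<eta>0" "w \<in> I"
  shows "gap w p \<le> 3 / 2 * \<bar>Df p (f 0)\<bar> * gap w 0" and "\<bar>Df p (f 0)\<bar> * gap w 0 / 2 \<le> gap w p"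
proof -
  have "\<forall>i. \<exists>q. gap w (Suc i) = q * \<bar>D f ((f ^^ i) (f 0))\<bar> * gap w i \<and> \<bar>q - 1\<bar> \<le> distortion w i"
    using gap_step[OF assms(4)] by metis
  then obtain q where q: "\<And>i. gap w (Suc i) = q i * \<bar>D f ((f ^^ i) (f 0))\<bar> * gap w i"
    "\<And>i. \<bar>q i - 1\<bar> \<le> distortion w i" by metis
  have eq_n: "gap w n = (\<Prod>i<n. q i) * \<bar>Df n (f 0)\<bar> * gap w 0" for n
  proof (induction n)
    case (Suc n)
    have "\<bar>Df (Suc n) (f 0)\<bar> = \<bar>D f ((f ^^ n) (f 0))\<bar> * \<bar>Df n (f 0)\<bar>"
      using Df_Suc'[OF f0_in_I, of n] by (simp add: abs_mult)
    then show ?case using q(1)[of n] Suc by (simp add: ac_simps)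
  qed (use f0_in_I in simp)
  have eq: "gap w p = (\<Prod>i<p. q i) * (\<bar>Df p (f 0)\<bar> * gap w 0)"
    using eq_n[of p] by (simp only: mult.assoc)
  have "\<bar>(\<Prod>i<p. q i) - 1\<bar> \<le> 1 / 2"
    using prod_near_one[of p q "distortion w"] q(2) bound_distortion_sum[OF assms(1-3)] by simp
  then have "1 / 2 \<le> (\<Prod>i<p. q i)" "(\<Prod>i<p. q i) \<le> 3 / 2" by linarith+
  moreover have "0 \<le> \<bar>Df p (f 0)\<bar> * gap w 0" using gap_nonneg by simp
  ultimately have "1 / 2 * (\<bar>Df p (f 0)\<bar> * gap w 0) \<le> gap w p"
    "gap w p \<le> 3 / 2 * (\<bar>Df p (f 0)\<bar> * gap w 0)"
    unfolding eq by (blast intro: mult_right_mono)+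
  then show "gap w p \<le> 3 / 2 * \<bar>Df p (f 0)\<bar> * gap w 0" "\<bar>Df p (f 0)\<bar> * gap w 0 / 2 \<le> gap w p"
    by simp_all
qed

lemma gap_0: "w \<in> I \<Longrightarrow> gap w 0 = f 0 - f w"
  using f_le_critical_value by (simp add: gap_def)

lemma gap_0_upper: "w \<in> I \<Longrightarrow> gap w 0 \<le> B * w\<^sup>2"
  using gap_0 critical_value_upper by simp

lemma bound_gap_upper:
  assumes "bound \<eta> w p" "0 < \<eta>" "\<eta> \<le> \<eta>0" "w \<in> I"
  shows "gap w p \<le> 3 / 2 * B * (\<bar>Df p (f 0)\<bar> * w\<^sup>2)"
proof -
  have "3 / 2 * \<bar>Df p (f 0)\<bar> * gap w 0 \<le> 3 / 2 * \<bar>Df p (f 0)\<bar> * (B * w\<^sup>2)"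
    using gap_0_upper[OF assms(4)] by (intro mult_left_mono) auto
  then show ?thesis using bound_gap(1)[OF assms] by (simp add: ac_simps)
qed

definition released :: "real \<Rightarrow> real \<Rightarrow> nat \<Rightarrow> bool" where
  "released \<eta> w p \<longleftrightarrow> bound \<eta> w p \<and> \<eta> * b0 * exp (- (2 * g) * real p) < gap w p"

lemma ex_released:
  assumes "0 < \<eta>" "\<eta> \<le> \<eta>0" "w \<in> I" "w \<noteq> 0"
  shows "\<exists>p. released \<eta> w p"
proof -
  let ?P = "\<lambda>i. \<eta> * b0 * exp (- (2 * g) * real i) < gap w i"
  have "\<exists>p. ?P p"
  proof (rule ccontr)
    assume "\<not> ?thesis"
    then have b: "bound \<eta> w p" for p by (simp add: bound_def not_less)
    have g0: "0 < gap w 0"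
    proof -
      have "0 < \<kappa> / 2 * w\<^sup>2" using kappa_pos assms(4) by simp
      then show ?thesis using critical_value_lower[OF assms(3)] gap_0[OF assms(3)] by linarith
    qed
    have "a0 * lam ^ p * gap w 0 / 2 \<le> 2" for p
    proof -
      have "a0 * lam ^ p * gap w 0 \<le> \<bar>Df p (f 0)\<bar> * gap w 0" using a0(3) g0 by (intro mult_right_mono) auto
      moreover have "\<bar>Df p (f 0)\<bar> * gap w 0 / 2 \<le> gap w p" using bound_gap(2)[OF b assms(1-3)] .
      moreover have "gap w p \<le> 2"
        using iterate_in_I[OF maps_I[OF assms(3)], of p] iterate_in_I[OF f0_in_I, of p] by (auto simp: gap_def)
      ultimately show ?thesis by linarith
    qed
    then have "lam ^ p \<le> 4 / (a0 * gap w 0)" for p using a0(1) g0 by (simp add: field_simps)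
    moreover obtain p where "4 / (a0 * gap w 0) < lam ^ p" using real_arch_pow[OF lam_gt_1] by blast
    ultimately show False by (meson not_le)
  qed
  define p where "p = (LEAST i. ?P i)"
  have "?P p" unfolding p_def using \<open>\<exists>p. ?P p\<close> by (rule LeastI_ex)
  moreover have "\<not> ?P i" if "i < p" for i using not_less_Least that unfolding p_def by blast
  ultimately have "released \<eta> w p" unfolding released_def bound_def by (meson not_le)
  then show ?thesis ..
qed

lemma released_size:
  assumes "released \<eta> w p" "0 < \<eta>" "\<eta> \<le> \<eta>0" "w \<in> I"
  shows "\<eta> * b0 * exp (- (2 * g) * real p) < 3 / 2 * B * (\<bar>Df p (f 0)\<bar> * w\<^sup>2)"
  using bound_gap_upper[OF _ assms(2-4), of p] assms(1) by (simp add: released_def)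

lemma ex_long_bound_period:
  assumes "0 < \<eta>" "\<eta> \<le> \<eta>0"
  shows "\<exists>\<delta>>0. \<forall>w\<in>I. w \<noteq> 0 \<and> \<bar>w\<bar> \<le> \<delta> \<longrightarrow> (\<exists>p>P. released \<eta> w p)"
proof -
  define M where "M = 3 / 2 * B * ((\<Sum>i\<le>P. \<bar>Df i (f 0)\<bar>) + 1)"
  define T where "T = \<eta> * b0 * exp (- (2 * g) * real P)"
  have M: "0 < M" using B_pos by (simp add: M_def sum_nonneg add_nonneg_pos)
  have T: "0 < T" using assms b0(1) by (simp add: T_def)
  define \<delta> where "\<delta> = sqrt (T / M)"
  have "P < p" if w: "w \<in> I" "\<bar>w\<bar> \<le> \<delta>" and p: "released \<eta> w p" for w p
  proof (rule ccontr)
    assume "\<not> P < p"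
    then have pP: "p \<le> P" by simp
    have "T \<le> \<eta> * b0 * exp (- (2 * g) * real p)"
      unfolding T_def using assms b0(1) g_pos pP by (intro mult_left_mono) (auto intro: mult_left_mono)
    also have "\<dots> < 3 / 2 * B * (\<bar>Df p (f 0)\<bar> * w\<^sup>2)" by (rule released_size[OF p assms w(1)])
    also have "\<dots> = 3 / 2 * B * \<bar>Df p (f 0)\<bar> * w\<^sup>2" by simp
    also have "\<dots> \<le> M * w\<^sup>2"
    proof (rule mult_right_mono)
      have "\<bar>Df p (f 0)\<bar> \<le> (\<Sum>i\<le>P. \<bar>Df i (f 0)\<bar>)"
        using pP by (intro member_le_sum) auto
      then show "3 / 2 * B * \<bar>Df p (f 0)\<bar> \<le> M" unfolding M_def using B_pos by (intro mult_left_mono) auto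
    qed simp
    also have "\<dots> \<le> M * \<delta>\<^sup>2"
      using w(2) M by (intro mult_left_mono abs_le_square_iff[THEN iffD1]) auto
    also have "\<dots> = T" using M T by (simp add: \<delta>_def)
    finally show False by simp
  qed
  moreover have "0 < \<delta>" using M T by (simp add: \<delta>_def)
  ultimately show ?thesis using ex_released[OF assms] by blast
qed

lemma bound_Df_Suc:
  assumes "bound \<eta> w p" "0 < \<eta>" "\<eta> \<le> \<eta>0" "w \<in> I"
  shows "\<kappa> / 2 * (\<bar>w\<bar> * \<bar>Df p (f 0)\<bar>) \<le> \<bar>Df (Suc p) w\<bar>"
proof -
  have "\<bar>Df p (f 0)\<bar> / 2 * (\<kappa> * \<bar>w\<bar>) \<le> \<bar>Df p (f w)\<bar> * \<bar>D f w\<bar>"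
    using bound_Df_lower[OF assms] D_lower[OF assms(4)] kappa_pos by (intro mult_mono) auto
  then show ?thesis using Df_Suc[OF assms(4)] by (simp add: abs_mult ac_simps)
qed

lemma lam_power_ge: "exp (4 * g * real k) \<le> lam ^ k"
  unfolding lam_power_exp using g_less by (auto intro!: mult_right_mono)

text \<open>
  At the end of the bound period \<open>A * w\<^sup>2\<close> is at least of the order \<open>exp (- 2 g p)\<close>, where \<open>A\<close> is the derivative along
  the critical orbit; the derivative at \<open>w\<close> is of the order \<open>A * \<bar>w\<bar>\<close>, whose square is
  \<open>A * w\<^sup>2 * A\<close>, and \<open>A\<close> grows at least like \<open>exp (4 g p)\<close>.
\<close>
lemma released_growth:
  assumes "released \<eta> w p" "0 < \<eta>" "\<eta> \<le> \<eta>0" "w \<in> I"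
  shows "\<kappa>\<^sup>2 * \<eta> * b0 * a0 / (6 * B) * exp (2 * g * real p) \<le> (Df (Suc p) w)\<^sup>2"
proof -
  let ?A = "\<bar>Df p (f 0)\<bar>"
  have b: "bound \<eta> w p" using assms(1) by (simp add: released_def)
  have "\<eta> * b0 * exp (- (2 * g) * real p) * (a0 * exp (4 * g * real p)) \<le> 3 / 2 * B * (?A * w\<^sup>2) * ?A"
  proof (rule mult_mono)
    show "\<eta> * b0 * exp (- (2 * g) * real p) \<le> 3 / 2 * B * (?A * w\<^sup>2)"
      using released_size[OF assms] by simp
    have "a0 * exp (4 * g * real p) \<le> a0 * lam ^ p" using lam_power_ge a0(1) by simp
    then show "a0 * exp (4 * g * real p) \<le> ?A" using a0(3)[of p] by linarith
  qed (use a0(1) B_pos in auto)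
  moreover have "exp (- (2 * g) * real p) * exp (4 * g * real p) = exp (2 * g * real p)"
    by (simp flip: exp_add)
  ultimately have "\<eta> * b0 * a0 * exp (2 * g * real p) \<le> 3 / 2 * B * (\<bar>w\<bar> * ?A)\<^sup>2"
    by (simp add: power2_eq_square ac_simps)
  then have "\<kappa>\<^sup>2 / (6 * B) * (\<eta> * b0 * a0 * exp (2 * g * real p)) \<le> \<kappa>\<^sup>2 / (6 * B) * (3 / 2 * B * (\<bar>w\<bar> * ?A)\<^sup>2)"
    using B_pos by (intro mult_left_mono) auto
  also have "\<dots> = (\<kappa> / 2 * (\<bar>w\<bar> * ?A))\<^sup>2" using B_pos by (simp add: power_mult_distrib power_divide)
  also have "\<dots> \<le> \<bar>Df (Suc p) w\<bar>\<^sup>2" using bound_Df_Suc[OF b assms(2-4)] kappa_pos by (intro power_mono) auto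
  finally show ?thesis by (simp add: mult.assoc)
qed

lemma ex_released_growth:
  assumes "0 < \<eta>" "\<eta> \<le> \<eta>0"
  shows "\<exists>P. \<forall>p>P. \<forall>w\<in>I. released \<eta> w p \<longrightarrow> M \<le> \<bar>Df (Suc p) w\<bar>"
proof -
  define C where "C = \<kappa>\<^sup>2 * \<eta> * b0 * a0 / (6 * B)"
  have C: "0 < C" using kappa_pos assms b0(1) a0(1) B_pos by (simp add: C_def)
  obtain P where P: "M\<^sup>2 / C < exp (2 * g) ^ P" using real_arch_pow[of "exp (2 * g)"] g_pos by auto
  have "M \<le> \<bar>Df (Suc p) w\<bar>" if "p > P" "w \<in> I" "released \<eta> w p" for p w
  proof -
    have "exp (2 * g) ^ P = exp (2 * g * real P)" by (simp add: exp_of_nat_mult[symmetric] mult.commute)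
    also have "\<dots> \<le> exp (2 * g * real p)" using that(1) g_pos by simp
    finally have "M\<^sup>2 / C \<le> exp (2 * g * real p)" using P by linarith
    then have "M\<^sup>2 \<le> C * exp (2 * g * real p)" using C by (simp add: field_simps)
    also have "\<dots> \<le> (Df (Suc p) w)\<^sup>2" using released_growth[OF that(3) assms that(2)] by (simp add: C_def)
    finally have "\<bar>M\<bar> \<le> \<bar>Df (Suc p) w\<bar>" by (simp add: abs_le_square_iff)
    then show ?thesis by linarith
  qed
  then show ?thesis by blast
qed

section \<open>Derivatives are bounded below by the distance to the critical point\<close>

text \<open>
  Up to the first entry into a small neighbourhood of 0 the derivative is bounded below by \<open>entry_derivative\<close>. A
  complete bound period gains more than the constant lost there, so the orbit can be
  restarted after it. An incomplete one only costs the factor \<open>\<bar>f' w\<bar>\<close>, which is at least of the order of the distance of \<open>w\<close> to 0.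
\<close>
theorem ex_derivative_ge_distance:
  "\<exists>C>0. \<forall>x\<in>I. \<forall>k r. 0 < r \<and> r \<le> 1 \<and> (\<forall>j<k. r \<le> \<bar>(f ^^ j) x\<bar>) \<longrightarrow> C * r \<le> \<bar>Df k x\<bar>"
proof -
  note eta = eta0_pos order_refl[of \<eta>0]
  obtain P where P: "\<And>p w. p > P \<Longrightarrow> w \<in> I \<Longrightarrow> released \<eta>0 w p \<Longrightarrow> 1 / (2 * R1) \<le> \<bar>Df (Suc p) w\<bar>"
    using ex_released_growth[OF eta, of "1 / (2 * R1)"] by blast
  obtain \<delta>' where \<delta>': "\<delta>' > 0" "\<And>w. w \<in> I \<Longrightarrow> w \<noteq> 0 \<Longrightarrow> \<bar>w\<bar> \<le> \<delta>' \<Longrightarrow> \<exists>p>P. released \<eta>0 w p"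
    using ex_long_bound_period[OF eta, of P] by blast
  define \<delta> where "\<delta> = min \<delta>' R1"
  have \<delta>: "0 < \<delta>" "\<delta> \<le> R1" "\<delta> \<le> \<delta>'" using \<delta>' R1_pos by (auto simp: \<delta>_def)
  obtain C1 where C1: "C1 > 0" "\<And>x n. x \<in> I \<Longrightarrow> (\<And>j. j < n \<Longrightarrow> \<delta> \<le> \<bar>(f ^^ j) x\<bar>) \<Longrightarrow> C1 \<le> \<bar>Df n x\<bar>"
    using ex_away_lower[OF \<delta>(1)] by blast
  define C where "C = min C1 (2 * R1 * (\<kappa> / 2 * a0))"
  have C: "0 < C" "C \<le> C1" "C \<le> 2 * R1 * (\<kappa> / 2 * a0)"
    using C1 R1_pos kappa_pos a0(1) by (auto simp: C_def)
  have "C * r \<le> \<bar>Df k x\<bar>" if "x \<in> I" "0 < r" "r \<le> 1" "\<And>j. j < k \<Longrightarrow> r \<le> \<bar>(f ^^ j) x\<bar>" for x k r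
    using that
  proof (induction k arbitrary: x rule: less_induct)
    case (less k)
    show ?case
    proof (cases "\<forall>j<k. \<delta> \<le> \<bar>(f ^^ j) x\<bar>")
      case True
      have "C * r \<le> C * 1" using less.prems C by (intro mult_left_mono) auto
      moreover have "C1 \<le> \<bar>Df k x\<bar>" using C1(2)[of x k] True less.prems(1) by blast
      ultimately show ?thesis using C(2) by linarith
    next
      case False
      then have ex: "\<exists>j. j < k \<and> \<bar>(f ^^ j) x\<bar> < \<delta>" by auto
      define m where "m = (LEAST j. j < k \<and> \<bar>(f ^^ j) x\<bar> < \<delta>)"
      have m: "m < k" "\<bar>(f ^^ m) x\<bar> < \<delta>" using LeastI_ex[OF ex] unfolding m_def by auto
      have before: "\<delta> \<le> \<bar>(f ^^ j) x\<bar>" if "j < m" for j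
        using not_less_Least[of j "\<lambda>j. j < k \<and> \<bar>(f ^^ j) x\<bar> < \<delta>"] that m(1) by (auto simp: m_def)
      have Dm: "2 * R1 \<le> \<bar>Df m x\<bar>"
        using before m(2) by (intro entry_derivative[OF \<delta>(1,2) less.prems(1)]) auto
      let ?w = "(f ^^ m) x"
      have wI: "?w \<in> I" by (rule iterate_in_I[OF less.prems(1)])
      have rw: "r \<le> \<bar>?w\<bar>" using less.prems(4) m(1) by blast
      obtain p where p: "p > P" "released \<eta>0 ?w p"
      proof -
        have "?w \<noteq> 0" "\<bar>?w\<bar> \<le> \<delta>'" using rw less.prems(2) m(2) \<delta>(3) by auto
        then show thesis using \<delta>'(2)[OF wI] that by blast
      qed
      have b: "bound \<eta>0 ?w p" using p(2) by (simp add: released_def)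
      show ?thesis
      proof (cases "k - m \<le> Suc p")
        case True
        then obtain i where i: "k - m = Suc i" "i \<le> p" using m(1) by (cases "k - m") auto
        have "\<kappa> / 2 * (r * a0) \<le> \<kappa> / 2 * (\<bar>?w\<bar> * \<bar>Df i (f 0)\<bar>)"
          using rw a0_le_Df a0(1) kappa_pos by (intro mult_left_mono mult_mono) auto
        also have "\<dots> \<le> \<bar>Df (k - m) ?w\<bar>"
          unfolding i(1) by (rule bound_Df_Suc[OF bound_mono[OF b i(2)] eta wI])
        finally have "\<kappa> / 2 * (r * a0) * (2 * R1) \<le> \<bar>Df (k - m) ?w\<bar> * \<bar>Df m x\<bar>"
          using Dm R1_pos less.prems(2) a0(1) kappa_pos by (intro mult_mono) auto
        moreover have "C * r \<le> 2 * R1 * (\<kappa> / 2 * a0) * r" using C(3) less.prems(2) by (intro mult_right_mono) auto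
        moreover have "\<bar>Df k x\<bar> = \<bar>Df (k - m) ?w\<bar> * \<bar>Df m x\<bar>"
          using Df_split[OF less.prems(1), of m k] m(1) by (simp add: abs_mult)
        ultimately show ?thesis by (simp add: ac_simps)
      next
        case False
        define n where "n = m + Suc p"
        have n: "n < k" using False by (simp add: n_def)
        let ?z = "(f ^^ n) x"
        have "\<bar>Df n x\<bar> = \<bar>Df (Suc p) ?w\<bar> * \<bar>Df m x\<bar>"
          unfolding n_def using Df_add[OF less.prems(1), of m "Suc p"] by (simp add: abs_mult)
        moreover have "1 / (2 * R1) * (2 * R1) \<le> \<bar>Df (Suc p) ?w\<bar> * \<bar>Df m x\<bar>"
          using P[OF p(1) wI p(2)] Dm R1_pos by (intro mult_mono) auto
        ultimately have Dn: "1 \<le> \<bar>Df n x\<bar>" using R1_pos by simp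
        have "C * r \<le> \<bar>Df (k - n) ?z\<bar>"
        proof (rule less.IH[OF _ iterate_in_I[OF less.prems(1)] less.prems(2,3)])
          show "k - n < k" using n by (simp add: n_def)
          show "r \<le> \<bar>(f ^^ j) ?z\<bar>" if "j < k - n" for j
            using less.prems(4)[of "n + j"] that by (simp add: iterate_add)
        qed
        then have "C * r * 1 \<le> \<bar>Df (k - n) ?z\<bar> * \<bar>Df n x\<bar>"
          using Dn by (intro mult_mono) auto
        then show ?thesis using Df_split[OF less.prems(1), of n k] n by (simp add: abs_mult)
      qed
    qed
  qed
  then show ?thesis using C(1) by blast
qed

section \<open>Cancellation along bound periods\<close>

text \<open>
  The derivatives \<open>A\<^sub>j = \<bar>(f\<^sup>j)'(f 0)\<bar>\<close> may be much larger than \<open>lam ^ j\<close> for some \<open>j\<close> and drop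
  afterwards, which would spoil the comparison of a tail of the horizontality series with \<open>\<bar>w\<bar>\<close>,
  which may be as small as \<open>exp (- g p) / sqrt A\<^sub>p\<close>, up to constants. The drop is controlled by
  \<open>A\<^sub>j \<ge> const * exp (- g j) * A\<^sub>i\<close>, a consequence of the preceding theorem; the geometric mean
  with \<open>A\<^sub>j \<ge> a0 * lam ^ j\<close> keeps \<open>sqrt A\<^sub>i\<close> as well as an exponential factor.
\<close>
lemma ex_critical_derivative_interpolation:
  "\<exists>N>0. \<forall>i j. i \<le> j \<longrightarrow>
     N * sqrt \<bar>Df i (f 0)\<bar> * exp (3 / 2 * g * real (Suc j)) \<le> \<bar>Df (Suc j) (f 0)\<bar>"
proof -
  obtain C where C: "C > 0" "\<And>x k r. x \<in> I \<Longrightarrow> 0 < r \<Longrightarrow> r \<le> 1 \<Longrightarrow> (\<And>j. j < k \<Longrightarrow> r \<le> \<bar>(f ^^ j) x\<bar>) \<Longrightarrow> C * r \<le> \<bar>Df k x\<bar>"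
    using ex_derivative_ge_distance by blast
  \<comment> \<open>\<open>sqrt (exp (- g j) * lam ^ j)\<close> is at least \<open>exp (3/2 g j)\<close> because \<open>4 g < ln lam\<close>\<close>
  define N where "N = sqrt (C * b0 * a0)"
  have N: "0 < N" "N\<^sup>2 = C * b0 * a0" using C(1) b0(1) a0(1) by (auto simp: N_def)
  have "N * sqrt \<bar>Df i (f 0)\<bar> * exp (3 / 2 * g * real (Suc j)) \<le> \<bar>Df (Suc j) (f 0)\<bar>" if ij: "i \<le> j" for i j
  proof (rule power2_le_imp_le)
    let ?e = "(f ^^ i) (f 0)" and ?r = "b0 * exp (- g * real (Suc j))"
    have "C * ?r \<le> \<bar>Df (Suc j - i) ?e\<bar>"
    proof (rule C(2)[OF iterate_in_I[OF f0_in_I]])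
      show "0 < ?r" using b0(1) by simp
      have "?r \<le> 1 * 1" using b0(1,2) g_pos by (intro mult_mono) auto
      then show "?r \<le> 1" by simp
      fix l assume l: "l < Suc j - i"
      have "?r \<le> b0 * exp (- g * real (Suc (i + l)))"
        using b0(1) g_pos l by (intro mult_left_mono) auto
      also have "\<dots> \<le> \<bar>(f ^^ Suc (i + l)) 0\<bar>" by (rule b0(3)) simp
      finally show "?r \<le> \<bar>(f ^^ l) ?e\<bar>" by (simp only: iterate_add cv_orbit add_Suc)
    qed
    then have "C * ?r * \<bar>Df i (f 0)\<bar> \<le> \<bar>Df (Suc j - i) ?e\<bar> * \<bar>Df i (f 0)\<bar>" by (rule mult_right_mono) simp
    also have "\<dots> = \<bar>Df (Suc j) (f 0)\<bar>" using Df_split[OF f0_in_I, of i "Suc j"] ij by (simp add: abs_mult)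
    finally have 1: "C * ?r * \<bar>Df i (f 0)\<bar> \<le> \<bar>Df (Suc j) (f 0)\<bar>" .
    have "a0 * exp (4 * g * real (Suc j)) \<le> a0 * lam ^ Suc j" using lam_power_ge[of "Suc j"] a0(1) by (intro mult_left_mono) auto
    then have 2: "a0 * exp (4 * g * real (Suc j)) \<le> \<bar>Df (Suc j) (f 0)\<bar>" using a0(3)[of "Suc j"] by linarith
    have "(N * sqrt \<bar>Df i (f 0)\<bar> * exp (3 / 2 * g * real (Suc j)))\<^sup>2
        = C * b0 * a0 * \<bar>Df i (f 0)\<bar> * (exp (3 / 2 * g * real (Suc j)))\<^sup>2"
      using N by (simp add: power_mult_distrib)
    also have "(exp (3 / 2 * g * real (Suc j)))\<^sup>2 = exp (- g * real (Suc j)) * exp (4 * g * real (Suc j))"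
      by (simp add: power2_eq_square flip: exp_add)
    also have "C * b0 * a0 * \<bar>Df i (f 0)\<bar> * (exp (- g * real (Suc j)) * exp (4 * g * real (Suc j)))
        = (C * ?r * \<bar>Df i (f 0)\<bar>) * (a0 * exp (4 * g * real (Suc j)))" by (simp only: ac_simps)
    also have "\<dots> \<le> \<bar>Df (Suc j) (f 0)\<bar> * \<bar>Df (Suc j) (f 0)\<bar>"
      using 1 2 a0(1) by (intro mult_mono) auto
    finally show "(N * sqrt \<bar>Df i (f 0)\<bar> * exp (3 / 2 * g * real (Suc j)))\<^sup>2 \<le> \<bar>Df (Suc j) (f 0)\<bar>\<^sup>2"
      by (simp add: power2_eq_square)
  qed simp
  then show ?thesis using N(1) by blast
qed

lemma bound_distortion_le_sqrt:
  assumes "bound \<eta> w p" "l < p" "0 < \<eta>" "\<eta> \<le> \<eta>0" "w \<in> I"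
  shows "distortion w l \<le> B / (\<kappa> * b0) * exp g * sqrt (3 / 2 * B * b0) * sqrt \<eta> * \<bar>w\<bar> * sqrt \<bar>Df l (f 0)\<bar>"
proof -
  let ?A = "\<bar>Df l (f 0)\<bar>"
  have gl: "gap w l \<le> sqrt (3 / 2 * B * b0) * sqrt \<eta> * exp (- g * real l) * \<bar>w\<bar> * sqrt ?A"
  proof (rule power2_le_imp_le)
    have 1: "gap w l \<le> \<eta> * b0 * exp (- (2 * g) * real l)" using assms(1,2) by (simp add: bound_def)
    have 2: "gap w l \<le> 3 / 2 * B * (?A * w\<^sup>2)"
      by (rule bound_gap_upper[OF bound_mono[OF assms(1)] assms(3-5)]) (use assms(2) in simp)
    have "(gap w l)\<^sup>2 \<le> (\<eta> * b0 * exp (- (2 * g) * real l)) * (3 / 2 * B * (?A * w\<^sup>2))"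
      unfolding power2_eq_square using 1 2 gap_nonneg assms(3) b0(1)
      by (intro mult_mono) (auto simp: power2_eq_square)
    also have "exp (- (2 * g) * real l) = (exp (- g * real l))\<^sup>2" by (simp add: power2_eq_square flip: exp_add)
    also have "\<eta> * b0 * (exp (- g * real l))\<^sup>2 * (3 / 2 * B * (?A * w\<^sup>2))
        = (sqrt (3 / 2 * B * b0) * sqrt \<eta> * exp (- g * real l) * \<bar>w\<bar> * sqrt ?A)\<^sup>2"
      using assms(3) b0(1) B_pos by (simp add: power_mult_distrib)
    finally show "(gap w l)\<^sup>2 \<le> (sqrt (3 / 2 * B * b0) * sqrt \<eta> * exp (- g * real l) * \<bar>w\<bar> * sqrt ?A)\<^sup>2" .
  qed (use assms(3) b0(1) B_pos in simp)
  have c: "b0 * exp (- g * real (Suc l)) \<le> \<bar>(f ^^ Suc l) 0\<bar>" by (rule b0(3)) simp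
  have "distortion w l \<le> B / \<kappa> * ((sqrt (3 / 2 * B * b0) * sqrt \<eta> * exp (- g * real l) * \<bar>w\<bar> * sqrt ?A)
      / (b0 * exp (- g * real (Suc l))))"
    unfolding distortion_def
    using gl c b0(1) B_pos kappa_pos assms(3) by (intro mult_left_mono frac_le) auto
  also have "\<dots> = B / (\<kappa> * b0) * exp g * sqrt (3 / 2 * B * b0) * sqrt \<eta> * \<bar>w\<bar> * sqrt ?A"
  proof -
    have "exp (- g * real l) / exp (- g * real (Suc l)) = exp g"
      by (simp add: algebra_simps flip: exp_diff)
    then have "exp (- g * real l) = exp g * exp (- g * real (Suc l))" by (simp add: field_simps)
    then show ?thesis using b0(1) kappa_pos by (simp add: field_simps)
  qed
  finally show ?thesis .
qed

lemma cand_term_Df: "cand_term f v x j = v ((f ^^ j) x) / of_real (Df (Suc j) x)"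
  by (simp add: cand_term_def Df_def)

lemma gap_le_distortion: "gap w i \<le> distortion w i"
proof -
  have c: "0 < \<bar>(f ^^ Suc i) 0\<bar>" "\<bar>(f ^^ Suc i) 0\<bar> \<le> 1"
    using cv_orbit_ne_0[of i] iterate_in_I[of 0 "Suc i"] by (auto simp: abs_le_iff)
  have "1 * (gap w i / 1) \<le> B / \<kappa> * (gap w i / \<bar>(f ^^ Suc i) 0\<bar>)"
    using kappa_le_B kappa_pos gap_nonneg c by (intro mult_mono divide_left_mono) auto
  then show ?thesis by (simp add: distortion_def)
qed

lemma bound_orbit_ne_0:
  assumes "bound \<eta> w p" "i < p" "0 < \<eta>" "\<eta> \<le> \<eta>0"
  shows "(f ^^ i) (f w) \<noteq> 0"
proof
  assume z: "(f ^^ i) (f w) = 0"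
  have "distortion w i \<le> (\<Sum>i<p. distortion w i)"
    using assms(2) distortion_nonneg by (intro member_le_sum) auto
  then have "distortion w i \<le> 1 / 4" using bound_distortion_sum[OF assms(1,3,4)] by linarith
  moreover have "gap w i = \<bar>(f ^^ Suc i) 0\<bar>" using z by (simp add: gap_def cv_orbit del: funpow_Suc_apply)
  then have "distortion w i = B / \<kappa>" using cv_orbit_ne_0[of i] by (simp add: distortion_def del: funpow_Suc_apply)
  moreover have "1 \<le> B / \<kappa>" using kappa_le_B kappa_pos by simp
  ultimately show False by linarith
qed

lemma cand_term_difference:
  assumes b: "bound \<eta> w p" "0 < \<eta>" "\<eta> \<le> \<eta>0" "w \<in> I" and j: "j < p"
    and V: "\<And>x. x \<in> I \<Longrightarrow> norm (v x) \<le> V"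
    and L: "0 \<le> L" "\<And>x y. x \<in> I \<Longrightarrow> y \<in> I \<Longrightarrow> norm (v x - v y) \<le> L * \<bar>x - y\<bar>"
  shows "norm (cand_term f v (f w) j - cand_term f v (f 0) j)
    \<le> (2 * L + 4 * V) * (\<Sum>l\<le>j. distortion w l) / \<bar>Df (Suc j) (f 0)\<bar>"
proof -
  let ?s = "\<Sum>l\<le>j. distortion w l" and ?D = "Df (Suc j) (f 0)"
  let ?y = "(f ^^ j) (f w)" and ?e = "(f ^^ j) (f 0)"
  have bj: "bound \<eta> w (Suc j)" using bound_mono[OF b(1)] j by simp
  have D0: "?D \<noteq> 0" by (rule Df_critical_value_ne_0)
  have s0: "0 \<le> ?s" using distortion_nonneg by (intro sum_nonneg) auto
  define q where "q = Df (Suc j) (f w) / ?D"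
  have Dw: "Df (Suc j) (f w) = ?D * q" using D0 by (simp add: q_def)
  have q1: "\<bar>q - 1\<bar> \<le> 2 * ?s"
    using bound_Df_ratio[OF bj b(2-4)] by (simp only: q_def lessThan_Suc_atMost)
  have "?s \<le> 1 / 4" using bound_distortion_sum[OF bj b(2,3)] by (simp only: lessThan_Suc_atMost)
  then have qh: "1 / 2 \<le> q" using q1 by linarith
  have inv2: "1 / q \<le> 2" using qh by (simp add: field_simps)
  have "\<bar>1 / q - 1\<bar> = \<bar>q - 1\<bar> * (1 / q)" using qh by (simp add: abs_if field_simps)
  also have "\<dots> \<le> (2 * ?s) * 2" using q1 inv2 qh by (intro mult_mono) auto
  finally have inv1: "\<bar>1 / q - 1\<bar> \<le> 4 * ?s" by simp
  have yI: "?y \<in> I" and eI: "?e \<in> I" by (rule iterate_in_I[OF maps_I], use b(4) in simp)+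
  have "gap w j \<le> ?s" using gap_le_distortion[of w j] member_le_sum[of j "{..j}" "distortion w"] distortion_nonneg by force
  then have "L * gap w j \<le> L * ?s" using L(1) by (rule mult_left_mono)
  then have va: "norm (v ?y - v ?e) \<le> L * ?s" using L(2)[OF yI eI] by (simp add: gap_def)
  have V0: "0 \<le> V" using V[OF eI] norm_ge_zero order_trans by blast
  have "cand_term f v (f w) j - cand_term f v (f 0) j
      = ((v ?y - v ?e) * of_real (1 / q) + v ?e * of_real (1 / q - 1)) / of_real ?D"
    using D0 qh unfolding cand_term_Df Dw by (simp add: field_simps)
  then have "norm (cand_term f v (f w) j - cand_term f v (f 0) j)
      = norm ((v ?y - v ?e) * of_real (1 / q) + v ?e * of_real (1 / q - 1)) / \<bar>?D\<bar>"
    by (simp only: norm_divide norm_of_real)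
  also have "\<dots> \<le> ((2 * L + 4 * V) * ?s) / \<bar>?D\<bar>"
  proof (rule divide_right_mono)
    have "norm ((v ?y - v ?e) * of_real (1 / q)) \<le> (L * ?s) * 2"
      unfolding norm_mult norm_of_real using va inv2 qh L(1) s0 by (intro mult_mono) auto
    moreover have "norm (v ?e * of_real (1 / q - 1)) \<le> V * (4 * ?s)"
      unfolding norm_mult norm_of_real using V[OF eI] inv1 V0 by (intro mult_mono) auto
    ultimately have "norm ((v ?y - v ?e) * of_real (1 / q) + v ?e * of_real (1 / q - 1)) \<le> (L * ?s) * 2 + V * (4 * ?s)"
      by (rule norm_triangle_mono)
    then show "norm ((v ?y - v ?e) * of_real (1 / q) + v ?e * of_real (1 / q - 1)) \<le> (2 * L + 4 * V) * ?s"
      by (simp add: algebra_simps)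
  qed simp
  finally show ?thesis .
qed

definition psum :: "(real \<Rightarrow> complex) \<Rightarrow> nat \<Rightarrow> real \<Rightarrow> complex" where
  "psum v n x = - (\<Sum>j<n. cand_term f v x j)"

text \<open>
  The bound is linear in \<open>\<bar>w\<bar>\<close>: each gap is split into two square roots, one of them estimated by the
  tolerance and the other by \<open>sqrt A\<^sub>l * \<bar>w\<bar>\<close>, and \<open>sqrt A\<^sub>l\<close> is absorbed by
  \<open>ex_critical_derivative_interpolation\<close>. The constant does not depend on \<eta>, so the factor
  \<open>sqrt \<eta>\<close> can be made as small as desired.
\<close>
lemma ex_bound_sum_estimate:
  assumes V: "\<And>x. x \<in> I \<Longrightarrow> norm (v x) \<le> V"
    and L: "0 \<le> L" "\<And>x y. x \<in> I \<Longrightarrow> y \<in> I \<Longrightarrow> norm (v x - v y) \<le> L * \<bar>x - y\<bar>"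
  shows "\<exists>K\<ge>0. \<forall>\<eta> w p. 0 < \<eta> \<and> \<eta> \<le> \<eta>0 \<and> w \<in> I \<and> bound \<eta> w p \<longrightarrow>
    norm (psum v p (f w) - psum v p (f 0)) \<le> K * sqrt \<eta> * \<bar>w\<bar>"
proof -
  obtain N where N: "N > 0" "\<And>i j. i \<le> j \<Longrightarrow>
     N * sqrt \<bar>Df i (f 0)\<bar> * exp (3 / 2 * g * real (Suc j)) \<le> \<bar>Df (Suc j) (f 0)\<bar>"
    using ex_critical_derivative_interpolation by blast
  define E where "E = B / (\<kappa> * b0) * exp g * sqrt (3 / 2 * B * b0)"
  have E: "0 \<le> E" using B_pos kappa_pos b0(1) by (simp add: E_def)
  have V0: "0 \<le> V" using V[of 0] norm_ge_zero[of "v 0"] by (simp del: norm_ge_zero) 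
  define G where "G = 2 * L + 4 * V"
  have G: "0 \<le> G" using V0 L(1) by (simp add: G_def)
  define K where "K = G * E / N * (2 / g) * (1 / (1 - exp (- g)))"
  have g1: "0 < 1 - exp (- g)" using g_pos by simp
  have K: "0 \<le> K" using G E N(1) g_pos g1 by (simp add: K_def)
  have "norm (psum v p (f w) - psum v p (f 0)) \<le> K * sqrt \<eta> * \<bar>w\<bar>"
    if b: "bound \<eta> w p" "0 < \<eta>" "\<eta> \<le> \<eta>0" "w \<in> I" for \<eta> w p
  proof -
    have "norm (psum v p (f w) - psum v p (f 0)) = norm (\<Sum>j<p. cand_term f v (f w) j - cand_term f v (f 0) j)"
      by (simp add: psum_def sum_subtractf norm_minus_commute)
    also have "\<dots> \<le> (\<Sum>j<p. G * E / N * (2 / g) * sqrt \<eta> * \<bar>w\<bar> * exp (- g * real j))"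
    proof (rule sum_norm_le)
      fix j assume "j \<in> {..<p}"
      then have j: "j < p" by simp
      let ?D = "\<bar>Df (Suc j) (f 0)\<bar>" and ?J = "real (Suc j)"
      have D: "0 < ?D" using Df_critical_value_ne_0 by simp
      have "distortion w l / ?D \<le> E * sqrt \<eta> * \<bar>w\<bar> / N * exp (- (3 / 2 * g * ?J))" if "l \<le> j" for l
      proof -
        have "distortion w l \<le> E * sqrt \<eta> * \<bar>w\<bar> * sqrt \<bar>Df l (f 0)\<bar>"
          unfolding E_def using that j by (intro bound_distortion_le_sqrt[OF b(1) _ b(2-4)]) auto
        also have "\<dots> \<le> E * sqrt \<eta> * \<bar>w\<bar> * (?D / N * exp (- (3 / 2 * g * ?J)))"
        proof (rule mult_left_mono)
          have "sqrt \<bar>Df l (f 0)\<bar> * (N * exp (3 / 2 * g * ?J)) \<le> ?D" using N(2)[OF that] by (simp add: ac_simps)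
          then show "sqrt \<bar>Df l (f 0)\<bar> \<le> ?D / N * exp (- (3 / 2 * g * ?J))"
            using N(1) by (simp add: exp_minus field_simps del: of_nat_Suc)
        qed (use E b(2) in simp)
        finally show ?thesis using D by (simp add: field_simps del: of_nat_Suc)
      qed
      then have "(\<Sum>l\<le>j. distortion w l / ?D) \<le> (\<Sum>l\<le>j. E * sqrt \<eta> * \<bar>w\<bar> / N * exp (- (3 / 2 * g * ?J)))"
        by (intro sum_mono) simp
      also have "\<dots> = E * sqrt \<eta> * \<bar>w\<bar> / N * (?J * exp (- (3 / 2 * g * ?J)))" by (simp del: of_nat_Suc)
      also have "\<dots> \<le> E * sqrt \<eta> * \<bar>w\<bar> / N * (2 / g * exp (- g * real j))"
      proof (rule mult_left_mono)
        \<comment> \<open>a third of the exponential decay absorbs the number of summands\<close>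
        have "g / 2 * ?J \<le> exp (g / 2 * ?J)" using exp_ge_add_one_self[of "g / 2 * ?J"] by linarith
        then have "?J \<le> 2 / g * exp (g / 2 * ?J)" using g_pos by (simp add: field_simps del: of_nat_Suc)
        then have "?J * exp (- (3 / 2 * g * ?J)) \<le> 2 / g * exp (g / 2 * ?J) * exp (- (3 / 2 * g * ?J))"
          by (rule mult_right_mono) simp
        also have "exp (g / 2 * ?J) * exp (- (3 / 2 * g * ?J)) = exp (- g * ?J)" for x :: real
          by (simp add: algebra_simps del: of_nat_Suc flip: exp_add)
        then have "2 / g * exp (g / 2 * ?J) * exp (- (3 / 2 * g * ?J)) = 2 / g * exp (- g * ?J)" by (simp only: mult.assoc)
        also have "\<dots> \<le> 2 / g * exp (- g * real j)" using g_pos by (intro mult_left_mono) auto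
        finally show "?J * exp (- (3 / 2 * g * ?J)) \<le> 2 / g * exp (- g * real j)" .
      qed (use E N(1) b(2) in simp)
      finally have sum: "(\<Sum>l\<le>j. distortion w l) / ?D \<le> E * sqrt \<eta> * \<bar>w\<bar> / N * (2 / g * exp (- g * real j))"
        by (simp add: sum_divide_distrib)
      have "norm (cand_term f v (f w) j - cand_term f v (f 0) j) \<le> G * ((\<Sum>l\<le>j. distortion w l) / ?D)"
        unfolding G_def using cand_term_difference[OF b j V L] by simp
      also have "\<dots> \<le> G * (E * sqrt \<eta> * \<bar>w\<bar> / N * (2 / g * exp (- g * real j)))"
        using sum G by (rule mult_left_mono)
      finally show "norm (cand_term f v (f w) j - cand_term f v (f 0) j)
          \<le> G * E / N * (2 / g) * sqrt \<eta> * \<bar>w\<bar> * exp (- g * real j)" by (simp add: ac_simps)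
    qed
    also have "\<dots> = G * E / N * (2 / g) * sqrt \<eta> * \<bar>w\<bar> * (\<Sum>j<p. exp (- g * real j))" by (simp only: sum_distrib_left)
    also have "\<dots> \<le> G * E / N * (2 / g) * sqrt \<eta> * \<bar>w\<bar> * (1 / (1 - exp (- g)))"
      using sum_exp_le[OF g_pos, of p] G E N(1) g_pos b(2) by (intro mult_left_mono mult_nonneg_nonneg) auto
    finally show ?thesis by (simp add: K_def ac_simps)
  qed
  then show ?thesis using K by blast
qed

lemma ex_released_tail_estimate:
  assumes V: "\<And>x. x \<in> I \<Longrightarrow> norm (v x) \<le> V" and h: "horizontal f v" and eta: "0 < \<eta>" "\<eta> \<le> \<eta>0"
  shows "\<exists>K\<ge>0. \<forall>w p. w \<in> I \<and> released \<eta> w p \<longrightarrow>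
    norm (psum v p (f 0) - v 0) \<le> K * exp (- (g / 2) * real p) * \<bar>w\<bar>"
proof -
  obtain N where N: "N > 0" "\<And>i j. i \<le> j \<Longrightarrow>
     N * sqrt \<bar>Df i (f 0)\<bar> * exp (3 / 2 * g * real (Suc j)) \<le> \<bar>Df (Suc j) (f 0)\<bar>"
    using ex_critical_derivative_interpolation by blast
  have V0: "0 \<le> V" using V[of 0] norm_ge_zero[of "v 0"] by (simp del: norm_ge_zero)
  let ?a = "3 / 2 * g" and ?c = "cand_term f v (f 0)"
  have a: "0 < ?a" using g_pos by simp
  have e1: "exp (- ?a) < 1" using a by simp
  define Z where "Z = sqrt (3 / 2 * B / (\<eta> * b0))"
  define K where "K = V / N * (1 / (1 - exp (- ?a))) * Z"
  have K: "0 \<le> K" using V0 N(1) e1 B_pos eta b0(1) by (simp add: K_def Z_def)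
  have "norm (psum v p (f 0) - v 0) \<le> K * exp (- (g / 2) * real p) * \<bar>w\<bar>"
    if w: "w \<in> I" "released \<eta> w p" for w p
  proof -
    let ?A = "\<bar>Df p (f 0)\<bar>"
    have A: "0 < ?A" using Df_critical_value_ne_0 by simp
    have summ: "summable ?c" "v 0 = - (\<Sum>j. ?c j)" using h by (auto simp: horizontal_def)
    have "psum v p (f 0) - v 0 = (\<Sum>j. ?c (j + p))"
      using suminf_split_initial_segment[OF summ(1), of p] summ(2) by (simp add: psum_def)
    also have "norm \<dots> \<le> (\<Sum>j. V / (N * sqrt ?A) * exp (- ?a * real p) * exp (- ?a) ^ j)"
    proof (rule norm_suminf_le)
      show "summable (\<lambda>j. V / (N * sqrt ?A) * exp (- ?a * real p) * exp (- ?a) ^ j)"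
        using e1 by (intro summable_mult summable_geometric) auto
      fix j
      let ?J = "real (Suc (j + p))"
      have low: "N * sqrt ?A * exp (?a * ?J) \<le> \<bar>Df (Suc (j + p)) (f 0)\<bar>" by (rule N(2)) simp
      have "norm (?c (j + p)) \<le> V / (N * sqrt ?A * exp (?a * ?J))"
        unfolding cand_term_Df norm_divide norm_of_real
        using V[OF iterate_in_I[OF f0_in_I]] V0 low N(1) A by (intro frac_le) auto
      also have "\<dots> = V / (N * sqrt ?A) * exp (- (?a * ?J))" by (simp add: exp_minus field_simps del: of_nat_Suc)
      also have "\<dots> \<le> V / (N * sqrt ?A) * (exp (- ?a * real p) * exp (- ?a) ^ j)"
      proof (rule mult_left_mono)
        have "exp (- ?a) ^ j = exp (- ?a * real j)" by (simp add: exp_of_nat_mult[symmetric] mult.commute)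
        then have "exp (- ?a * real p) * exp (- ?a) ^ j = exp (- ?a * real (j + p))" by (simp add: algebra_simps flip: exp_add)
        moreover have "- (?a * ?J) \<le> - ?a * real (j + p)" using g_pos by simp
        ultimately show "exp (- (?a * ?J)) \<le> exp (- ?a * real p) * exp (- ?a) ^ j" by (simp only: exp_le_cancel_iff)
      qed (use V0 N(1) in simp)
      finally show "norm (?c (j + p)) \<le> V / (N * sqrt ?A) * exp (- ?a * real p) * exp (- ?a) ^ j" by (simp add: mult.assoc)
    qed
    also have "\<dots> = V / (N * sqrt ?A) * exp (- ?a * real p) * (1 / (1 - exp (- ?a)))"
      using e1 by (subst suminf_mult) (auto simp: suminf_geometric)
    also have "\<dots> = V / N * exp (- ?a * real p) * (1 / (1 - exp (- ?a))) * (1 / sqrt ?A)" by simp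
    also have "\<dots> \<le> V / N * exp (- ?a * real p) * (1 / (1 - exp (- ?a))) * (Z * exp (g * real p) * \<bar>w\<bar>)"
    proof (rule mult_left_mono)
      show "1 / sqrt ?A \<le> Z * exp (g * real p) * \<bar>w\<bar>"
      proof (rule power2_le_imp_le)
        have "\<eta> * b0 * exp (- (2 * g) * real p) \<le> 3 / 2 * B * (?A * w\<^sup>2)" using released_size[OF w(2) eta w(1)] by simp
        then have "1 / ?A \<le> 3 / 2 * B / (\<eta> * b0) * exp (2 * g * real p) * w\<^sup>2"
          using A eta(1) b0(1) by (simp add: exp_minus field_simps)
        also have "\<dots> = (Z * exp (g * real p) * \<bar>w\<bar>)\<^sup>2"
          using eta(1) b0(1) B_pos by (simp add: Z_def power_mult_distrib exp_double[symmetric] mult.assoc)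
        finally show "(1 / sqrt ?A)\<^sup>2 \<le> (Z * exp (g * real p) * \<bar>w\<bar>)\<^sup>2" by (simp add: power_divide)
      qed (use eta(1) b0(1) B_pos in \<open>simp add: Z_def\<close>)
    qed (use V0 N(1) e1 in simp)
    also have "\<dots> = K * (exp (- ?a * real p) * exp (g * real p)) * \<bar>w\<bar>" by (simp add: K_def ac_simps)
    also have "exp (- ?a * real p) * exp (g * real p) = exp (- (g / 2) * real p)" by (simp add: algebra_simps flip: exp_add)
    finally show ?thesis .
  qed
  then show ?thesis using K by blast
qed

text \<open>
  The tolerance \<eta> is chosen first, to make the error within the bound period small; then \<open>w\<close> is taken so close to 0 that
  the bound period is long, which makes the tail of the horizontality series small.
\<close>
theorem bound_period_cancellation:
  assumes V: "\<And>x. x \<in> I \<Longrightarrow> norm (v x) \<le> V"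
    and L: "0 \<le> L" "\<And>x y. x \<in> I \<Longrightarrow> y \<in> I \<Longrightarrow> norm (v x - v y) \<le> L * \<bar>x - y\<bar>"
    and h: "horizontal f v" and \<epsilon>: "0 < \<epsilon>"
  shows "\<exists>\<delta>>0. \<forall>w\<in>I. w \<noteq> 0 \<and> \<bar>w\<bar> \<le> \<delta> \<longrightarrow>
    (\<exists>p. 1 / \<epsilon> \<le> \<bar>Df (Suc p) w\<bar> \<and> (\<forall>i<p. (f ^^ i) (f w) \<noteq> 0) \<and> norm (psum v p (f w) - v 0) \<le> \<epsilon> * \<bar>w\<bar>)"
proof -
  obtain K1 where K1: "0 \<le> K1" "\<And>\<eta> w p. 0 < \<eta> \<Longrightarrow> \<eta> \<le> \<eta>0 \<Longrightarrow> w \<in> I \<Longrightarrow> bound \<eta> w p \<Longrightarrow>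
    norm (psum v p (f w) - psum v p (f 0)) \<le> K1 * sqrt \<eta> * \<bar>w\<bar>"
    using ex_bound_sum_estimate[OF V L] by blast
  define \<eta> where "\<eta> = min \<eta>0 ((\<epsilon> / (2 * (K1 + 1)))\<^sup>2)"
  have eta: "0 < \<eta>" "\<eta> \<le> \<eta>0" using eta0_pos \<epsilon> K1(1) by (auto simp: \<eta>_def)
  have "sqrt \<eta> \<le> \<epsilon> / (2 * (K1 + 1))" using \<epsilon> K1(1) by (intro real_le_lsqrt) (auto simp: \<eta>_def)
  then have "K1 * sqrt \<eta> \<le> (K1 + 1) * (\<epsilon> / (2 * (K1 + 1)))" using K1(1) eta by (intro mult_mono) auto
  also have "\<dots> = \<epsilon> / 2" using K1(1) by (simp add: field_simps)
  finally have s1: "K1 * sqrt \<eta> \<le> \<epsilon> / 2" .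
  obtain K2 where K2: "0 \<le> K2" "\<And>w p. w \<in> I \<Longrightarrow> released \<eta> w p \<Longrightarrow>
    norm (psum v p (f 0) - v 0) \<le> K2 * exp (- (g / 2) * real p) * \<bar>w\<bar>"
    using ex_released_tail_estimate[OF V h eta] by blast
  obtain P1 where P1: "\<And>p w. p > P1 \<Longrightarrow> w \<in> I \<Longrightarrow> released \<eta> w p \<Longrightarrow> 1 / \<epsilon> \<le> \<bar>Df (Suc p) w\<bar>"
    using ex_released_growth[OF eta] by blast
  obtain P2 where "2 * K2 / \<epsilon> < exp (g / 2) ^ P2" using real_arch_pow[of "exp (g / 2)"] g_pos by auto
  then have P2: "2 * K2 / \<epsilon> < exp (g / 2 * real P2)" by (simp add: exp_of_nat_mult[symmetric] mult.commute)
  obtain \<delta> where \<delta>: "\<delta> > 0" "\<And>w. w \<in> I \<Longrightarrow> w \<noteq> 0 \<Longrightarrow> \<bar>w\<bar> \<le> \<delta> \<Longrightarrow> \<exists>p>max P1 P2. released \<eta> w p"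
    using ex_long_bound_period[OF eta] by blast
  have "\<exists>p. 1 / \<epsilon> \<le> \<bar>Df (Suc p) w\<bar> \<and> (\<forall>i<p. (f ^^ i) (f w) \<noteq> 0) \<and> norm (psum v p (f w) - v 0) \<le> \<epsilon> * \<bar>w\<bar>"
    if w: "w \<in> I" "w \<noteq> 0" "\<bar>w\<bar> \<le> \<delta>" for w
  proof -
    obtain p where p: "p > max P1 P2" "released \<eta> w p" using \<delta>(2)[OF w] by blast
    have b: "bound \<eta> w p" using p(2) by (simp add: released_def)
    have "g / 2 * real P2 \<le> g / 2 * real p" using p(1) g_pos by simp
    then have "2 * K2 / \<epsilon> \<le> exp (g / 2 * real p)" using P2 by (meson exp_le_cancel_iff less_imp_le order_trans)
    then have s2: "K2 * exp (- (g / 2) * real p) \<le> \<epsilon> / 2" using \<epsilon> by (simp add: exp_minus field_simps)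
    have "norm (psum v p (f w) - v 0) \<le> norm (psum v p (f w) - psum v p (f 0)) + norm (psum v p (f 0) - v 0)"
      using norm_triangle_ineq[of "psum v p (f w) - psum v p (f 0)" "psum v p (f 0) - v 0"] by simp
    also have "\<dots> \<le> K1 * sqrt \<eta> * \<bar>w\<bar> + K2 * exp (- (g / 2) * real p) * \<bar>w\<bar>"
      by (intro add_mono K1(2)[OF eta w(1) b] K2(2)[OF w(1) p(2)])
    also have "\<dots> \<le> \<epsilon> / 2 * \<bar>w\<bar> + \<epsilon> / 2 * \<bar>w\<bar>" by (intro add_mono mult_right_mono s1 s2) auto
    finally have "norm (psum v p (f w) - v 0) \<le> \<epsilon> * \<bar>w\<bar>" by (simp add: algebra_simps)
    then show ?thesis using P1[OF _ w(1) p(2)] p(1) bound_orbit_ne_0[OF b _ eta] by auto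
  qed
  then show ?thesis using \<delta>(1) by blast
qed

section \<open>The twisted cohomological equation\<close>

lemma psum_0 [simp]: "psum v 0 x = 0"
  by (simp add: psum_def)

lemma psum_add:
  assumes "x \<in> I"
  shows "psum v (m + n) x = psum v m x + psum v n ((f ^^ m) x) / of_real (Df m x)"
proof -
  have "cand_term f v x (m + j) = cand_term f v ((f ^^ m) x) j / of_real (Df m x)" for j
    using Df_add[OF assms, of m "Suc j"] unfolding cand_term_Df by (simp add: iterate_add)
  then show ?thesis by (simp add: psum_def sum_lessThan_add sum_divide_distrib)
qed

lemma psum_Suc: "x \<in> I \<Longrightarrow> psum v (Suc n) x = (psum v n (f x) - v x) / of_real (D f x)"
  using psum_add[of x v 1 n] by (simp add: psum_def cand_term_Df diff_divide_distrib)

lemma TCE_iterate: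
  assumes "TCE f v \<alpha>" "x \<in> I" "\<And>j. j < n \<Longrightarrow> (f ^^ j) x \<noteq> 0"
  shows "\<alpha> x = psum v n x + \<alpha> ((f ^^ n) x) / of_real (Df n x)"
  using assms(2,3)
proof (induction n arbitrary: x)
  case (Suc n)
  have "(f ^^ j) (f x) \<noteq> 0" if "j < n" for j
    using Suc.prems(2)[of "Suc j"] that by (simp only: iterate_Suc_shift) simp
  then have IH: "\<alpha> (f x) = psum v n (f x) + \<alpha> ((f ^^ n) (f x)) / of_real (Df n (f x))"
    using Suc.IH maps_I Suc.prems(1) by blast
  have D0: "D f x \<noteq> 0" using D_eq_0_iff[OF Suc.prems(1)] Suc.prems(2)[of 0] by simp
  have "v x = \<alpha> (f x) - of_real (D f x) * \<alpha> x" using assms(1) Suc.prems(1) unfolding TCE_def by blast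
  then have "\<alpha> x = (\<alpha> (f x) - v x) / of_real (D f x)" using D0 by (simp add: field_simps)
  also have "\<dots> = psum v (Suc n) x + \<alpha> ((f ^^ Suc n) x) / of_real (Df (Suc n) x)"
    unfolding IH psum_Suc[OF Suc.prems(1)] Df_Suc[OF Suc.prems(1)]
    by (simp add: iterate_Suc_shift add_divide_distrib diff_divide_distrib del: funpow_Suc_apply)
  finally show ?case .
qed simp

lemma Df_cv_tends_to_infinity: "(\<lambda>n. inverse \<bar>Df n (f 0)\<bar>) \<longlonglongrightarrow> 0"
proof (rule tendsto_sandwich[of "\<lambda>_. 0"])
  have "(\<lambda>n. inverse a0 * (inverse lam) ^ n) \<longlonglongrightarrow> inverse a0 * 0"
    using lam_gt_1 by (intro tendsto_mult tendsto_const LIMSEQ_power_zero) (auto simp: field_simps)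
  then show "(\<lambda>n. inverse a0 * (inverse lam) ^ n) \<longlonglongrightarrow> 0" by simp
  have "inverse \<bar>Df n (f 0)\<bar> \<le> inverse (a0 * lam ^ n)" for n
    using a0(1) lam_gt_1 by (intro le_imp_inverse_le a0(3)) auto
  then show "\<forall>\<^sub>F n in sequentially. inverse \<bar>Df n (f 0)\<bar> \<le> inverse a0 * (inverse lam) ^ n"
    by (simp add: power_inverse)
qed auto

lemma psum_at_critical_value_tendsto:
  assumes "\<And>n. norm (l - psum v n (f 0)) * \<bar>Df n (f 0)\<bar> \<le> A"
  shows "(\<lambda>n. psum v n (f 0)) \<longlonglongrightarrow> l"
proof (rule LIM_zero_cancel, rule Lim_null_comparison)
  have "norm (psum v n (f 0) - l) \<le> A * inverse \<bar>Df n (f 0)\<bar>" for n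
    using assms[of n] Df_critical_value_ne_0[of n] by (simp add: norm_minus_commute field_simps)
  then show "\<forall>\<^sub>F n in sequentially. norm (psum v n (f 0) - l) \<le> A * inverse \<bar>Df n (f 0)\<bar>" by simp
  show "(\<lambda>n. A * inverse \<bar>Df n (f 0)\<bar>) \<longlonglongrightarrow> 0"
    using tendsto_mult_left[OF Df_cv_tends_to_infinity, of A] by simp
qed

text \<open>
  Off the preimages of the critical point the derivatives of the iterates are unbounded, so at most one
  value can be the start of a bounded solution of the equation along the orbit.
\<close>
lemma bounded_value_unique:
  assumes x: "x \<in> I" "\<And>j. (f ^^ j) x \<noteq> 0"
    and "\<And>n. norm (l - s n) * \<bar>Df n x\<bar> \<le> A" "\<And>n. norm (l' - s n) * \<bar>Df n x\<bar> \<le> A"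
  shows "(l :: complex) = l'"
proof (rule ccontr)
  assume ne: "l \<noteq> l'"
  obtain n where n: "2 * A / norm (l - l') < \<bar>Df n x\<bar>" using derivatives_unbounded[OF x] by blast
  have "norm (l - l') \<le> norm (l - s n) + norm (l' - s n)"
    using norm_triangle_ineq4[of "l - s n" "l' - s n"] by simp
  then have "norm (l - l') * \<bar>Df n x\<bar> \<le> (norm (l - s n) + norm (l' - s n)) * \<bar>Df n x\<bar>"
    by (rule mult_right_mono) simp
  also have "\<dots> \<le> 2 * A" using assms(3)[of n] assms(4)[of n] by (simp add: distrib_right)
  finally show False using n ne by (simp add: field_simps)
qed

lemma bounded_solution_estimate:
  assumes "TCE f v \<alpha>" "\<And>x. x \<in> I \<Longrightarrow> norm (\<alpha> x) \<le> A" "x \<in> I" "\<And>j. j < n \<Longrightarrow> (f ^^ j) x \<noteq> 0"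
  shows "norm (\<alpha> x - psum v n x) * \<bar>Df n x\<bar> \<le> A"
proof -
  have "Df n x \<noteq> 0" using Df_eq_0_iff[OF assms(3)] assms(4) by blast
  then have "norm (\<alpha> x - psum v n x) * \<bar>Df n x\<bar> = norm (\<alpha> ((f ^^ n) x))"
    using TCE_iterate[OF assms(1,3,4)] by (simp add: norm_divide)
  then show ?thesis using assms(2)[OF iterate_in_I[OF assms(3)]] by simp
qed

lemma ex_bound_on_I: "bounded (\<alpha> ` I) \<Longrightarrow> \<exists>A>0. \<forall>x\<in>I. norm (\<alpha> x) \<le> A"
  for \<alpha> :: "real \<Rightarrow> complex"
  by (metis bounded_pos imageI)

definition first_hit :: "nat \<Rightarrow> real \<Rightarrow> bool" where
  "first_hit n x \<longleftrightarrow> (f ^^ n) x = 0 \<and> (\<forall>j<n. (f ^^ j) x \<noteq> 0)"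

lemma ex_first_hit: "\<exists>j. (f ^^ j) x = 0 \<Longrightarrow> \<exists>n. first_hit n x"
  unfolding first_hit_def by (rule exists_least_iff[THEN iffD1])

lemma first_hit_shift: "first_hit n x \<Longrightarrow> m \<le> n \<Longrightarrow> first_hit (n - m) ((f ^^ m) x)"
  unfolding first_hit_def by (simp add: iterate_add)

lemma alpha_cand_first_hit: "first_hit n x \<Longrightarrow> alpha_cand f v x = psum v n x"
proof -
  assume h: "first_hit n x"
  then have "(LEAST j. (f ^^ j) x = 0) = n"
    unfolding first_hit_def by (intro Least_equality) (auto simp: not_less[symmetric])
  then show ?thesis using h unfolding alpha_cand_def psum_def first_hit_def by auto
qed

theorem bounded_solution_unique:
  assumes \<alpha>: "bounded (\<alpha> ` I)" "\<alpha> 0 = 0" "TCE f v \<alpha>" and \<beta>: "bounded (\<beta> ` I)" "\<beta> 0 = 0" "TCE f v \<beta>"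
    and x: "x \<in> I"
  shows "\<beta> x = \<alpha> x"
proof (cases "\<exists>j. (f ^^ j) x = 0")
  case True
  then obtain n where "first_hit n x" using ex_first_hit by blast
  then have n: "(f ^^ n) x = 0" "\<And>j. j < n \<Longrightarrow> (f ^^ j) x \<noteq> 0" by (auto simp: first_hit_def)
  show ?thesis using TCE_iterate[OF \<alpha>(3) x n(2)] TCE_iterate[OF \<beta>(3) x n(2)] n(1) \<alpha>(2) \<beta>(2) by simp
next
  case False
  obtain A1 A2 where A: "\<And>x. x \<in> I \<Longrightarrow> norm (\<alpha> x) \<le> A1" "\<And>x. x \<in> I \<Longrightarrow> norm (\<beta> x) \<le> A2"
    using ex_bound_on_I[OF \<alpha>(1)] ex_bound_on_I[OF \<beta>(1)] by blast
  have A': "norm (\<alpha> x) \<le> max A1 A2" "norm (\<beta> x) \<le> max A1 A2" if "x \<in> I" for x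
    using A[OF that] by auto
  show ?thesis
    by (rule bounded_value_unique[OF x _ bounded_solution_estimate[OF \<beta>(3) A'(2) x]
          bounded_solution_estimate[OF \<alpha>(3) A'(1) x]]) (use False in auto)
qed

lemma cv_orbit_not_hit: "(f ^^ j) (f 0) \<noteq> 0"
  using cv_orbit_ne_0[of j] by (simp only: cv_orbit not_False_eq_True)

theorem bounded_solution_horizontal:
  assumes \<alpha>: "bounded (\<alpha> ` I)" "\<alpha> 0 = 0" "TCE f v \<alpha>"
  shows "horizontal f v"
proof -
  obtain A where A: "\<And>x. x \<in> I \<Longrightarrow> norm (\<alpha> x) \<le> A" using ex_bound_on_I[OF \<alpha>(1)] by blast
  have "v 0 = \<alpha> (f 0) - of_real (D f 0) * \<alpha> 0" using \<alpha>(3) unfolding TCE_def by simp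
  then have v0: "\<alpha> (f 0) = v 0" using \<alpha>(2) by simp
  have "(\<lambda>n. psum v n (f 0)) \<longlonglongrightarrow> v 0"
    unfolding v0[symmetric] using bounded_solution_estimate[OF \<alpha>(3) A f0_in_I] cv_orbit_not_hit
    by (intro psum_at_critical_value_tendsto) blast
  then have "(\<lambda>n. - psum v n (f 0)) \<longlonglongrightarrow> - v 0" by (rule tendsto_minus)
  then have "cand_term f v (f 0) sums (- v 0)" by (simp add: sums_def psum_def)
  then show ?thesis unfolding horizontal_def by (simp add: sums_iff)
qed

section \<open>Construction of a continuous solution\<close>

text \<open>
  Induction on the hitting time. The orbit first spends some time away from 0, which contributes a bounded sum; then it
  comes close to 0, and during the bound period the sum is bounded by
  cancellation. Afterwards the hitting time is smaller, and the bound for it is multiplied by at most 1/2: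
  the derivative is at least \<open>2 R1\<close> before the bound period and at least \<open>1 / R1\<close> over it.
\<close>
lemma ex_preimage_bound:
  assumes V: "\<And>x. x \<in> I \<Longrightarrow> norm (v x) \<le> V"
    and L: "0 \<le> L" "\<And>x y. x \<in> I \<Longrightarrow> y \<in> I \<Longrightarrow> norm (v x - v y) \<le> L * \<bar>x - y\<bar>"
    and L': "0 \<le> L'" "\<And>x. x \<in> I \<Longrightarrow> norm (v 0 - v x) \<le> L' * x\<^sup>2"
    and h: "horizontal f v"
  shows "\<exists>A. \<forall>x\<in>I. \<forall>n. first_hit n x \<longrightarrow> norm (psum v n x) \<le> A"
proof -
  obtain \<delta>' where \<delta>': "\<delta>' > 0" "\<And>w. w \<in> I \<Longrightarrow> w \<noteq> 0 \<Longrightarrow> \<bar>w\<bar> \<le> \<delta>' \<Longrightarrow>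
    \<exists>p. 1 / R1 \<le> \<bar>Df (Suc p) w\<bar> \<and> (\<forall>i<p. (f ^^ i) (f w) \<noteq> 0) \<and> norm (psum v p (f w) - v 0) \<le> R1 * \<bar>w\<bar>"
    using bound_period_cancellation[OF V L h R1_pos] by blast
  define \<delta> where "\<delta> = min \<delta>' R1"
  have \<delta>: "0 < \<delta>" "\<delta> \<le> R1" "\<delta> \<le> \<delta>'" using \<delta>' R1_pos by (auto simp: \<delta>_def)
  obtain K where K: "K > 0" "\<And>x n. x \<in> I \<Longrightarrow> (\<And>j. j < n \<Longrightarrow> \<delta> \<le> \<bar>(f ^^ j) x\<bar>) \<Longrightarrow> (\<Sum>j<n. 1 / \<bar>Df (Suc j) x\<bar>) \<le> K"
    using ex_away_sum[OF \<delta>(1)] by blast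
  have V0: "0 \<le> V" using V[of 0] norm_ge_zero[of "v 0"] by (simp del: norm_ge_zero)
  define E where "E = (R1 + L') / \<kappa>"
  have E: "0 \<le> E" using R1_pos L'(1) kappa_pos by (simp add: E_def)
  define A where "A = 2 * (V * K + E / (2 * R1))"
  have A: "0 \<le> A" using V0 K(1) E R1_pos by (simp add: A_def)
  have "norm (psum v n x) \<le> A" if "x \<in> I" "first_hit n x" for x n
    using that
  proof (induction n arbitrary: x rule: less_induct)
    case (less n)
    have ex: "\<exists>j. \<bar>(f ^^ j) x\<bar> < \<delta>" using less.prems(2) \<delta>(1) by (auto simp: first_hit_def intro: exI[of _ n])
    define m where "m = (LEAST j. \<bar>(f ^^ j) x\<bar> < \<delta>)"
    have m: "\<bar>(f ^^ m) x\<bar> < \<delta>" unfolding m_def using ex by (rule LeastI_ex)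
    have before: "\<delta> \<le> \<bar>(f ^^ j) x\<bar>" if "j < m" for j
      using not_less_Least[of j "\<lambda>j. \<bar>(f ^^ j) x\<bar> < \<delta>"] that by (auto simp: m_def)
    have mn: "m \<le> n" unfolding m_def using less.prems(2) \<delta>(1) by (intro Least_le) (simp add: first_hit_def)
    let ?w = "(f ^^ m) x"
    have wI: "?w \<in> I" by (rule iterate_in_I[OF less.prems(1)])
    have Dm: "2 * R1 \<le> \<bar>Df m x\<bar>"
      using before m by (intro entry_derivative[OF \<delta>(1,2) less.prems(1)]) auto
    have "norm (psum v m x) \<le> (\<Sum>j<m. V * (1 / \<bar>Df (Suc j) x\<bar>))"
      unfolding psum_def norm_minus_cancel
    proof (rule sum_norm_le)
      show "norm (cand_term f v x j) \<le> V * (1 / \<bar>Df (Suc j) x\<bar>)" for j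
        using V[OF iterate_in_I[OF less.prems(1)]]
        by (simp add: cand_term_Df norm_divide divide_right_mono)
    qed
    also have "\<dots> \<le> V * K"
      unfolding sum_distrib_left[symmetric] using K(2)[OF less.prems(1) before] V0 by (intro mult_left_mono) auto
    finally have first: "norm (psum v m x) \<le> V * K" .
    have "norm (psum v (n - m) ?w) \<le> E + R1 * A"
    proof (cases "?w = 0")
      case True
      then have "n - m = 0" using first_hit_shift[OF less.prems(2) mn] unfolding first_hit_def
        by (metis funpow_0 gr0I)
      then show ?thesis using E R1_pos A by simp
    next
      case False
      have hw: "first_hit (n - m) ?w" by (rule first_hit_shift[OF less.prems(2) mn])
      obtain n' where n': "n - m = Suc n'" using hw False by (cases "n - m") (auto simp: first_hit_def)
      obtain p where p: "1 / R1 \<le> \<bar>Df (Suc p) ?w\<bar>" "\<And>i. i < p \<Longrightarrow> (f ^^ i) (f ?w) \<noteq> 0"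
        "norm (psum v p (f ?w) - v 0) \<le> R1 * \<bar>?w\<bar>"
        using \<delta>'(2)[OF wI False] m \<delta>(3) by (auto simp: less_imp_le)
      have "(f ^^ n') (f ?w) = 0" using hw n' by (simp only: first_hit_def iterate_Suc_shift)
      then have pn: "p \<le> n'" using p(2) by (meson not_le)
      let ?z = "(f ^^ Suc p) ?w"
      have zI: "?z \<in> I" by (rule iterate_in_I[OF wI])
      have "norm (psum v (n' - p) ?z) \<le> A"
      proof (rule less.IH[OF _ zI])
        show "n' - p < n" using n' by simp
        show "first_hit (n' - p) ?z" using first_hit_shift[OF hw, of "Suc p"] n' pn by simp
      qed
      moreover have "norm (psum v (Suc p) ?w) \<le> E"
      proof -
        have "norm (psum v p (f ?w) - v ?w) \<le> norm (psum v p (f ?w) - v 0) + norm (v 0 - v ?w)"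
          by (rule norm_diff_triangle)
        also have "\<dots> \<le> R1 * \<bar>?w\<bar> + L' * ?w\<^sup>2" by (intro add_mono p(3) L'(2) wI)
        also have "L' * ?w\<^sup>2 \<le> L' * \<bar>?w\<bar>"
        proof (rule mult_left_mono[OF _ L'(1)])
          have "\<bar>?w\<bar> * \<bar>?w\<bar> \<le> 1 * \<bar>?w\<bar>" using wI by (intro mult_right_mono) (auto simp: abs_le_iff)
          then show "?w\<^sup>2 \<le> \<bar>?w\<bar>" by (simp add: power2_eq_square)
        qed
        finally have "norm (psum v p (f ?w) - v ?w) \<le> (R1 + L') * \<bar>?w\<bar>" by (simp add: distrib_right)
        then have "norm (psum v (Suc p) ?w) \<le> ((R1 + L') * \<bar>?w\<bar>) / (\<kappa> * \<bar>?w\<bar>)"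
          unfolding psum_Suc[OF wI] norm_divide norm_of_real
          using D_lower[OF wI] kappa_pos False R1_pos L'(1) by (intro frac_le) auto
        then show ?thesis using False by (simp add: E_def)
      qed
      moreover have "psum v (n - m) ?w = psum v (Suc p) ?w + psum v (n' - p) ?z / of_real (Df (Suc p) ?w)"
        using psum_add[OF wI, of v "Suc p" "n' - p"] n' pn by simp
      moreover have "norm (psum v (n' - p) ?z / of_real (Df (Suc p) ?w)) \<le> A / (1 / R1)"
        unfolding norm_divide norm_of_real using calculation(1) p(1) R1_pos A by (intro frac_le) auto
      ultimately show ?thesis
        using norm_triangle_mono[of "psum v (Suc p) ?w" E "psum v (n' - p) ?z / of_real (Df (Suc p) ?w)" "A / (1 / R1)"]
        by (simp add: mult.commute)
    qed
    then have "norm (psum v (n - m) ?w / of_real (Df m x)) \<le> (E + R1 * A) / (2 * R1)"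
      unfolding norm_divide norm_of_real using Dm R1_pos A E by (intro frac_le) auto
    moreover have "psum v n x = psum v m x + psum v (n - m) ?w / of_real (Df m x)"
      using psum_add[OF less.prems(1), of v m "n - m"] mn by simp
    ultimately have "norm (psum v n x) \<le> V * K + (E + R1 * A) / (2 * R1)"
      using norm_triangle_mono[OF first] by metis
    also have "\<dots> = A" using R1_pos by (simp add: A_def field_simps)
    finally show ?case .
  qed
  then show ?thesis by blast
qed

lemma tendsto_psum:
  assumes v: "continuous_on I v" and y: "x \<in> I" "\<And>j. j < n \<Longrightarrow> (f ^^ j) x \<noteq> 0"
    and F: "(y \<longlongrightarrow> x) F" "\<forall>\<^sub>F k in F. y k \<in> I"
  shows "((\<lambda>k. psum v n (y k)) \<longlongrightarrow> psum v n x) F"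
  unfolding psum_def cand_term_Df
proof (intro tendsto_minus tendsto_sum tendsto_divide tendsto_of_real)
  fix j assume "j \<in> {..<n}"
  have "continuous_on I (\<lambda>t. v ((f ^^ j) t))"
    by (rule continuous_on_compose2[OF v continuous_iterate iterate_image])
  then show "((\<lambda>k. v ((f ^^ j) (y k))) \<longlongrightarrow> v ((f ^^ j) x)) F"
    by (rule continuous_on_tendsto_compose[OF _ F(1) y(1) F(2)])
  show "((\<lambda>k. Df (Suc j) (y k)) \<longlongrightarrow> Df (Suc j) x) F"
    by (rule continuous_on_tendsto_compose[OF continuous_Df F(1) y(1) F(2)])
  have "\<forall>i<Suc j. (f ^^ i) x \<noteq> 0" using y(2) \<open>j \<in> {..<n}\<close> by (simp add: less_Suc_eq)
  then show "of_real (Df (Suc j) x) \<noteq> (0::complex)"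
    using Df_eq_0_iff[OF y(1), of "Suc j"] by auto
qed

lemma tendsto_Df:
  "x \<in> I \<Longrightarrow> (y \<longlongrightarrow> x) F \<Longrightarrow> \<forall>\<^sub>F k in F. y k \<in> I \<Longrightarrow> ((\<lambda>k. Df n (y k)) \<longlongrightarrow> Df n x) F"
  using continuous_on_tendsto_compose[OF continuous_Df] by blast

lemma eventually_orbit_ne_0:
  assumes y: "x \<in> I" "\<And>j. j < n \<Longrightarrow> (f ^^ j) x \<noteq> 0"
    and F: "(y \<longlongrightarrow> x) F" "\<forall>\<^sub>F k in F. y k \<in> I"
  shows "\<forall>\<^sub>F k in F. \<forall>j\<in>{..<n}. (f ^^ j) (y k) \<noteq> 0"
proof (rule eventually_ball_finite)
  show "\<forall>j\<in>{..<n}. \<forall>\<^sub>F k in F. (f ^^ j) (y k) \<noteq> 0"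
    using continuous_on_tendsto_compose[OF continuous_iterate F(1) y(1) F(2)] y(2)
    by (auto intro!: tendsto_imp_eventually_ne)
qed simp

text \<open>
  Limit of the values at preimages of 0 that converge to \<open>x\<close>. For fixed \<open>n\<close> and a preimage \<open>y\<close> close to \<open>x\<close>, the hitting time
  of \<open>y\<close> exceeds \<open>n\<close>, and the remainder after \<open>n\<close> terms is the value at \<open>f\<^sup>n y\<close>
  divided by the derivative.
\<close>
lemma ex_limit_value:
  assumes v: "continuous_on I v" and A: "\<And>x n. x \<in> I \<Longrightarrow> first_hit n x \<Longrightarrow> norm (psum v n x) \<le> A"
    and x: "x \<in> I" "\<And>j. (f ^^ j) x \<noteq> 0"
  shows "\<exists>l. \<forall>n. norm (l - psum v n x) * \<bar>Df n x\<bar> \<le> A"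
proof -
  have "\<exists>y h. y \<in> I \<and> \<bar>x - y\<bar> < inverse (real (Suc k)) \<and> first_hit h y" for k
    using precritical_dense[OF x(1), of "inverse (real (Suc k))"] ex_first_hit by (metis inverse_positive_iff_positive of_nat_0_less_iff zero_less_Suc)
  then obtain y h where y: "\<And>k. y k \<in> I" "\<And>k. \<bar>x - y k\<bar> < inverse (real (Suc k))" "\<And>k. first_hit (h k) (y k)"
    by metis
  have ylim: "y \<longlonglongrightarrow> x"
  proof (rule LIM_zero_cancel, rule Lim_null_comparison)
    show "\<forall>\<^sub>F k in sequentially. norm (y k - x) \<le> inverse (real (Suc k))"
      using y(2) by (intro always_eventually) (auto simp: abs_minus_commute intro: less_imp_le)
  qed (rule LIMSEQ_inverse_real_of_nat)
  define a where "a k = psum v (h k) (y k)" for k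
  have "\<forall>k. a k \<in> cball 0 A" using A[OF y(1) y(3)] by (simp add: a_def)
  then obtain l r where r: "strict_mono r" "(a \<circ> r) \<longlonglongrightarrow> l"
    by (rule seq_compactE[OF compact_imp_seq_compact[OF compact_cball]])
  have yr: "(\<lambda>k. y (r k)) \<longlonglongrightarrow> x" using LIMSEQ_subseq_LIMSEQ[OF ylim r(1)] by (simp add: o_def)
  have yI: "\<forall>\<^sub>F k in sequentially. y (r k) \<in> I" using y(1) by (intro always_eventually) blast
  have "norm (l - psum v n x) * \<bar>Df n x\<bar> \<le> A" for n
  proof (rule tendsto_upperbound)
    show "((\<lambda>k. norm ((a \<circ> r) k - psum v n (y (r k))) * \<bar>Df n (y (r k))\<bar>)
        \<longlongrightarrow> norm (l - psum v n x) * \<bar>Df n x\<bar>) sequentially"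
      by (intro tendsto_mult tendsto_norm tendsto_diff tendsto_rabs r(2)
          tendsto_psum[OF v x(1) _ yr yI] tendsto_Df[OF x(1) yr yI] x(2))
    show "\<forall>\<^sub>F k in sequentially. norm ((a \<circ> r) k - psum v n (y (r k))) * \<bar>Df n (y (r k))\<bar> \<le> A"
      using eventually_orbit_ne_0[OF x(1) x(2) yr yI, of "Suc n"]
    proof eventually_elim
      case (elim k)
      let ?y = "y (r k)" and ?h = "h (r k)"
      have yk: "?y \<in> I" and hk: "first_hit ?h ?y" using y by auto
      have "n \<le> ?h" using elim hk unfolding first_hit_def by (metis lessThan_iff less_Suc_eq_le linorder_not_le less_imp_le)
      have "Df n ?y \<noteq> 0" using Df_eq_0_iff[OF yk] elim by auto
      moreover have "psum v ?h ?y = psum v n ?y + psum v (?h - n) ((f ^^ n) ?y) / of_real (Df n ?y)"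
        using psum_add[OF yk, of v n "?h - n"] \<open>n \<le> ?h\<close> by simp
      ultimately have "norm (psum v ?h ?y - psum v n ?y) * \<bar>Df n ?y\<bar> = norm (psum v (?h - n) ((f ^^ n) ?y))"
        by (simp add: norm_divide)
      also have "\<dots> \<le> A" by (rule A[OF iterate_in_I[OF yk] first_hit_shift[OF hk \<open>n \<le> ?h\<close>]])
      finally show ?case by (simp add: a_def)
    qed
  qed simp
  then show ?thesis by blast
qed

lemma Lipschitz_composition_estimates:
  assumes X: "L-lipschitz_on I X" and vX: "\<And>x. x \<in> I \<Longrightarrow> v x = X (f x)"
  shows "0 \<le> L" and "x \<in> I \<Longrightarrow> y \<in> I \<Longrightarrow> norm (v x - v y) \<le> (L * B) * \<bar>x - y\<bar>"
    and "x \<in> I \<Longrightarrow> norm (v 0 - v x) \<le> (L * B) * x\<^sup>2"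
proof -
  show L: "0 \<le> L" using X by (rule lipschitz_on_nonneg)
  have XL: "norm (v x - v y) \<le> L * \<bar>f x - f y\<bar>" if "x \<in> I" "y \<in> I" for x y
    using lipschitz_onD[OF X maps_I[OF that(1)] maps_I[OF that(2)]] vX that by (simp add: dist_norm)
  show "norm (v x - v y) \<le> (L * B) * \<bar>x - y\<bar>" if xy: "x \<in> I" "y \<in> I" for x y
  proof -
    have "\<bar>f x - f y\<bar> \<le> B * \<bar>x - y\<bar>"
    proof (rule field_differentiable_bound[of I f "D f", simplified real_norm_def])
      show "\<bar>D f z\<bar> \<le> B" if "z \<in> I" for z
      proof -
        have "B * \<bar>z\<bar> \<le> B * 1" using that B_pos by (intro mult_left_mono) (auto simp: abs_le_iff)
        then show ?thesis using D_upper[OF that] by linarith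
      qed
    qed (use xy deriv0 in auto)
    then have "L * \<bar>f x - f y\<bar> \<le> L * (B * \<bar>x - y\<bar>)" using L by (rule mult_left_mono)
    then show ?thesis using XL[OF xy] by simp
  qed
  show "norm (v 0 - v x) \<le> (L * B) * x\<^sup>2" if x: "x \<in> I" for x
  proof -
    have "\<bar>f 0 - f x\<bar> \<le> B * x\<^sup>2" using critical_value_upper[OF x] f_le_critical_value[OF x] by simp
    then have "L * \<bar>f 0 - f x\<bar> \<le> L * (B * x\<^sup>2)" using L by (rule mult_left_mono)
    then show ?thesis using XL[of 0 x] x by simp
  qed
qed

theorem continuous_solution_exists:
  assumes X: "L-lipschitz_on I X" and vX: "\<And>x. x \<in> I \<Longrightarrow> v x = X (f x)" and h: "horizontal f v"
  shows "\<exists>\<alpha> :: real \<Rightarrow> complex. continuous_on I \<alpha> \<and> \<alpha> 0 = 0 \<and> TCE f v \<alpha> \<and>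
     (\<forall>x\<in>I. (\<exists>j. (f ^^ j) x = 0) \<or> summable (\<lambda>j. norm (cand_term f v x j)) \<longrightarrow> \<alpha> x = alpha_cand f v x)"
proof -
  note est = Lipschitz_composition_estimates[OF X vX]
  have LB: "0 \<le> L * B" using est(1) B_pos by simp
  have cv: "continuous_on I v"
    by (rule lipschitz_on_continuous_on[of "L * B"], rule lipschitz_onI)
      (use est(2) LB in \<open>auto simp: dist_norm dist_real_def\<close>)
  have "bounded (v ` I)" by (intro compact_imp_bounded compact_continuous_image cv) simp
  then obtain V where V: "\<And>x. x \<in> I \<Longrightarrow> norm (v x) \<le> V" using ex_bound_on_I by blast
  obtain A0 where A0: "\<And>x n. x \<in> I \<Longrightarrow> first_hit n x \<Longrightarrow> norm (psum v n x) \<le> A0"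
    using ex_preimage_bound[OF V LB est(2) LB est(3) h] by blast
  define A where "A = max A0 1"
  have A: "0 < A" "\<And>x n. x \<in> I \<Longrightarrow> first_hit n x \<Longrightarrow> norm (psum v n x) \<le> A"
    using A0 by (auto simp: A_def le_max_iff_disj)
  define \<alpha> where "\<alpha> x = (if \<exists>j. (f ^^ j) x = 0 then alpha_cand f v x
     else (SOME l. \<forall>n. norm (l - psum v n x) * \<bar>Df n x\<bar> \<le> A))" for x
  have free: "norm (\<alpha> x - psum v n x) * \<bar>Df n x\<bar> \<le> A" if "x \<in> I" "\<And>j. (f ^^ j) x \<noteq> 0" for x n
    using someI_ex[OF ex_limit_value[OF cv A(2) that]] that(2) by (simp add: \<alpha>_def)
  have hit: "\<alpha> x = psum v n x" if "first_hit n x" for x n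
    using that alpha_cand_first_hit[OF that] by (auto simp: \<alpha>_def first_hit_def)
  have a0: "\<alpha> 0 = 0" using hit[of 0 0] by (simp add: first_hit_def)
  have bnd: "norm (\<alpha> x) \<le> A" if "x \<in> I" for x
  proof (cases "\<exists>j. (f ^^ j) x = 0")
    case True
    then show ?thesis using ex_first_hit hit A(2)[OF that] by metis
  next
    case False
    then show ?thesis using free[OF that, of 0] that by simp
  qed
  have tce: "TCE f v \<alpha>"
    unfolding TCE_def
  proof
    fix x assume x: "x \<in> I"
    consider "x = 0" | n where "x \<noteq> 0" "first_hit n x" | "x \<noteq> 0" "\<And>j. (f ^^ j) x \<noteq> 0"
      using ex_first_hit by blast
    then show "v x = \<alpha> (f x) - of_real (D f x) * \<alpha> x"
    proof cases
      case 1
      have "(\<lambda>n. psum v n (f 0)) \<longlonglongrightarrow> \<alpha> (f 0)"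
        by (rule psum_at_critical_value_tendsto[OF free[OF f0_in_I cv_orbit_not_hit]])
      moreover have "(\<lambda>n. psum v n (f 0)) \<longlonglongrightarrow> v 0"
        using summable_LIMSEQ[of "cand_term f v (f 0)", THEN tendsto_minus] h by (simp add: psum_def horizontal_def)
      ultimately have "\<alpha> (f 0) = v 0" by (rule LIMSEQ_unique)
      then show ?thesis using 1 a0 by simp
    next
      case 2
      obtain m where m: "n = Suc m" using 2 by (cases n) (auto simp: first_hit_def)
      have "first_hit m (f x)" using first_hit_shift[OF 2(2), of 1] m by simp
      then have "\<alpha> (f x) = psum v m (f x)" by (rule hit)
      moreover have "\<alpha> x = (psum v m (f x) - v x) / of_real (D f x)"
        using hit[OF 2(2)] psum_Suc[OF x] m by simp
      moreover have "D f x \<noteq> 0" using D_eq_0_iff[OF x] 2(1) by simp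
      ultimately show ?thesis by simp
    next
      case 3
      have fx: "f x \<in> I" "\<And>j. (f ^^ j) (f x) \<noteq> 0"
        using maps_I[OF x] 3(2)[of "Suc j" for j] by (simp_all only: iterate_Suc_shift) auto
      have D0: "D f x \<noteq> 0" using D_eq_0_iff[OF x] 3(1) by simp
      have "norm (of_real (D f x) * \<alpha> x + v x - psum v n (f x)) * \<bar>Df n (f x)\<bar> \<le> A" for n
      proof -
        have "of_real (D f x) * \<alpha> x + v x - psum v n (f x) = of_real (D f x) * (\<alpha> x - psum v (Suc n) x)"
          unfolding psum_Suc[OF x] using D0 by (simp add: field_simps)
        then have "norm (of_real (D f x) * \<alpha> x + v x - psum v n (f x)) * \<bar>Df n (f x)\<bar>
            = norm (\<alpha> x - psum v (Suc n) x) * \<bar>Df (Suc n) x\<bar>"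
          using Df_Suc[OF x, of n] by (simp add: norm_mult abs_mult ac_simps)
        then show ?thesis using free[OF x 3(2), of "Suc n"] by simp
      qed
      then have "of_real (D f x) * \<alpha> x + v x = \<alpha> (f x)"
        by (rule bounded_value_unique[OF fx _ free[OF fx]])
      then show ?thesis by (simp add: algebra_simps)
    qed
  qed
  have at0: "(\<alpha> \<longlongrightarrow> 0) (at 0 within I)"
    unfolding tendsto_iff
  proof (intro allI impI)
    fix e :: real assume e: "0 < e"
    define \<epsilon> where "\<epsilon> = e / (2 * (1 / \<kappa> + A))"
    have kA: "0 < 1 / \<kappa> + A" using kappa_pos A(1) by (simp add: add_pos_pos)
    have \<epsilon>: "0 < \<epsilon>" using e kA by (simp add: \<epsilon>_def)
    obtain \<delta> where \<delta>: "\<delta> > 0" "\<And>w. w \<in> I \<Longrightarrow> w \<noteq> 0 \<Longrightarrow> \<bar>w\<bar> \<le> \<delta> \<Longrightarrow>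
      \<exists>p. 1 / \<epsilon> \<le> \<bar>Df (Suc p) w\<bar> \<and> (\<forall>i<p. (f ^^ i) (f w) \<noteq> 0) \<and> norm (psum v p (f w) - v 0) \<le> \<epsilon> * \<bar>w\<bar>"
      using bound_period_cancellation[OF V LB est(2) h \<epsilon>] by blast
    define d where "d = min \<delta> (e * \<kappa> / (2 * (L * B + 1)))"
    have d: "0 < d" "d \<le> \<delta>" "d \<le> e * \<kappa> / (2 * (L * B + 1))" using \<delta>(1) e kappa_pos LB by (auto simp: d_def)
    have "dist (\<alpha> w) 0 < e" if w: "w \<in> I" "w \<noteq> 0" "\<bar>w\<bar> < d" for w
    proof -
      obtain p where p: "1 / \<epsilon> \<le> \<bar>Df (Suc p) w\<bar>" "\<And>i. i < p \<Longrightarrow> (f ^^ i) (f w) \<noteq> 0"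
        "norm (psum v p (f w) - v 0) \<le> \<epsilon> * \<bar>w\<bar>" using \<delta>(2)[OF w(1,2)] w(3) d(2) by auto
      have "(f ^^ j) w \<noteq> 0" if "j < Suc p" for j
        using p(2)[of "j - 1"] that w(2) by (cases j) (simp_all only: iterate_Suc_shift diff_Suc_1 Suc_less_eq funpow_0 not_False_eq_True)
      then have "\<alpha> w = psum v (Suc p) w + \<alpha> ((f ^^ Suc p) w) / of_real (Df (Suc p) w)"
        by (rule TCE_iterate[OF tce w(1)])
      moreover have "norm (\<alpha> ((f ^^ Suc p) w) / of_real (Df (Suc p) w)) \<le> A / (1 / \<epsilon>)"
        unfolding norm_divide norm_of_real using bnd[OF iterate_in_I[OF w(1), of "Suc p"]] p(1) \<epsilon> A(1) by (intro frac_le) auto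
      moreover have "norm (psum v (Suc p) w) \<le> \<epsilon> / \<kappa> + L * B / \<kappa> * \<bar>w\<bar>"
      proof -
        have "norm (psum v p (f w) - v w) \<le> norm (psum v p (f w) - v 0) + norm (v 0 - v w)"
          by (rule norm_diff_triangle)
        also have "\<dots> \<le> \<epsilon> * \<bar>w\<bar> + (L * B) * w\<^sup>2" by (intro add_mono p(3) est(3) w(1))
        also have "\<dots> = (\<epsilon> + L * B * \<bar>w\<bar>) * \<bar>w\<bar>" by (simp add: algebra_simps power2_eq_square)
        finally have "norm (psum v (Suc p) w) \<le> ((\<epsilon> + L * B * \<bar>w\<bar>) * \<bar>w\<bar>) / (\<kappa> * \<bar>w\<bar>)"
          unfolding psum_Suc[OF w(1)] norm_divide norm_of_real
          using D_lower[OF w(1)] kappa_pos w(2) \<epsilon> LB by (intro frac_le) auto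
        then show ?thesis using w(2) by (simp add: add_divide_distrib)
      qed
      ultimately have "norm (\<alpha> w) \<le> (\<epsilon> / \<kappa> + L * B / \<kappa> * \<bar>w\<bar>) + A / (1 / \<epsilon>)"
        using norm_triangle_mono by metis
      also have "\<dots> = \<epsilon> * (1 / \<kappa> + A) + L * B / \<kappa> * \<bar>w\<bar>" by (simp add: algebra_simps)
      also have "\<epsilon> * (1 / \<kappa> + A) = e / 2"
      proof -
        have "e / (2 * S) * S = e / 2" if "0 < S" for S using that by simp
        then show ?thesis unfolding \<epsilon>_def using kA by blast
      qed
      also have "L * B / \<kappa> * \<bar>w\<bar> < e / 2"
      proof -
        have "L * B / \<kappa> * \<bar>w\<bar> \<le> (L * B + 1) / \<kappa> * \<bar>w\<bar>" using kappa_pos by (intro mult_right_mono divide_right_mono) auto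
        also have "\<dots> < (L * B + 1) / \<kappa> * (e * \<kappa> / (2 * (L * B + 1)))"
          using w(3) d(3) kappa_pos LB by (intro mult_strict_left_mono) auto
        also have "\<dots> = e / 2"
        proof -
          have "T / \<kappa> * (e * \<kappa> / (2 * T)) = e / 2" if "0 < T" for T using that kappa_pos by simp
          then show ?thesis using LB by (simp only: add_nonneg_pos zero_less_one)
        qed
        finally show ?thesis .
      qed
      finally show ?thesis by simp
    qed
    then show "\<forall>\<^sub>F w in at 0 within I. dist (\<alpha> w) 0 < e"
      unfolding eventually_at using d(1) by (intro exI[of _ d]) (auto simp: dist_real_def)
  qed
  have cont0: "continuous (at 0 within I) \<alpha>" using at0 a0 by (simp add: continuous_within)
  have cont: "continuous_on I \<alpha>"
    unfolding continuous_on_eq_continuous_within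
  proof
    fix x assume x: "x \<in> I"
    have lim: "((\<lambda>y. y) \<longlongrightarrow> x) (at x within I)" by (rule tendsto_ident_at)
    have inI: "\<forall>\<^sub>F y in at x within I. y \<in> I" by (simp add: eventually_at_filter)
    show "continuous (at x within I) \<alpha>"
    proof (cases "\<exists>j. (f ^^ j) x = 0")
      case True
      then obtain n where n: "first_hit n x" using ex_first_hit by blast
      then have ne: "\<And>j. j < n \<Longrightarrow> (f ^^ j) x \<noteq> 0" and fn: "(f ^^ n) x = 0" by (auto simp: first_hit_def)
      have D0: "of_real (Df n x) \<noteq> (0::complex)" using Df_eq_0_iff[OF x] ne by auto
      have lim\<alpha>: "((\<lambda>y. \<alpha> ((f ^^ n) y)) \<longlongrightarrow> 0) (at x within I)"
      proof -
        have "continuous (at x within I) (f ^^ n)"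
          using continuous_iterate x by (simp only: continuous_on_eq_continuous_within)
        moreover have "continuous (at ((f ^^ n) x) within (f ^^ n) ` I) \<alpha>"
          unfolding fn by (rule continuous_within_subset[OF cont0 iterate_image])
        ultimately have "continuous (at x within I) (\<alpha> \<circ> (f ^^ n))" by (rule continuous_within_compose)
        then show ?thesis using fn a0 by (simp add: continuous_within o_def)
      qed
      have ev: "\<forall>\<^sub>F y in at x within I. \<forall>j\<in>{..<n}. (f ^^ j) y \<noteq> 0"
        by (rule eventually_orbit_ne_0[OF x _ lim inI]) (rule ne)
      from lim\<alpha> have "((\<lambda>y. psum v n y + \<alpha> ((f ^^ n) y) / of_real (Df n y)) \<longlongrightarrow> psum v n x + 0 / of_real (Df n x)) (at x within I)"
        by (intro tendsto_add tendsto_divide tendsto_of_real tendsto_psum[OF cv x ne lim inI] tendsto_Df[OF x lim inI] D0)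
      moreover have "\<forall>\<^sub>F y in at x within I. psum v n y + \<alpha> ((f ^^ n) y) / of_real (Df n y) = \<alpha> y"
        using ev inI
      proof eventually_elim
        case (elim y)
        then show ?case using TCE_iterate[OF tce elim(2), of n] by simp
      qed
      ultimately have "(\<alpha> \<longlongrightarrow> psum v n x + 0 / of_real (Df n x)) (at x within I)" by (rule Lim_transform_eventually)
      then show ?thesis using hit[OF n] by (simp add: continuous_within)
    next
      case False
      then have ne: "\<And>j. (f ^^ j) x \<noteq> 0" by blast
      have "(\<alpha> \<longlongrightarrow> \<alpha> x) (at x within I)"
        unfolding tendsto_iff
      proof (intro allI impI)
        fix e :: real assume e: "0 < e"
        obtain n where n: "3 * A / e < \<bar>Df n x\<bar>" using derivatives_unbounded[OF x ne] by blast
        have close: "norm (\<alpha> y - psum v n y) < e / 3"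
          if "y \<in> I" "\<And>j. j < n \<Longrightarrow> (f ^^ j) y \<noteq> 0" "3 * A / e < \<bar>Df n y\<bar>" for y
        proof -
          have "norm (\<alpha> y - psum v n y) * \<bar>Df n y\<bar> \<le> A" by (rule bounded_solution_estimate[OF tce bnd that(1,2)])
          also have "A < e / 3 * \<bar>Df n y\<bar>" using that(3) e by (simp add: field_simps)
          finally show ?thesis by (rule mult_right_less_imp_less) simp
        qed
        have "\<forall>\<^sub>F y in at x within I. 3 * A / e < \<bar>Df n y\<bar>"
          by (rule order_tendstoD(1)[OF tendsto_rabs[OF tendsto_Df[OF x lim inI]] n])
        moreover have "\<forall>\<^sub>F y in at x within I. dist (psum v n y) (psum v n x) < e / 3"
          using tendstoD[OF tendsto_psum[OF cv x ne lim inI], of "e / 3" n] e by simp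
        ultimately show "\<forall>\<^sub>F y in at x within I. dist (\<alpha> y) (\<alpha> x) < e"
          using eventually_orbit_ne_0[where n = n, OF x ne lim inI] inI
        proof eventually_elim
          case (elim y)
          have 1: "norm (\<alpha> y - psum v n y) < e / 3" using close[of y] elim by auto
          have 2: "norm (\<alpha> x - psum v n x) < e / 3" using close[of x] x ne n by auto
          have "norm (\<alpha> y - \<alpha> x) \<le> norm (\<alpha> y - psum v n y) + norm (psum v n y - psum v n x) + norm (psum v n x - \<alpha> x)"
            using norm_diff_triangle[of "\<alpha> y" "\<alpha> x" "psum v n y"] norm_diff_triangle[of "psum v n y" "\<alpha> x" "psum v n x"]
            by linarith
          then show ?case using 1 2 elim(2) by (simp add: dist_norm norm_minus_commute)
        qed
      qed
      then show ?thesis by (simp add: continuous_within)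
    qed
  qed
  have "\<alpha> x = alpha_cand f v x" if x: "x \<in> I" and s: "(\<exists>j. (f ^^ j) x = 0) \<or> summable (\<lambda>j. norm (cand_term f v x j))" for x
  proof (cases "\<exists>j. (f ^^ j) x = 0")
    case True then show ?thesis by (simp add: \<alpha>_def)
  next
    case False
    then have ne: "\<And>j. (f ^^ j) x \<noteq> 0" by blast
    have "summable (cand_term f v x)" using s False by (blast intro: summable_norm_cancel)
    then have lim: "(\<lambda>n. psum v n x) \<longlonglongrightarrow> alpha_cand f v x"
      using False summable_LIMSEQ[THEN tendsto_minus] unfolding psum_def alpha_cand_def by simp
    show ?thesis
    proof (rule ccontr)
      assume "\<alpha> x \<noteq> alpha_cand f v x"
      then have pos: "0 < norm (\<alpha> x - alpha_cand f v x) / 2" (is "0 < ?d") by simp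
      have "(\<lambda>n. norm (\<alpha> x - psum v n x)) \<longlonglongrightarrow> norm (\<alpha> x - alpha_cand f v x)" by (intro tendsto_intros lim)
      then have "\<forall>\<^sub>F n in sequentially. ?d < norm (\<alpha> x - psum v n x)"
        by (rule order_tendstoD(1)) (use pos in simp)
      then obtain N where N: "\<And>n. n \<ge> N \<Longrightarrow> ?d < norm (\<alpha> x - psum v n x)" unfolding eventually_sequentially by blast
      obtain n where n: "A / ?d + (\<Sum>i<N. \<bar>Df i x\<bar>) < \<bar>Df n x\<bar>" using derivatives_unbounded[OF x ne] by blast
      have "N \<le> n"
      proof (rule ccontr)
        assume "\<not> N \<le> n"
        then have "\<bar>Df n x\<bar> \<le> (\<Sum>i<N. \<bar>Df i x\<bar>)" by (intro member_le_sum) auto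
        moreover have "0 < A / ?d" using A(1) pos by (rule divide_pos_pos)
        ultimately show False using n by linarith
      qed
      have "0 \<le> (\<Sum>i<N. \<bar>Df i x\<bar>)" by (simp add: sum_nonneg)
      then have "A / ?d < \<bar>Df n x\<bar>" using n by linarith
      then have "A < ?d * \<bar>Df n x\<bar>" using pos by (simp only: pos_divide_less_eq mult.commute)
      also have "\<dots> \<le> norm (\<alpha> x - psum v n x) * \<bar>Df n x\<bar>" using N[OF \<open>N \<le> n\<close>] by (intro mult_right_mono) auto
      finally show False using free[OF x ne, of n] by simp
    qed
  qed
  then show ?thesis using cont a0 tce by blast
qed

end

theorem theorem2p4:
  fixes f :: "real \<Rightarrow> real" and lam :: real and H0 :: nat
  assumes "S_unimodal f"
    and repelling_endpoint: "D f (-1) > 1"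
    and "collet_eckmann lam H0 f"
    and "benedicks_carleson lam H0 f"
  shows
    "(\<forall>v :: real \<Rightarrow> complex. bounded (v ` I) \<longrightarrow>
        (\<forall>\<alpha> :: real \<Rightarrow> complex.
           bounded (\<alpha> ` I) \<and> \<alpha> c = 0 \<and> TCE f v \<alpha> \<longrightarrow>
             (\<forall>\<beta> :: real \<Rightarrow> complex.
                bounded (\<beta> ` I) \<and> \<beta> c = 0 \<and> TCE f v \<beta> \<longrightarrow> (\<forall>x\<in>I. \<beta> x = \<alpha> x)) \<and>
             horizontal f v)) \<and>
     (\<forall>(X :: real \<Rightarrow> complex) (v :: real \<Rightarrow> complex).
        (\<exists>L. L-lipschitz_on I X) \<and> (\<forall>x\<in>I. v x = X (f x)) \<and> horizontal f v \<longrightarrow>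
          (\<exists>\<alpha> :: real \<Rightarrow> complex.
             continuous_on I \<alpha> \<and> \<alpha> c = 0 \<and> TCE f v \<alpha> \<and>
             (\<forall>x\<in>I. (\<exists>j. (f ^^ j) x = c) \<or> summable (\<lambda>j. norm (cand_term f v x j)) \<longrightarrow>
                \<alpha> x = alpha_cand f v x)))"
proof -
  obtain g where g: "0 < g" "g < ln lam / 4" "\<And>k. k \<ge> H0 \<Longrightarrow> exp (- g * real k) \<le> \<bar>(f ^^ k) 0\<bar>"
    using assms(4) unfolding benedicks_carleson_def by auto
  interpret collet_eckmann_map f lam H0 g
    using assms g by unfold_locales
  show ?thesis
  proof (intro conjI allI impI ballI; (elim conjE exE)?)
    fix v \<alpha> \<beta> :: "real \<Rightarrow> complex" and x
    assume "bounded (\<alpha> ` I)" "\<alpha> 0 = 0" "TCE f v \<alpha>" "bounded (\<beta> ` I)" "\<beta> 0 = 0" "TCE f v \<beta>" "x \<in> I"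
    then show "\<beta> x = \<alpha> x" by (rule bounded_solution_unique)
  next
    fix v \<alpha> :: "real \<Rightarrow> complex"
    assume "bounded (\<alpha> ` I)" "\<alpha> 0 = 0" "TCE f v \<alpha>"
    then show "horizontal f v" by (rule bounded_solution_horizontal)
  next
    fix X v :: "real \<Rightarrow> complex" and L
    assume "L-lipschitz_on I X" "\<forall>x\<in>I. v x = X (f x)" "horizontal f v"
    then show "\<exists>\<alpha> :: real \<Rightarrow> complex. continuous_on I \<alpha> \<and> \<alpha> 0 = 0 \<and> TCE f v \<alpha> \<and>
        (\<forall>x\<in>I. (\<exists>j. (f ^^ j) x = 0) \<or> summable (\<lambda>j. norm (cand_term f v x j)) \<longrightarrow>
          \<alpha> x = alpha_cand f v x)"
      by (intro continuous_solution_exists) auto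
  qed
qed

end
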